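(* Let $G = (G_x)_{x \in X}$ be a Borel field of Polish groups. Assume that every $G_x$ is locally compact. Consider the family $\widehat{G} = (\widehat{G}_x)_{x \in X}$ of their Pontryagin duals. There is a unique standard Borel structure on $\widehat{G}$ such that the maps $\pi : \widehat{G} \to X$ and $\widehat{G} \times_\pi G \to \mathbb{T} : (\omega,g) \mapsto \omega(g)$ are Borel. In this way, $\widehat{G}$ is a Borel field of Polish groups.
   Context: Conventions. A standard Borel space is a measurable space isomorphic to a Borel subset of a Polish space. Product spaces carry the product $\sigma$-algebra and subsets the restricted $\sigma$-algebra. For a family of sets $V = (V_x)_{x\in X}$, the symbol $V$ also denotes the disjoint union of the $V_x$, and $\pi : V \to X$ is the map with $\pi(v) = x$ for $v \in V_x$. For two families over $X$, $V \times_\pi W = \{(v,w) \in V \times W \mid \pi(v)=\pi(w)\}$. A section is a map $\varphi : X \to V$ with $\varphi(x)\in V_x$ for all $x$. A sequence of Borel sections $\varphi_n : X \to V$ is dense if $\{\varphi_n(x) \mid n\in\mathbb{N}\}$ is dense in $V_x$ for every $x\in X$. For a locally compact group $L$ (not necessarily abelian), the Pontryagin dual $\widehat{L}$ is the group of continuous homomorphisms $L\to\mathbb{T}=\{z\in\mathbb{C}\mid|z|=1\}$, equipped with the compact-open topology. A Borel field of Polish spaces consists of a standard Borel space $X$, a family $V=(V_x)_{x\in X}$ of Polish spaces and a standard Borel structure on $V$ such that: (1) $\pi : V\to X$ is Borel; (2) there is a Borel map $d : V\times_\pi V\to[0,+\infty)$ whose restriction to each $V_x\times V_x$ is a separable complete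 metric inducing the topology of $V_x$; (3) there is a dense sequence of Borel sections $X\to V$. A Borel field of Polish groups is a family $G=(G_x)_{x\in X}$ of Polish groups over a standard Borel space $X$ with a standard Borel structure on $G$ such that $G$ is a Borel field of Polish spaces and the unit section $X\to G : x\mapsto e_x$, the inverse $G\to G$ and the multiplication $G\times_\pi G\to G$ are Borel. *)

theory Defs
  imports "HOL-Analysis.Analysis" "HOL-Algebra.Group"
begin

section \<open>Standard Borel spaces\<close>

text \<open>A Borel structure is represented by a value of type \<open>'a measure\<close>, of which only
  \<^const>\<open>space\<close> and \<^const>\<open>sets\<close> matter; the measure itself is never used.\<close>

definition Polish_topology :: "'a topology \<Rightarrow> bool" where
  "Polish_topology T \<longleftrightarrow> completely_metrizable_space T \<and> separable_space T"

definition borel_of :: "'a topology \<Rightarrow> 'a measure" where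
  "borel_of T = sigma (topspace T) {U. openin T U}"

definition Borel_isomorphic :: "'a measure \<Rightarrow> 'b measure \<Rightarrow> bool" where
  "Borel_isomorphic M N \<longleftrightarrow>
     (\<exists>f g. f \<in> M \<rightarrow>\<^sub>M N \<and> g \<in> N \<rightarrow>\<^sub>M M \<and>
        (\<forall>x\<in>space M. g (f x) = x) \<and> (\<forall>y\<in>space N. f (g y) = y))"

text \<open>HOL cannot quantify existentially over the type of points of the ambient Polish space.
  Fixing that type to be \<^typ>\<open>real\<close> is no restriction, because the carrier and the topology of
  \<open>T\<close> are arbitrary (unrelated to the usual topology of the reals) and a Polish space has at most
  continuum many points, so that every Polish space is homeomorphic to such a \<open>T\<close>.\<close>

definition standard_Borel :: "'a measure \<Rightarrow> bool" where
  "standard_Borel M \<longleftrightarrow>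
     (\<exists>(T :: real topology) B. Polish_topology T \<and> B \<in> sets (borel_of T) \<and>
        Borel_isomorphic M (restrict_space (borel_of T) B))"

section \<open>Borel fields of Polish spaces\<close>

text \<open>A family \<open>V = (V\<^sub>x)\<close> of topological spaces over the space \<open>X\<close> is a function \<open>T\<close> into topologies
  on a common type. The disjoint union is formed with \<^const>\<open>Sigma\<close>, so the \<open>V\<^sub>x\<close> may overlap as
  subsets of that type, and \<open>\<pi>\<close> is \<^const>\<open>fst\<close>.\<close>

definition total_space :: "'x measure \<Rightarrow> ('x \<Rightarrow> 'v topology) \<Rightarrow> ('x \<times> 'v) set" where
  "total_space X T = (SIGMA x:space X. topspace (T x))"

definition fibre_product ::
    "('x \<times> 'v) measure \<Rightarrow> ('x \<times> 'w) measure \<Rightarrow> (('x \<times> 'v) \<times> ('x \<times> 'w)) measure" where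
  "fibre_product M N =
     restrict_space (M \<Otimes>\<^sub>M N) {(v, w). v \<in> space M \<and> w \<in> space N \<and> fst v = fst w}"

definition Borel_section :: "'x measure \<Rightarrow> ('x \<times> 'v) measure \<Rightarrow> ('x \<Rightarrow> 'x \<times> 'v) \<Rightarrow> bool" where
  "Borel_section X M \<phi> \<longleftrightarrow> \<phi> \<in> X \<rightarrow>\<^sub>M M \<and> (\<forall>x\<in>space X. fst (\<phi> x) = x)"

text \<open>The locale \<^locale>\<open>Metric_space\<close> also asks for nonnegativity and symmetry off the carrier. This is
  harmless here: \<open>d\<close> is existentially quantified and unconstrained outside the fibre product.\<close>

definition Borel_field_of_Polish_spaces ::
    "'x measure \<Rightarrow> ('x \<Rightarrow> 'v topology) \<Rightarrow> ('x \<times> 'v) measure \<Rightarrow> bool" where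
  "Borel_field_of_Polish_spaces X T M \<longleftrightarrow>
     standard_Borel X \<and>
     (\<forall>x\<in>space X. Polish_topology (T x)) \<and>
     space M = total_space X T \<and> standard_Borel M \<and>
     fst \<in> M \<rightarrow>\<^sub>M X \<and>
     (\<exists>d :: ('x \<times> 'v) \<times> ('x \<times> 'v) \<Rightarrow> real.
        d \<in> fibre_product M M \<rightarrow>\<^sub>M restrict_space borel {0..} \<and>
        (\<forall>x\<in>space X.
           let d\<^sub>x = (\<lambda>v w. d ((x, v), (x, w))) in
           Metric_space (topspace (T x)) d\<^sub>x \<and>
           Metric_space.mcomplete (topspace (T x)) d\<^sub>x \<and>
           Metric_space.mtopology (topspace (T x)) d\<^sub>x = T x \<and>
           separable_space (Metric_space.mtopology (topspace (T x)) d\<^sub>x))) \<and>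
     (\<exists>\<phi> :: nat \<Rightarrow> 'x \<Rightarrow> 'x \<times> 'v.
        (\<forall>n. Borel_section X M (\<phi> n)) \<and>
        (\<forall>x\<in>space X. T x closure_of (range (\<lambda>n. snd (\<phi> n x))) = topspace (T x)))"

section \<open>Borel fields of Polish groups\<close>

definition topological_group :: "('g, 'm) monoid_scheme \<Rightarrow> 'g topology \<Rightarrow> bool" where
  "topological_group G T \<longleftrightarrow>
     group G \<and> topspace T = carrier G \<and>
     continuous_map (prod_topology T T) T (\<lambda>(g, h). g \<otimes>\<^bsub>G\<^esub> h) \<and>
     continuous_map T T (\<lambda>g. inv\<^bsub>G\<^esub> g)"

definition Polish_group :: "('g, 'm) monoid_scheme \<Rightarrow> 'g topology \<Rightarrow> bool" where
  "Polish_group G T \<longleftrightarrow> topological_group G T \<and> Polish_topology T"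

definition Borel_field_of_Polish_groups ::
    "'x measure \<Rightarrow> ('x \<Rightarrow> ('g, 'm) monoid_scheme) \<Rightarrow> ('x \<Rightarrow> 'g topology) \<Rightarrow>
     ('x \<times> 'g) measure \<Rightarrow> bool" where
  "Borel_field_of_Polish_groups X G T M \<longleftrightarrow>
     (\<forall>x\<in>space X. Polish_group (G x) (T x)) \<and>
     Borel_field_of_Polish_spaces X T M \<and>
     (\<lambda>x. (x, \<one>\<^bsub>G x\<^esub>)) \<in> X \<rightarrow>\<^sub>M M \<and>
     (\<lambda>(x, g). (x, inv\<^bsub>G x\<^esub> g)) \<in> M \<rightarrow>\<^sub>M M \<and>
     (\<lambda>((x, g), (_, h)). (x, g \<otimes>\<^bsub>G x\<^esub> h)) \<in> fibre_product M M \<rightarrow>\<^sub>M M"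

section \<open>Pontryagin duals\<close>

definition circle_group :: "complex monoid" where
  "circle_group = \<lparr>carrier = sphere 0 1, mult = (*), one = 1\<rparr>"

abbreviation circle_topology :: "complex topology" where
  "circle_topology \<equiv> top_of_set (sphere 0 1)"

text \<open>Characters are total functions on the type \<open>'g\<close>; extensionality makes equality of characters
  the same as equality on the group.\<close>

definition Pontryagin_dual ::
    "('g, 'm) monoid_scheme \<Rightarrow> 'g topology \<Rightarrow> ('g \<Rightarrow> complex) monoid" where
  "Pontryagin_dual G T =
     \<lparr>carrier = {\<omega> \<in> extensional (carrier G).
                  \<omega> \<in> hom G circle_group \<and> continuous_map T circle_topology \<omega>},
      mult = (\<lambda>\<omega> \<eta>. \<lambda>g\<in>carrier G. \<omega> g * \<eta> g),
      one = (\<lambda>g\<in>carrier G. 1)\<rparr>"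

definition compact_open_topology :: "'a topology \<Rightarrow> 'b topology \<Rightarrow> ('a \<Rightarrow> 'b) topology" where
  "compact_open_topology S T = topology_generated_by
     {{f \<in> extensional (topspace S). continuous_map S T f \<and> f ` K \<subseteq> U} | K U.
        compactin S K \<and> openin T U}"

definition Pontryagin_dual_topology ::
    "('g, 'm) monoid_scheme \<Rightarrow> 'g topology \<Rightarrow> ('g \<Rightarrow> complex) topology" where
  "Pontryagin_dual_topology G T =
     subtopology (compact_open_topology T circle_topology) (carrier (Pontryagin_dual G T))"

lemma topspace_Pontryagin_dual_topology:
  assumes "topspace T = carrier G"
  shows "topspace (Pontryagin_dual_topology G T) = carrier (Pontryagin_dual G T)"
proof -
  have "f \<in> topspace (compact_open_topology T circle_topology)"
    if "f \<in> carrier (Pontryagin_dual G T)" for f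
  proof -
    have "openin (compact_open_topology T circle_topology)
            {f \<in> extensional (topspace T). continuous_map T circle_topology f \<and> f ` {} \<subseteq> {}}"
      unfolding compact_open_topology_def openin_topology_generated_by_iff
      by (rule generate_topology_on.Basis) blast
    from openin_subset[OF this] that assms show ?thesis
      by (auto simp: Pontryagin_dual_def)
  qed
  then show ?thesis
    by (auto simp: Pontryagin_dual_topology_def)
qed

definition dual_total_space ::
    "'x measure \<Rightarrow> ('x \<Rightarrow> ('g, 'm) monoid_scheme) \<Rightarrow> ('x \<Rightarrow> 'g topology) \<Rightarrow>
     ('x \<times> ('g \<Rightarrow> complex)) set" where
  "dual_total_space X G T = (SIGMA x:space X. carrier (Pontryagin_dual (G x) (T x)))"

text \<open>The argument \<open>\<Sigma>\<close> is a sigma-algebra rather than a \<open>measure\<close>, because uniqueness of the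
  Borel structure is uniqueness of the sigma-algebra.\<close>

definition dual_Borel_structure ::
    "'x measure \<Rightarrow> ('x \<Rightarrow> ('g, 'm) monoid_scheme) \<Rightarrow> ('x \<Rightarrow> 'g topology) \<Rightarrow>
     ('x \<times> 'g) measure \<Rightarrow> ('x \<times> ('g \<Rightarrow> complex)) set set \<Rightarrow> bool" where
  "dual_Borel_structure X G T M \<Sigma> \<longleftrightarrow>
     (let \<Omega> = dual_total_space X G T in
      sigma_algebra \<Omega> \<Sigma> \<and>
      standard_Borel (sigma \<Omega> \<Sigma>) \<and>
      fst \<in> sigma \<Omega> \<Sigma> \<rightarrow>\<^sub>M X \<and>
      (\<lambda>((_, \<omega>), (_, g)). \<omega> g)
        \<in> fibre_product (sigma \<Omega> \<Sigma>) M \<rightarrow>\<^sub>M restrict_space borel (sphere 0 1))"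

end

(* Let phi_n be the dense Borel sections of G. The map sending a character w of G_x to x and the
   values w(phi_n(x)) is injective, and it is Borel for every admissible Borel structure on the
   dual. By Lusin's separation theorem an injective Borel map out of a standard Borel space
   generates the Borel structure; this gives uniqueness and singles out the structure generated by
   this map.

   That structure is standard because the image of the map is Borel. Indeed, if |z - 1| <= 1/2 and
   |z^2 - 1| <= c, then |z - 1| <= 2c/3, so a homomorphism from a dense subgroup of G_x to the
   circle is continuous as soon as it stays within distance 1/2 of 1 on some neighbourhood of the
   unit. A tuple u therefore comes from a character of G_x iff for some k all words in the
   phi_n(x) whose value lies in the ball of radius 1/(k+1) around the unit have u-values within
   1/2 of 1. Only countable quantifiers occur here.

   For fixed k these tuples form a compact subset of the infinite torus that is cut out by
   countably many Caratheodory constraints, and such sets have dense sequences of measurable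
   selections. On each of them the family of characters is equicontinuous, so selections that are
   dense for pointwise convergence are dense for the compact-open topology. The metric on the dual
   is a weighted supremum over the dense subgroup, with weight 1 on a relatively compact ball
   whose radius depends measurably on x. *)

theory Submission
  imports Defs
begin

section \<open>Analytic sets and Lusin separation\<close>

text \<open>The obstacle is that being a character of \<open>G x\<close> and being close in the
  compact-open topology both involve uncountably many points of a fibre that varies with
  \<open>x\<close>. Everything is therefore expressed through words in the sections: they form one
  countable index set for all fibres, while their values in \<open>G x\<close> vary measurably. The
  set of all tuples that come from characters is in general not closed in the torus, because a limit
  of characters along the dense sequence need not extend continuously. The bound at scale
  \<open>1 / Suc k\<close> cuts this set into compact layers, on which minimisation makes sense, and
  the factor 2/3 per squaring gives all tuples of one layer a common modulus of continuity at the
  unit. Local compactness supplies an open ball around the unit with compact closure. Its openness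
  lets finitely many translates cover any compact set, so the supremum over the ball together with
  values at single points controls compact-open convergence; its compact closure gives the
  converse.\<close>

definition analytic_set :: "'a::topological_space set \<Rightarrow> bool" where
  "analytic_set E \<longleftrightarrow>
     (\<exists>(F :: (nat \<Rightarrow> nat) set) g. closed F \<and> continuous_on F g \<and> E = g ` F)"

lemma open_coordinate: "open {t :: nat \<Rightarrow> nat. t n \<in> A}"
proof -
  have "open ((\<lambda>t :: nat \<Rightarrow> nat. t n) -` A)"
    by (intro open_vimage open_discrete continuous_on_product_coordinates)
  then show ?thesis by (simp add: vimage_def)
qed

lemma closed_coordinate: "closed {t :: nat \<Rightarrow> nat. t n \<in> A}"
  using open_coordinate[of n "- A"] by (simp add: closed_def Compl_eq)

text \<open>Points are parametrised by fast Cauchy sequences of indices into a dense sequence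
  \<open>q\<close>. The admissible index sequences form a closed set \<open>F\<close>, and the limit
  is continuous in the sequence because the entry at \<open>n\<close> alone determines it up to
  \<open>2 * (1/2)^n\<close>. All points are reached, and a closed \<open>C\<close> is cut out by
  its preimage.\<close>

lemma analytic_set_closed:
  fixes C :: "'a::polish_space set"
  assumes "closed C"
  shows "analytic_set C"
proof -
  obtain D :: "'a set" where D: "countable D" "\<And>X. open X \<Longrightarrow> X \<noteq> {} \<Longrightarrow> \<exists>d\<in>D. d \<in> X"
    using countable_dense_setE by metis
  have "D \<noteq> {}" using D(2)[of UNIV] by auto
  define q where "q = from_nat_into D"
  have q: "\<exists>n. q n \<in> X" if "open X" "X \<noteq> {}" for X
    using D(2)[OF that] from_nat_into_surj[OF D(1)] unfolding q_def by metis
  define F where "F = {s :: nat \<Rightarrow> nat. \<forall>n. dist (q (s n)) (q (s (Suc n))) \<le> (1/2)^n}"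
  define g where "g s = lim (\<lambda>n. q (s n))" for s :: "nat \<Rightarrow> nat"
  \<comment> \<open>The bound is the exact partial geometric sum; the subtracted term lets the
    induction on \<open>k\<close> close.\<close>
  have le: "dist (q (s n)) (q (s (n + k))) \<le> 2 * (1/2)^n - 2 * (1/2)^(n+k)" if "s \<in> F" for s n k
  proof (induction k)
    case (Suc k)
    have "dist (q (s n)) (q (s (n + Suc k))) \<le>
          dist (q (s n)) (q (s (n + k))) + dist (q (s (n + k))) (q (s (n + Suc k)))"
      by (rule dist_triangle)
    also have "dist (q (s (n + k))) (q (s (n + Suc k))) \<le> (1/2)^(n+k)"
      using that unfolding F_def by simp
    finally show ?case using Suc by simp
  qed simp
  have le2: "dist (q (s n)) (q (s m)) \<le> 2 * (1/2)^n" if "s \<in> F" "n \<le> m" for s n m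
  proof -
    have "0 \<le> (1/2::real)^m" by simp
    moreover have "dist (q (s n)) (q (s m)) \<le> 2 * (1/2)^n - 2 * (1/2)^m"
      using le[OF that(1), of n "m - n"] that(2) by simp
    ultimately show ?thesis by linarith
  qed
  have lim: "(\<lambda>n. q (s n)) \<longlonglongrightarrow> g s" if "s \<in> F" for s
  proof -
    have "Cauchy (\<lambda>n. q (s n))"
    proof (rule metric_CauchyI)
      fix e :: real assume "e > 0"
      then obtain N where N: "(1/2)^N < e / 4"
        using real_arch_pow_inv[of "e/4" "1/2"] by auto
      have "dist (q (s m)) (q (s n)) < e" if "m \<ge> N" "n \<ge> N" for m n
        using le2[OF \<open>s \<in> F\<close> that(1)] le2[OF \<open>s \<in> F\<close> that(2)] N
          dist_triangle3[of "q (s m)" "q (s n)" "q (s N)"] by linarith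
      then show "\<exists>M. \<forall>m\<ge>M. \<forall>n\<ge>M. dist (q (s m)) (q (s n)) < e" by blast
    qed
    then have "convergent (\<lambda>n. q (s n))" by (rule Cauchy_convergent)
    then show ?thesis unfolding g_def by (simp add: convergent_LIMSEQ_iff)
  qed
  have dg: "dist (q (s n)) (g s) \<le> 2 * (1/2)^n" if "s \<in> F" for s n
    by (rule Lim_bounded[where M=n, OF tendsto_dist[OF tendsto_const lim[OF that]]]) (use le2[OF that] in auto)
  have clF: "closed F"
  proof -
    have "F = (\<Inter>n. \<Inter>a. {s. s n \<in> - {a}} \<union> {s. s (Suc n) \<in> {b. dist (q a) (q b) \<le> (1/2)^n}})"
      unfolding F_def by auto
    also have "closed \<dots>" by (intro closed_INT ballI closed_Un closed_coordinate)
    finally show ?thesis .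
  qed
  have contg: "continuous_on F g"
    unfolding continuous_on_topological
  proof (intro ballI allI impI)
    fix s B assume s: "s \<in> F" and B: "open B" "g s \<in> B"
    then obtain e where e: "e > 0" "\<And>y. dist y (g s) < e \<Longrightarrow> y \<in> B"
      unfolding open_dist by blast
    then obtain n where n: "(1/2)^n < e / 4"
      using real_arch_pow_inv[of "e/4" "1/2"] by auto
    have "g t \<in> B" if "t \<in> F" "t n \<in> {s n}" for t
    proof (rule e(2))
      show "dist (g t) (g s) < e"
        using dg[OF s, of n] dg[OF that(1), of n] that(2) n
          dist_triangle3[of "g t" "g s" "q (s n)"] by simp
    qed
    then show "\<exists>A. open A \<and> s \<in> A \<and> (\<forall>y\<in>F. y \<in> A \<longrightarrow> g y \<in> B)"
      using open_coordinate[of n "{s n}"] by (intro exI[of _ "{t. t n \<in> {s n}}"]) auto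
  qed
  have surj: "\<exists>s\<in>F. g s = c" for c
  proof -
    \<comment> \<open>The margin 1/4 puts consecutive terms within
      \<open>(1/4 + 1/8) * (1/2)^n\<close> of each other, so the chosen index sequence lies in
      \<open>F\<close>.\<close>
    have "\<exists>k. q k \<in> ball c ((1/2)^n / 4)" for n
    proof -
      have "(0::real) < (1/2)^n / 4" by simp
      then have "c \<in> ball c ((1/2)^n / 4)" by (simp only: centre_in_ball)
      then show ?thesis using q[OF open_ball, of c "(1/2)^n / 4"] by blast
    qed
    then obtain s where s: "\<And>n. dist c (q (s n)) < (1/2)^n / 4"
      unfolding mem_ball by metis
    have "s \<in> F" unfolding F_def
    proof safe
      fix n show "dist (q (s n)) (q (s (Suc n))) \<le> (1/2)^n"
        using s[of n] s[of "Suc n"] dist_triangle3[of "q (s n)" "q (s (Suc n))" c]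
          zero_le_dist[of c "q (s (Suc n))"] unfolding power_Suc by linarith
    qed
    moreover have "(\<lambda>n. q (s n)) \<longlonglongrightarrow> c"
    proof (rule metric_LIMSEQ_I)
      fix r :: real assume "r > 0"
      then obtain N where N: "(1/2)^N < r"
        using real_arch_pow_inv[of r "1/2"] by auto
      have "dist (q (s n)) c < r" if "n \<ge> N" for n
      proof -
        have "(1/2::real)^n \<le> (1/2)^N" using that by (intro power_decreasing) auto
        then show ?thesis using s[of n] N zero_le_dist[of c "q (s n)"]
          unfolding dist_commute[of _ c] by linarith
      qed
      then show "\<exists>N. \<forall>n\<ge>N. dist (q (s n)) c < r" by blast
    qed
    ultimately show ?thesis using LIMSEQ_unique lim by blast
  qed
  have "closed (F \<inter> g -` C)"
    using continuous_closed_preimage[OF contg clF assms] .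
  moreover have "continuous_on (F \<inter> g -` C) g" using contg by (rule continuous_on_subset) auto
  moreover have "C = g ` (F \<inter> g -` C)"
  proof (intro equalityI subsetI)
    fix c assume "c \<in> C"
    with surj[of c] show "c \<in> g ` (F \<inter> g -` C)" by auto
  qed auto
  ultimately show ?thesis unfolding analytic_set_def by (intro exI[of _ "F \<inter> g -` C"] exI[of _ g]) simp
qed

lemma analytic_set_continuous_image:
  assumes "analytic_set E" "continuous_on UNIV h"
  shows "analytic_set (h ` E)"
proof -
  obtain F g where "closed (F :: (nat \<Rightarrow> nat) set)" "continuous_on F g" "E = g ` F"
    using assms(1) unfolding analytic_set_def by auto
  moreover from this have "continuous_on F (h \<circ> g)"
    using assms(2) continuous_on_compose continuous_on_subset by blast
  ultimately show ?thesis unfolding analytic_set_def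
    by (intro exI[of _ F] exI[of _ "h \<circ> g"]) auto
qed

lemma analytic_set_sequence:
  assumes "\<And>n::nat. analytic_set (E n)"
  shows "\<exists>F g. \<forall>n. closed (F n :: (nat \<Rightarrow> nat) set) \<and> continuous_on (F n) (g n) \<and> E n = g n ` F n"
proof -
  have "\<forall>n. \<exists>F g. closed (F :: (nat \<Rightarrow> nat) set) \<and> continuous_on F g \<and> E n = g ` F"
    using assms unfolding analytic_set_def by simp
  from choice[OF this] obtain F where
    "\<forall>n. \<exists>g. closed (F n :: (nat \<Rightarrow> nat) set) \<and> continuous_on (F n) g \<and> E n = g ` F n" by (rule exE)
  from choice[OF this] show ?thesis by (intro exI[of _ F])
qed

text \<open>Coordinate 0 names the member of the family and the shifted sequence is its parameter.
  Closedness and continuity survive because coordinate 0 is locally constant.\<close>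

lemma analytic_set_UN:
  assumes "\<And>n::nat. analytic_set (E n)"
  shows "analytic_set (\<Union>n. E n)"
proof -
  from analytic_set_sequence[of E, OF assms] obtain F g where
    "\<forall>n. closed (F n :: (nat \<Rightarrow> nat) set) \<and> continuous_on (F n) (g n) \<and> E n = g n ` F n" by (elim exE)
  then have Fg: "\<And>n. closed (F n)" "\<And>n. continuous_on (F n) (g n)" "\<And>n. E n = g n ` F n"
    by simp_all
  define tl where "tl s = (\<lambda>k. s (Suc k))" for s :: "nat \<Rightarrow> nat"
  have ctl: "continuous_on S tl" for S unfolding tl_def
    by (intro continuous_on_coordinatewise_then_product continuous_on_subset[OF continuous_on_product_coordinates]) auto
  define F' where "F' = {s. tl s \<in> F (s 0)}"
  define g' where "g' s = g (s 0) (tl s)" for s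
  have "F' = (\<Inter>n. {s. s 0 \<in> - {n}} \<union> tl -` F n)" unfolding F'_def by auto
  moreover have "closed \<dots>"
    by (intro closed_INT ballI closed_Un closed_coordinate closed_vimage Fg ctl)
  ultimately have cl: "closed F'" by argo
  have "continuous_on F' g'"
    unfolding continuous_on_topological
  proof (intro ballI allI impI)
    fix s B assume s: "s \<in> F'" and B: "open B" "g' s \<in> B"
    have "continuous_on (F' \<inter> {t. t 0 = s 0}) (\<lambda>t. g (s 0) (tl t))"
      by (rule continuous_on_compose2[OF Fg(2) ctl]) (auto simp: F'_def)
    moreover have "s \<in> F' \<inter> {t. t 0 = s 0}" "g (s 0) (tl s) \<in> B" using s B unfolding g'_def by auto
    ultimately obtain A where A: "open A" "s \<in> A"
      "\<forall>t\<in>F' \<inter> {t. t 0 = s 0}. t \<in> A \<longrightarrow> g (s 0) (tl t) \<in> B"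
      using B(1) unfolding continuous_on_topological by meson
    show "\<exists>A. open A \<and> s \<in> A \<and> (\<forall>y\<in>F'. y \<in> A \<longrightarrow> g' y \<in> B)"
      using A open_coordinate[of 0 "{s 0}"]
      by (intro exI[of _ "A \<inter> {t. t 0 \<in> {s 0}}"]) (auto simp: g'_def)
  qed
  moreover have "(\<Union>n. E n) = g' ` F'"
  proof (intro equalityI subsetI)
    fix y assume "y \<in> (\<Union>n. E n)"
    then obtain n where "y \<in> g n ` F n" using Fg(3) by auto
    then obtain t where nt: "t \<in> F n" "y = g n t" by auto
    define s where "s = (\<lambda>k. case k of 0 \<Rightarrow> n | Suc k \<Rightarrow> t k)"
    have "s 0 = n" "tl s = t" unfolding s_def tl_def by auto
    then show "y \<in> g' ` F'" using nt unfolding g'_def F'_def by (intro image_eqI[of _ _ s]) auto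
  next
    fix y assume "y \<in> g' ` F'"
    then show "y \<in> (\<Union>n. E n)" using Fg(3) unfolding g'_def F'_def by auto
  qed
  ultimately show ?thesis using cl unfolding analytic_set_def by blast
qed

text \<open>One sequence encodes countably many parameters through \<open>prod_encode\<close>. The
  parameters whose images all coincide form a closed set, which explains why analytic sets are
  defined with a closed domain; the metric expresses coincidence as a zero of a continuous
  function.\<close>

lemma analytic_set_INT:
  fixes E :: "nat \<Rightarrow> 'a::metric_space set"
  assumes "\<And>n::nat. analytic_set (E n)"
  shows "analytic_set (\<Inter>n. E n)"
proof -
  from analytic_set_sequence[of E, OF assms] obtain F g where
    "\<forall>n. closed (F n :: (nat \<Rightarrow> nat) set) \<and> continuous_on (F n) (g n) \<and> E n = g n ` F n" by (elim exE)
  then have Fg: "\<And>n. closed (F n)" "\<And>n. continuous_on (F n) (g n)" "\<And>n. E n = g n ` F n"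
    by simp_all
  define t where "t n s = (\<lambda>k. s (prod_encode (n, k)))" for n and s :: "nat \<Rightarrow> nat"
  have ct: "continuous_on S (t n)" for S n unfolding t_def
    by (intro continuous_on_coordinatewise_then_product continuous_on_subset[OF continuous_on_product_coordinates]) auto
  define F0 where "F0 = (\<Inter>n. t n -` F n)"
  have cl0: "closed F0" unfolding F0_def by (intro closed_INT ballI closed_vimage Fg ct)
  have cg: "continuous_on F0 (\<lambda>s. g n (t n s))" for n
    by (rule continuous_on_compose2[OF Fg(2) ct]) (auto simp: F0_def)
  define F' where "F' = (\<Inter>n. F0 \<inter> (\<lambda>s. dist (g n (t n s)) (g 0 (t 0 s))) -` {0})"
  have "closed F'" unfolding F'_def
    by (intro closed_INT ballI continuous_closed_preimage cl0 continuous_intros cg closed_singleton)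
  moreover have "continuous_on F' (\<lambda>s. g 0 (t 0 s))"
    by (rule continuous_on_subset[OF cg]) (auto simp: F'_def)
  moreover have "(\<Inter>n. E n) = (\<lambda>s. g 0 (t 0 s)) ` F'"
  proof (intro equalityI subsetI)
    fix y assume "y \<in> (\<Inter>n. E n)"
    then have "\<forall>n. y \<in> g n ` F n" using Fg(3) by simp
    then have "\<forall>n. \<exists>u. u \<in> F n \<and> g n u = y" by (metis imageE)
    then obtain u where u: "\<And>n. u n \<in> F n" "\<And>n. g n (u n) = y" by metis
    define s where "s = (\<lambda>k. case prod_decode k of (n, k) \<Rightarrow> u n k)"
    have "t n s = u n" for n unfolding s_def t_def by auto
    then show "y \<in> (\<lambda>s. g 0 (t 0 s)) ` F'" using u unfolding F0_def F'_def by (intro image_eqI[of _ _ s]) auto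
  next
    fix y assume "y \<in> (\<lambda>s. g 0 (t 0 s)) ` F'"
    then obtain s where s: "s \<in> F'" "y = g 0 (t 0 s)" by auto
    then have "t n s \<in> F n" "g n (t n s) = y" for n unfolding F'_def F0_def by auto
    then show "y \<in> (\<Inter>n. E n)" unfolding Fg(3) by force
  qed
  ultimately show ?thesis unfolding analytic_set_def by blast
qed

text \<open>Analytic sets are in general not closed under complement, so the induction carries a set
  and its complement together. For a closed generator the complement is open, hence a countable
  union of closed sets.\<close>

lemma analytic_set_borel:
  fixes A :: "'a::polish_space set"
  assumes "A \<in> sets borel"
  shows "analytic_set A"
proof -
  have "A \<in> sigma_sets UNIV (Collect closed)"
    using assms unfolding borel_eq_closed by simp
  then have "analytic_set A \<and> analytic_set (- A)"
  proof induction
    case (Basic a)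
    have "open (- a)" using Basic by auto
    then have "fsigma_in euclidean (- a)"
      using open_imp_fsigma_in metrizable_space_euclidean open_openin by blast
    then obtain C where C: "\<And>n::nat. closedin euclidean (C n)" "\<Union> (range C) = - a"
      unfolding fsigma_in_ascending by blast
    have "analytic_set (\<Union>n. C n)" by (intro analytic_set_UN analytic_set_closed) (use C in auto)
    then show ?case using C Basic analytic_set_closed by auto
  next
    case (Compl a) then show ?case by (simp add: Compl_eq_Diff_UNIV[symmetric])
  next
    case (Union a)
    then show ?case using analytic_set_UN[of a] analytic_set_INT[of "\<lambda>n. - a n"] by simp
  qed (use analytic_set_closed[of "{}::'a set"] analytic_set_closed[of "UNIV::'a set"] in auto)
  then show ?thesis ..
qed

section \<open>Separation of disjoint analytic sets by Borel sets\<close>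

definition borel_separated :: "'a::topological_space set \<Rightarrow> 'a set \<Rightarrow> bool" where
  "borel_separated A B \<longleftrightarrow> (\<exists>C\<in>sets borel. A \<subseteq> C \<and> C \<inter> B = {})"

text \<open>If \<open>C m n\<close> separates \<open>A m\<close> from \<open>B n\<close>, the union
  over \<open>m\<close> of the intersections over \<open>n\<close> separates the unions. The
  contrapositive drives the separation theorem: an inseparable pair of unions contains an
  inseparable pair of members.\<close>

lemma borel_separated_UN:
  assumes "\<And>m n. borel_separated (A m) (B n)"
  shows "borel_separated (\<Union>m::nat. A m) (\<Union>n::nat. B n)"
proof -
  obtain C where C: "\<And>m n. C m n \<in> sets borel" "\<And>m n. A m \<subseteq> C m n" "\<And>m n. C m n \<inter> B n = {}"
    using assms unfolding borel_separated_def by metis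
  have "(\<Union>m. \<Inter>n. C m n) \<in> sets borel" using C(1) by auto
  moreover have "(\<Union>m. A m) \<subseteq> (\<Union>m. \<Inter>n. C m n)" by (intro UN_mono INT_greatest C(2) subset_refl)
  moreover have "(\<Union>m. \<Inter>n. C m n) \<inter> (\<Union>n. B n) = {}"
  proof -
    have False if "y \<in> (\<Inter>n. C m n)" "y \<in> B n" for m n y
    proof -
      have "y \<in> C m n" using that(1) by simp
      then show False using that(2) C(3)[of m n] by auto
    qed
    then show ?thesis by auto
  qed
  ultimately show ?thesis unfolding borel_separated_def by blast
qed

text \<open>If the images were inseparable, splitting both parameter sets one coordinate at a time
  would keep some pair of cylinders inseparable at each stage. The cylinders shrink to parameters
  \<open>s\<close> and \<open>t\<close> whose images differ, and continuity puts the images of small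
  cylinders into disjoint open sets, a contradiction.\<close>

theorem Lusin_separation:
  fixes E1 E2 :: "'a::t2_space set"
  assumes "analytic_set E1" "analytic_set E2" "E1 \<inter> E2 = {}"
  shows "borel_separated E1 E2"
proof (rule ccontr)
  assume neg: "\<not> borel_separated E1 E2"
  obtain F1 g1 where 1: "closed (F1 :: (nat \<Rightarrow> nat) set)" "continuous_on F1 g1" "E1 = g1 ` F1"
    using assms(1) unfolding analytic_set_def by blast
  obtain F2 g2 where 2: "closed (F2 :: (nat \<Rightarrow> nat) set)" "continuous_on F2 g2" "E2 = g2 ` F2"
    using assms(2) unfolding analytic_set_def by blast
  define cyl where "cyl F s n = {t \<in> F. \<forall>i<n. t i = s i}" for F :: "(nat \<Rightarrow> nat) set" and s and n :: nat
  define P where "P n st \<longleftrightarrow> \<not> borel_separated (g1 ` cyl F1 (fst st) n) (g2 ` cyl F2 (snd st) n)"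
    for n and st :: "(nat \<Rightarrow> nat) \<times> (nat \<Rightarrow> nat)"
  have split: "h ` cyl F s n = (\<Union>m. h ` cyl F (s(n := m)) (Suc n))" for h :: "(nat \<Rightarrow> nat) \<Rightarrow> 'a" and F s n
    unfolding cyl_def by (auto simp: less_Suc_eq)
  have "\<exists>st. \<forall>n. P n (st n) \<and> (\<exists>m k. st (Suc n) = ((fst (st n))(n := m), (snd (st n))(n := k)))"
  proof (rule dependent_nat_choice)
    have "cyl F s 0 = F" for F s unfolding cyl_def by simp
    then show "\<exists>x. P 0 x" using neg 1 2 unfolding P_def by simp
    fix x n assume "P n x"
    then obtain m k where "\<not> borel_separated (g1 ` cyl F1 ((fst x)(n := m)) (Suc n)) (g2 ` cyl F2 ((snd x)(n := k)) (Suc n))"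
      using borel_separated_UN[of "\<lambda>m. g1 ` cyl F1 ((fst x)(n := m)) (Suc n)" "\<lambda>k. g2 ` cyl F2 ((snd x)(n := k)) (Suc n)"]
      unfolding P_def split[of _ _ _ n] by auto
    then show "\<exists>y. P (Suc n) y \<and> (\<exists>m k. y = ((fst x)(n := m), (snd x)(n := k)))"
      unfolding P_def by auto
  qed
  then obtain st where st: "\<And>n. P n (st n)"
    "\<And>n. \<exists>m k. st (Suc n) = ((fst (st n))(n := m), (snd (st n))(n := k))" by blast
  \<comment> \<open>Passing from stage \<open>n\<close> to \<open>Suc n\<close> fixes coordinate
    \<open>n\<close> for good, so coordinate \<open>i\<close> is final from stage
    \<open>Suc i\<close> on.\<close>
  define s where "s i = fst (st (Suc i)) i" for i
  define t where "t i = snd (st (Suc i)) i" for i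
  have agree: "\<forall>i<n. fst (st n) i = s i \<and> snd (st n) i = t i" for n
  proof (induction n)
    case (Suc n)
    show ?case
    proof safe
      fix i assume "i < Suc n"
      then consider "i = n" | "i < n" by linarith
      then have "fst (st (Suc n)) i = s i \<and> snd (st (Suc n)) i = t i"
      proof cases
        case 2 then show ?thesis using Suc st(2)[of n] by auto
      qed (auto simp: s_def t_def)
      then show "fst (st (Suc n)) i = s i" "snd (st (Suc n)) i = t i" by auto
    qed
  qed simp
  have "cyl F1 (fst (st n)) n = cyl F1 s n" "cyl F2 (snd (st n)) n = cyl F2 t n" for n
    using agree[of n] unfolding cyl_def by auto
  then have ns: "\<not> borel_separated (g1 ` cyl F1 s n) (g2 ` cyl F2 t n)" for n
    using st(1)[of n] unfolding P_def by simp
  have ne: "cyl F1 s n \<noteq> {}" "cyl F2 t n \<noteq> {}" for n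
    using ns[of n] unfolding borel_separated_def by auto
  \<comment> \<open>Cylinders form a neighbourhood base of the product topology, since an open box
    restricts only finitely many coordinates.\<close>
  have nbhd: "\<exists>n. {u. \<forall>i<n. u i = s i} \<subseteq> A" if A: "open A" "s \<in> A" for A and s :: "nat \<Rightarrow> nat"
  proof -
    obtain X where X: "s \<in> Pi\<^sub>E UNIV X" "finite {i. X i \<noteq> UNIV}" "Pi\<^sub>E UNIV X \<subseteq> A"
      using product_topology_open_contains_basis[of "\<lambda>_. euclidean" UNIV A s] A
      unfolding open_fun_def by (auto simp: PiE_UNIV_domain)
    obtain n where "\<forall>i\<in>{i. X i \<noteq> UNIV}. i < n"
      using X(2) unfolding finite_nat_set_iff_bounded by (rule exE)
    then have n: "\<And>i. X i \<noteq> UNIV \<Longrightarrow> i < n" by simp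
    have "{u. \<forall>i<n. u i = s i} \<subseteq> Pi\<^sub>E UNIV X"
    proof (clarsimp simp: PiE_UNIV_domain)
      fix u i assume u: "\<forall>i<n. u i = s i"
      show "u i \<in> X i"
      proof (cases "X i = UNIV")
        case False
        then have "u i = s i" using u n by simp
        then show ?thesis using X(1) by (simp add: PiE_UNIV_domain Pi_iff)
      qed simp
    qed
    then show ?thesis using X(3) by (intro exI[of _ n]) (rule subset_trans)
  qed
  have mem: "s \<in> F" if F: "closed F" "\<And>n. cyl F s n \<noteq> {}" for F s
  proof (rule ccontr)
    assume "s \<notin> F"
    then have "s \<in> - F" by simp
    from nbhd[OF open_Compl[OF F(1)] this] obtain n where n: "{u. \<forall>i<n. u i = s i} \<subseteq> - F" by (rule exE)
    obtain u where "u \<in> cyl F s n" using F(2)[of n] by auto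
    then have "u \<in> F" "u \<in> {u. \<forall>i<n. u i = s i}" unfolding cyl_def by auto
    then show False using n by auto
  qed
  have s: "s \<in> F1" and t: "t \<in> F2" using mem[OF 1(1) ne(1)] mem[OF 2(1) ne(2)] by auto
  then have "g1 s \<noteq> g2 t" using 1(3) 2(3) assms(3) by blast
  then obtain U V where UV: "open U" "open V" "g1 s \<in> U" "g2 t \<in> V" "U \<inter> V = {}"
    using hausdorff by metis
  obtain A where A: "open A" "s \<in> A" "\<And>u. u \<in> F1 \<Longrightarrow> u \<in> A \<Longrightarrow> g1 u \<in> U"
    using 1(2)[unfolded continuous_on_topological, rule_format, OF s UV(1,3)] by auto
  obtain B where B: "open B" "t \<in> B" "\<And>u. u \<in> F2 \<Longrightarrow> u \<in> B \<Longrightarrow> g2 u \<in> V"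
    using 2(2)[unfolded continuous_on_topological, rule_format, OF t UV(2,4)] by auto
  from nbhd[OF A(1,2)] obtain m where m: "{u. \<forall>i<m. u i = s i} \<subseteq> A" by (rule exE)
  from nbhd[OF B(1,2)] obtain k where k: "{u. \<forall>i<k. u i = t i} \<subseteq> B" by (rule exE)
  have "cyl F1 s (max m k) \<subseteq> {u. \<forall>i<m. u i = s i}" "cyl F2 t (max m k) \<subseteq> {u. \<forall>i<k. u i = t i}"
    "cyl F1 s (max m k) \<subseteq> F1" "cyl F2 t (max m k) \<subseteq> F2"
    unfolding cyl_def by auto
  note sub = this(3,4) subset_trans[OF this(1) m] subset_trans[OF this(2) k]
  have "g1 ` cyl F1 s (max m k) \<subseteq> U" using A(3) sub(1,3) by (intro image_subsetI) (simp add: subsetD)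
  moreover have "g2 ` cyl F2 t (max m k) \<subseteq> V" using B(3) sub(2,4) by (intro image_subsetI) (simp add: subsetD)
  ultimately have "borel_separated (g1 ` cyl F1 s (max m k)) (g2 ` cyl F2 t (max m k))"
    unfolding borel_separated_def using UV by (intro bexI[of _ U]) auto
  then show False using ns by blast
qed

section \<open>Standard Borel spaces as Borel subsets of Polish spaces\<close>

instance prod :: (polish_space, polish_space) polish_space ..

text \<open>The case \<open>A = space N\<close> says that the image of the whole space is Borel, so
  \<open>i\<close> is an isomorphism onto a Borel subset. The codomain carries its topology through
  its type, which makes \<open>borel\<close> available on it.\<close>

definition borel_embedding :: "'a measure \<Rightarrow> ('a \<Rightarrow> 'b::topological_space) \<Rightarrow> bool" where
  "borel_embedding N i \<longleftrightarrow>
     i \<in> borel_measurable N \<and> inj_on i (space N) \<and> (\<forall>A\<in>sets N. i ` A \<in> sets borel)"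

lemma borel_embedding_inverse:
  assumes "borel_embedding N i"
  shows "the_inv_into (space N) i \<in> restrict_space borel (i ` space N) \<rightarrow>\<^sub>M N"
proof (rule measurableI)
  have inj: "inj_on i (space N)" using assms unfolding borel_embedding_def by simp
  show "the_inv_into (space N) i p \<in> space N" if "p \<in> space (restrict_space borel (i ` space N))" for p
    using that inj by (auto simp: space_restrict_space the_inv_into_f_f)
  fix A assume A: "A \<in> sets N"
  then have "A \<subseteq> space N" by (rule sets.sets_into_space)
  then have "the_inv_into (space N) i -` A \<inter> space (restrict_space borel (i ` space N)) = i ` A"
    using inj by (auto simp: space_restrict_space the_inv_into_f_f)
  also have "\<dots> = i ` space N \<inter> i ` A" using \<open>A \<subseteq> space N\<close> by auto
  also have "\<dots> \<in> sets (restrict_space borel (i ` space N))"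
    using assms A unfolding borel_embedding_def sets_restrict_space by blast
  finally show "the_inv_into (space N) i -` A \<inter> space (restrict_space borel (i ` space N))
    \<in> sets (restrict_space borel (i ` space N))" .
qed

text \<open>The image is the second projection of the graph of \<open>f\<close> over
  \<open>A\<close>. Transported along \<open>i\<close>, this graph is a Borel subset of a product of
  two Polish types, hence analytic, and projection is continuous.\<close>

lemma analytic_set_measurable_image:
  fixes i :: "'a \<Rightarrow> 'p::polish_space" and f :: "'a \<Rightarrow> 'y::polish_space"
  assumes i: "borel_embedding N i" and f: "f \<in> borel_measurable N" and A: "A \<in> sets N"
  shows "analytic_set (f ` A)"
proof -
  define j where "j = the_inv_into (space N) i"
  define S where "S = i ` space N"
  have S: "S \<in> sets borel" and iA: "i ` A \<in> sets borel" and inj: "inj_on i (space N)"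
    using i A unfolding borel_embedding_def S_def by auto
  have "j \<in> restrict_space borel S \<rightarrow>\<^sub>M N"
    unfolding j_def S_def by (rule borel_embedding_inverse[OF i])
  then have "f \<circ> j \<in> borel_measurable (restrict_space borel S)"
    using f by (rule measurable_comp)
  \<comment> \<open>The value \<open>undefined\<close> off \<open>S\<close> is harmless: the graph
    is taken only over the image of \<open>A\<close>, which lies in \<open>S\<close>.\<close>
  then have F[measurable]: "(\<lambda>p. if p \<in> S then (f \<circ> j) p else undefined) \<in> borel_measurable borel" (is "?F \<in> _")
    using S by (subst (asm) measurable_restrict_space_iff[where c = undefined]) auto
  note iA[measurable]
  have "{z. dist (?F (fst z)) (snd z) = 0} \<inter> fst -` (i ` A) \<in> sets (borel \<Otimes>\<^sub>M borel)" (is "?Gr \<in> _")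
  proof -
    have "{z \<in> space (borel \<Otimes>\<^sub>M borel). dist (?F (fst z)) (snd z) = 0} \<inter>
      (fst -` (i ` A) \<inter> space (borel \<Otimes>\<^sub>M borel)) \<in> sets (borel \<Otimes>\<^sub>M borel)"
      by (intro sets.Int measurable_sets[OF measurable_fst iA]) measurable
    then show ?thesis by (simp add: space_pair_measure)
  qed
  then have "?Gr \<in> sets borel" unfolding borel_prod .
  then have "analytic_set (snd ` ?Gr)"
    by (intro analytic_set_continuous_image analytic_set_borel continuous_intros)
  also have "snd ` ?Gr = f ` A"
  proof -
    have "A \<subseteq> space N" using A by (rule sets.sets_into_space)
    then have j: "j (i x) = x" "i x \<in> S" if "x \<in> A" for x
      using that inj unfolding j_def S_def by (auto intro: the_inv_into_f_f)
    show ?thesis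
    proof (intro equalityI subsetI)
      fix y assume "y \<in> snd ` ?Gr"
      then obtain z where z: "z \<in> ?Gr" "y = snd z" by blast
      then obtain x where x: "x \<in> A" "fst z = i x" by auto
      then have "y = f x" using z j[OF x(1)] by simp
      then show "y \<in> f ` A" using x by simp
    next
      fix y assume "y \<in> f ` A"
      then obtain x where "x \<in> A" "y = f x" by auto
      then show "y \<in> snd ` ?Gr" using j by (intro image_eqI[of _ _ "(i x, y)"]) auto
    qed
  qed
  finally show ?thesis .
qed

text \<open>By injectivity \<open>A\<close> and its complement have disjoint analytic images; a
  Borel set that separates the images pulls back to exactly \<open>A\<close>.\<close>

theorem injective_measurable_generates:
  fixes i :: "'a \<Rightarrow> 'p::polish_space" and f :: "'a \<Rightarrow> 'y::polish_space"
  assumes i: "borel_embedding N i" and f: "f \<in> borel_measurable N" and inj: "inj_on f (space N)"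
    and A: "A \<in> sets N"
  shows "\<exists>C\<in>sets borel. A = f -` C \<inter> space N"
proof -
  have sub: "A \<subseteq> space N" using A by (rule sets.sets_into_space)
  have "f ` A \<inter> f ` (space N - A) = {}" using inj sub unfolding inj_on_def by blast
  then have "borel_separated (f ` A) (f ` (space N - A))"
    by (intro Lusin_separation analytic_set_measurable_image[OF i f] A sets.compl_sets)
  then obtain C where C: "C \<in> sets borel" "f ` A \<subseteq> C" "C \<inter> f ` (space N - A) = {}"
    unfolding borel_separated_def by auto
  have "A = f -` C \<inter> space N" using C sub by auto
  then show ?thesis using C(1) by auto
qed

section \<open>From \<open>standard_Borel\<close> to Borel embeddings and back\<close>

lemma space_borel_of [simp]: "space (borel_of T) = topspace T"
  unfolding borel_of_def by (rule space_measure_of) (auto dest: openin_subset)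

lemma sets_borel_of: "sets (borel_of T) = sigma_sets (topspace T) {U. openin T U}"
  unfolding borel_of_def by (rule sets_measure_of) (auto dest: openin_subset)

lemma gdelta_in_euclidean_borel:
  assumes "gdelta_in euclidean S"
  shows "S \<in> sets borel"
proof -
  obtain U where U: "countable U" "U \<subseteq> Collect open" "\<Inter>U = S"
    using assms unfolding gdelta_in_alt intersection_of_def by auto
  show ?thesis
  proof (cases "U = {}")
    case False
    then have "(\<Inter>x\<in>U. x) \<in> sets borel"
      using U by (intro sets.countable_INT'') auto
    then show ?thesis using U by simp
  qed (use U in auto)
qed

text \<open>The map records the distances to a dense sequence. It is a homeomorphism onto its image,
  so the image is completely metrizable and hence a G-delta in the space of real sequences.\<close>

lemma Polish_topology_embedding:
  assumes "Polish_topology T"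
  shows "\<exists>h :: 'a \<Rightarrow> nat \<Rightarrow> real. borel_embedding (borel_of T) h"
proof -
  obtain M d where "Metric_space M d" and T: "T = Metric_space.mtopology M d"
    using assms unfolding Polish_topology_def completely_metrizable_space_def by auto
  then interpret Metric_space M d by simp
  have top: "topspace T = M" by (simp add: T)
  obtain C where C: "countable C" "C \<subseteq> M" "mtopology closure_of C = M"
    using assms unfolding Polish_topology_def separable_space_def T by auto
  define q where "q = from_nat_into C"
  define h where "h x = (\<lambda>n. d x (q n))" for x
  have approx: "\<exists>n. q n \<in> M \<and> d x (q n) < r" if x: "x \<in> M" and r: "r > 0" for x r
  proof -
    have "x \<in> mtopology closure_of C" using C(3) x by simp
    then obtain c where "c \<in> C" "c \<in> mball x r"
      using r unfolding metric_closure_of by auto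
    moreover from this obtain n where "q n = c"
      using from_nat_into_surj[OF C(1)] unfolding q_def by metis
    ultimately show ?thesis by auto
  qed
  have qM: "q n \<in> M" if "x \<in> M" for n x
  proof -
    have "C \<noteq> {}" using that C(3) by auto
    then show ?thesis using C(2) from_nat_into[of C n] unfolding q_def by auto
  qed
  have inj: "inj_on h M"
  proof (rule inj_onI, rule ccontr)
    fix x y assume xy: "x \<in> M" "y \<in> M" "h x = h y" "x \<noteq> y"
    then obtain n where n: "q n \<in> M" "d x (q n) < d x y / 2" using approx[of x "d x y / 2"] by auto
    moreover have "d y (q n) = d x (q n)" using xy(3) unfolding h_def by metis
    ultimately show False using triangle'[of x "q n" y] xy by linarith
  qed
  have cont: "continuous_map mtopology euclidean h"
  proof -
    have "continuous_map mtopology euclideanreal (\<lambda>x. d x (q n))" for n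
    proof (cases "M = {}")
      case False
      then have "q n \<in> M" using qM by auto
      have "\<exists>U. openin mtopology U \<and> x \<in> U \<and> (\<forall>y\<in>U. dist (d x (q n)) (d y (q n)) < e)"
        if "x \<in> M" "e > 0" for x e
      proof (intro exI[of _ "mball x e"] conjI ballI)
        fix y assume y: "y \<in> mball x e"
        then show "dist (d x (q n)) (d y (q n)) < e"
          using \<open>q n \<in> M\<close> triangle[of x y "q n"] triangle[of y x "q n"] commute[of x y]
          by (auto simp: dist_real_def)
      qed (use that in auto)
      then show ?thesis
        unfolding mtopology_is_euclidean[symmetric] Met_TC.continuous_map_to_metric by auto
    next
      case True
      have "topspace mtopology = {}" using trans[OF topspace_mtopology True] .
      then show ?thesis by (simp add: continuous_map_def del: topspace_mtopology)
    qed
    then show ?thesis unfolding h_def euclidean_product_topology[symmetric]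
      by (subst continuous_map_componentwise_UNIV) auto
  qed
  have image_open: "\<exists>W. open W \<and> h ` U = h ` M \<inter> W" if U: "openin mtopology U" for U
  proof -
    \<comment> \<open>A ball around \<open>q n\<close> inside \<open>U\<close> corresponds to the
      open condition \<open>y n < r\<close> on distance sequences. The clause
      \<open>q n \<in> M\<close> guards the case of an empty space, where \<open>q\<close> takes
      arbitrary values.\<close>
    define W where "W = (\<Union>(n, r) \<in> {(n, r). q n \<in> M \<and> mball (q n) r \<subseteq> U}. {y :: nat \<Rightarrow> real. y n < r})"
    have "open {y :: nat \<Rightarrow> real. y n < r}" for n r
      by (intro open_Collect_less continuous_intros continuous_on_product_coordinates)
    then have "open W" unfolding W_def by auto
    moreover have "h ` U = h ` M \<inter> W"
    proof (intro equalityI subsetI)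
      fix y assume "y \<in> h ` U"
      then obtain x where x: "x \<in> U" "y = h x" by auto
      then have "x \<in> M" using openin_subset[OF U] by auto
      obtain r where r: "r > 0" "mball x r \<subseteq> U" using U x unfolding openin_mtopology by auto
      obtain n where n: "q n \<in> M" "d x (q n) < r / 2" using approx[OF \<open>x \<in> M\<close>, of "r/2"] r by auto
      have "mball (q n) (r/2) \<subseteq> mball x r"
      proof
        fix z assume "z \<in> mball (q n) (r/2)"
        then show "z \<in> mball x r" using n \<open>x \<in> M\<close> triangle[of x "q n" z] by auto
      qed
      then have "mball (q n) (r/2) \<subseteq> U" using r by auto
      then have "y \<in> W" unfolding W_def using n x by (intro UN_I[of "(n, r/2)"]) (auto simp: h_def)
      then show "y \<in> h ` M \<inter> W" using x \<open>x \<in> M\<close> by auto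
    next
      fix y assume "y \<in> h ` M \<inter> W"
      then obtain x n r where x: "x \<in> M" "y = h x" "q n \<in> M" "mball (q n) r \<subseteq> U" "y n < r"
        unfolding W_def by auto
      then have "x \<in> mball (q n) r" by (simp add: h_def commute)
      then show "y \<in> h ` U" using x by auto
    qed
    ultimately show ?thesis by auto
  qed
  have "homeomorphic_map mtopology (top_of_set (h ` M)) h"
  proof (rule bijective_open_imp_homeomorphic_map)
    show "continuous_map mtopology (top_of_set (h ` M)) h"
      using cont by (simp add: continuous_map_in_subtopology)
    show "open_map mtopology (top_of_set (h ` M)) h"
      unfolding open_map_def using image_open by (metis openin_open)
  qed (use inj in auto)
  then have "completely_metrizable_space (top_of_set (h ` M))"
    using assms homeomorphic_completely_metrizable_space homeomorphic_map_imp_homeomorphic_space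
    unfolding Polish_topology_def T by blast
  then have "gdelta_in euclidean (h ` M)"
    by (intro completely_metrizable_space_imp_gdelta_in metrizable_space_euclidean) auto
  then have hM: "h ` M \<in> sets borel" by (rule gdelta_in_euclidean_borel)
  have "h \<in> borel_measurable (borel_of T)"
  proof (rule borel_measurableI)
    fix S :: "(nat \<Rightarrow> real) set" assume "open S"
    then have "openin mtopology {x \<in> M. h x \<in> S}"
      using openin_continuous_map_preimage[OF cont] by simp
    then show "h -` S \<inter> space (borel_of T) \<in> sets (borel_of T)"
      by (auto simp: sets_borel_of T vimage_def Int_def conj_commute intro!: sigma_sets.Basic)
  qed
  moreover have "h ` A \<in> sets borel" if "A \<in> sets (borel_of T)" for A
    using that unfolding sets_borel_of top T
  proof (induction)
    case (Basic U)
    then have "openin mtopology U" by simp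
    from image_open[OF this] obtain W where "open W" "h ` U = h ` M \<inter> W" by (elim exE conjE)
    then show ?case using hM by simp
  next
    case (Compl A)
    have "{U. openin mtopology U} \<subseteq> Pow (topspace mtopology)" using openin_subset[of mtopology] by auto
    from sigma_sets_into_sp[OF this Compl.hyps] have "A \<subseteq> M" by simp
    then have "h ` (topspace mtopology - A) = h ` M - h ` A" using inj by (simp add: inj_on_image_set_diff)
    then show ?case using Compl hM by auto
  next
    case (Union A) then show ?case by (auto simp: image_UN)
  qed auto
  ultimately show ?thesis using inj unfolding borel_embedding_def by (auto simp: top)
qed

text \<open>The definition allows any topology on a set of reals. Here every standard Borel space is
  moved into one fixed type with its type-class topology, where the separation theorem
  applies.\<close>

lemma standard_Borel_embedding:
  assumes "standard_Borel N"
  shows "\<exists>i :: 'a \<Rightarrow> nat \<Rightarrow> real. borel_embedding N i"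
proof -
  obtain T :: "real topology" and B f g where T: "Polish_topology T" "B \<in> sets (borel_of T)"
    and f: "f \<in> N \<rightarrow>\<^sub>M restrict_space (borel_of T) B" and g: "g \<in> restrict_space (borel_of T) B \<rightarrow>\<^sub>M N"
    and fg: "\<And>x. x \<in> space N \<Longrightarrow> g (f x) = x"
      "\<And>y. y \<in> space (restrict_space (borel_of T) B) \<Longrightarrow> f (g y) = y"
    using assms unfolding standard_Borel_def Borel_isomorphic_def by auto
  obtain h :: "real \<Rightarrow> nat \<Rightarrow> real" where h: "h \<in> borel_measurable (borel_of T)"
    "inj_on h (topspace T)" "\<And>A. A \<in> sets (borel_of T) \<Longrightarrow> h ` A \<in> sets borel"
    using Polish_topology_embedding[OF T(1)] unfolding borel_embedding_def by auto
  have sp: "space (restrict_space (borel_of T) B) = B"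
    using sets.sets_into_space[OF T(2)] by (auto simp: space_restrict_space)
  have fB: "f x \<in> B \<and> f x \<in> topspace T" if "x \<in> space N" for x
    using measurable_space[OF f that] by (simp add: space_restrict_space)
  have "h \<circ> f \<in> borel_measurable N"
    by (rule measurable_comp[OF f measurable_restrict_space1[OF h(1)]])
  moreover have "inj_on (h \<circ> f) (space N)"
    using fB fg(1) h(2) unfolding inj_on_def comp_def by metis
  moreover have "(h \<circ> f) ` A \<in> sets borel" if A: "A \<in> sets N" for A
  proof -
    have "A \<subseteq> space N" using A by (rule sets.sets_into_space)
    then have "f ` A = g -` A \<inter> B" using fg fB unfolding sp by force
    also have "\<dots> \<in> sets (restrict_space (borel_of T) B)" using measurable_sets[OF g A] sp by simp
    finally have "f ` A \<in> sets (borel_of T)"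
      using T(2) by (auto simp: sets_restrict_space)
    then show ?thesis using h(3) by (metis image_comp)
  qed
  ultimately show ?thesis unfolding borel_embedding_def by blast
qed

text \<open>A point of a T1 space is determined by the indices of the basic open sets that contain
  it, and sets of naturals embed into the reals. This provides the real carrier that
  \<open>standard_Borel\<close> asks for.\<close>

lemma second_countable_lepoll_real:
  "\<exists>\<kappa> :: 'a::{second_countable_topology,t1_space} \<Rightarrow> real. inj \<kappa>"
proof -
  obtain B :: "'a set set" where B: "countable B" "topological_basis B" using ex_countable_basis by auto
  define c where "c x = {n. x \<in> from_nat_into B n \<and> B \<noteq> {}}" for x :: 'a
  have "inj c"
  proof (rule injI, rule ccontr)
    fix x y assume xy: "c x = c y" "x \<noteq> y"
    then obtain U where "open U" "x \<in> U" "y \<notin> U" using t1_space by blast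
    then obtain V where V: "V \<in> B" "x \<in> V" "V \<subseteq> U" using topological_basisE[OF B(2)] by metis
    then obtain n where "from_nat_into B n = V" using from_nat_into_surj[OF B(1)] by metis
    then have "n \<in> c x" "n \<notin> c y" using V \<open>y \<notin> U\<close> unfolding c_def by auto
    then show False using xy by simp
  qed
  moreover obtain e :: "nat set \<Rightarrow> real" where "inj e"
    using nat_sets_eqpoll_reals unfolding eqpoll_def bij_betw_def by auto
  ultimately have "inj (e \<circ> c)" by (rule inj_compose[rotated])
  then show ?thesis by blast
qed

text \<open>An injection \<open>\<kappa>\<close> into the reals carries the Polish topology to the
  set \<open>range \<kappa>\<close>: the pullback along the inverse of \<open>\<kappa>\<close> makes
  that inverse a homeomorphism.\<close>

lemma standard_BorelI:
  fixes i :: "'a \<Rightarrow> 'p::polish_space"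
  assumes i: "borel_embedding N i"
  shows "standard_Borel N"
proof -
  obtain \<kappa> :: "'p \<Rightarrow> real" where \<kappa>: "inj \<kappa>" using second_countable_lepoll_real by blast
  define T where "T = pullback_topology (range \<kappa>) (inv_into UNIV \<kappa>) euclidean"
  have top: "topspace T = range \<kappa>" unfolding T_def topspace_pullback_topology by auto
  have openT: "openin T U \<longleftrightarrow> (\<exists>V. open V \<and> U = inv_into UNIV \<kappa> -` V \<inter> range \<kappa>)" for U
    unfolding T_def openin_pullback_topology by auto
  have hom: "homeomorphic_map T euclidean (inv_into UNIV \<kappa>)"
  proof (rule bijective_open_imp_homeomorphic_map)
    show "continuous_map T euclidean (inv_into UNIV \<kappa>)"
      unfolding continuous_map_def top using openT by (auto simp: vimage_def Int_def conj_commute)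
    have "inv_into UNIV \<kappa> ` (inv_into UNIV \<kappa> -` V \<inter> range \<kappa>) = V" for V using \<kappa> by (force simp: image_iff)
    then show "open_map T euclidean (inv_into UNIV \<kappa>)" unfolding open_map_def openT by auto
    show "inv_into UNIV \<kappa> ` topspace T = topspace euclidean" using \<kappa> by (force simp: top image_iff)
    show "inj_on (inv_into UNIV \<kappa>) (topspace T)" using \<kappa> by (auto simp: top inj_on_def)
  qed
  have "separable_space (euclidean :: 'p topology)"
  proof -
    obtain D :: "'p set" where D: "countable D" "\<And>X. open X \<Longrightarrow> X \<noteq> {} \<Longrightarrow> \<exists>d\<in>D. d \<in> X"
      using countable_dense_exists[where 'a = 'p] by auto
    have "euclidean closure_of D = topspace euclidean"
      unfolding dense_intersects_open
    proof (intro allI impI)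
      fix X :: "'p set" assume "openin euclidean X \<and> X \<noteq> {}"
      then obtain d where "d \<in> D" "d \<in> X" using D(2)[of X] by auto
      then show "D \<inter> X \<noteq> {}" by auto
    qed
    then show ?thesis unfolding separable_space_def using D(1) by (intro exI[of _ D]) auto
  qed
  then have pol: "Polish_topology T"
    using completely_metrizable_space_euclidean homeomorphic_map_imp_homeomorphic_space[OF hom]
      homeomorphic_completely_metrizable_space homeomorphic_separable_space
    unfolding Polish_topology_def by blast
  define S where "S = i ` space N"
  define j where "j = the_inv_into (space N) i"
  have iN: "i \<in> borel_measurable N" and inj: "inj_on i (space N)" and S: "S \<in> sets borel"
    using i unfolding borel_embedding_def S_def by auto
  have inv_kappa: "inv_into UNIV \<kappa> \<in> borel_measurable (borel_of T)"
  proof (rule borel_measurableI)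
    fix V :: "'p set" assume "open V"
    then show "inv_into UNIV \<kappa> -` V \<inter> space (borel_of T) \<in> sets (borel_of T)"
      unfolding space_borel_of top sets_borel_of by (intro sigma_sets.Basic) (auto simp: openT)
  qed
  define B where "B = inv_into UNIV \<kappa> -` S \<inter> topspace T"
  have B: "B \<in> sets (borel_of T)" unfolding B_def using measurable_sets[OF inv_kappa S] by simp
  have spB: "space (restrict_space (borel_of T) B) = B" by (auto simp: space_restrict_space B_def)
  have "\<kappa> \<circ> i \<in> N \<rightarrow>\<^sub>M borel_of T"
    unfolding borel_of_def
  proof (rule measurable_measure_of)
    show "{U. openin T U} \<subseteq> Pow (topspace T)" by (auto dest: openin_subset)
    fix U assume "U \<in> {U. openin T U}"
    then obtain V where V: "open V" "U = inv_into UNIV \<kappa> -` V \<inter> range \<kappa>" by (auto simp: openT)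
    then have "(\<kappa> \<circ> i) -` U \<inter> space N = i -` V \<inter> space N" using \<kappa> by auto
    then show "(\<kappa> \<circ> i) -` U \<inter> space N \<in> sets N" using measurable_sets[OF iN] V by auto
  qed (auto simp: top)
  then have f: "\<kappa> \<circ> i \<in> N \<rightarrow>\<^sub>M restrict_space (borel_of T) B"
    using \<kappa> by (intro measurable_restrict_space2) (auto simp: B_def S_def top)
  have "inv_into UNIV \<kappa> \<in> restrict_space (borel_of T) B \<rightarrow>\<^sub>M restrict_space borel S"
    by (intro measurable_restrict_space2 measurable_restrict_space1 inv_kappa) (auto simp: spB, simp add: B_def)
  then have g: "j \<circ> inv_into UNIV \<kappa> \<in> restrict_space (borel_of T) B \<rightarrow>\<^sub>M N"
    using borel_embedding_inverse[OF i] unfolding j_def S_def by (rule measurable_comp)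
  have "(j \<circ> inv_into UNIV \<kappa>) ((\<kappa> \<circ> i) x) = x" if "x \<in> space N" for x
    using that \<kappa> inj by (simp add: j_def the_inv_into_f_f)
  moreover have "(\<kappa> \<circ> i) ((j \<circ> inv_into UNIV \<kappa>) y) = y" if "y \<in> space (restrict_space (borel_of T) B)" for y
  proof -
    have "y \<in> B" using that spB by simp
    then obtain x p where "x \<in> space N" "y = \<kappa> p" "inv_into UNIV \<kappa> y = i x"
      unfolding B_def top S_def by auto
    then show ?thesis using \<kappa> inj by (simp add: j_def the_inv_into_f_f)
  qed
  ultimately have "Borel_isomorphic N (restrict_space (borel_of T) B)"
    unfolding Borel_isomorphic_def using f g by blast
  then show ?thesis unfolding standard_Borel_def using pol B by blast
qed

section \<open>Measurable selections from compact sets\<close>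

definition solutions ::
    "'z set \<Rightarrow> (nat \<Rightarrow> 'x \<Rightarrow> 'z \<Rightarrow> real) \<Rightarrow> 'x \<Rightarrow> 'z set" where
  "solutions Z f x = {z \<in> Z. \<forall>n. f n x z \<le> 0}"

definition Caratheodory :: "'x measure \<Rightarrow> 'z::topological_space set \<Rightarrow> ('x \<Rightarrow> 'z \<Rightarrow> real) \<Rightarrow> bool" where
  "Caratheodory X Z f \<longleftrightarrow>
     (\<forall>z\<in>Z. (\<lambda>x. f x z) \<in> borel_measurable X) \<and> (\<forall>x\<in>space X. continuous_on Z (f x))"

text \<open>Existence over an uncountable set is replaced by a countable condition: for every
  \<open>m\<close> some point of a countable dense set meets the first \<open>Suc m\<close>
  constraints up to an error below \<open>1 / Suc m\<close>. Continuity gives one direction; for the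
  other, a limit point of such approximate solutions solves all constraints.\<close>

lemma solutions_nonempty_measurable:
  fixes Z :: "'z::{metric_space,second_countable_topology} set"
  assumes Z: "compact Z" and f: "\<And>n. Caratheodory X Z (f n)"
  shows "{x \<in> space X. solutions Z f x \<noteq> {}} \<in> sets X"
proof -
  obtain Q where Q: "countable Q" "Q \<subseteq> Z" "Z \<subseteq> closure Q" using separable by blast
  have "{x \<in> space X. solutions Z f x \<noteq> {}} =
    {x \<in> space X. \<forall>m. \<exists>q\<in>Q. \<forall>n\<in>{..m}. f n x q < 1 / Suc m}"
  proof (intro Collect_cong conj_cong refl iffI allI)
    fix x m assume x: "x \<in> space X" and "solutions Z f x \<noteq> {}"
    then obtain z where z: "z \<in> Z" "\<And>n. f n x z \<le> 0" unfolding solutions_def by auto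
    have "\<forall>n\<in>{..m}. \<exists>d>0. \<forall>y\<in>Z. dist y z < d \<longrightarrow> dist (f n x y) (f n x z) < 1 / Suc m"
    proof
      fix n
      have "continuous_on Z (f n x)" using f x unfolding Caratheodory_def by simp
      then show "\<exists>d>0. \<forall>y\<in>Z. dist y z < d \<longrightarrow> dist (f n x y) (f n x z) < 1 / Suc m"
        using z(1) unfolding continuous_on_iff by simp
    qed
    from bchoice[OF this] obtain d where
      d: "\<forall>n\<in>{..m}. d n > 0 \<and> (\<forall>y\<in>Z. dist y z < d n \<longrightarrow> dist (f n x y) (f n x z) < 1 / Suc m)" by auto
    define e where "e = Min (d ` {..m})"
    have e: "e > 0" "\<And>n. n \<in> {..m} \<Longrightarrow> e \<le> d n" using d unfolding e_def by auto
    obtain q where q: "q \<in> Q" "dist q z < e"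
      using z(1) Q(3) e(1) unfolding closure_approachable by (meson subsetD closure_approachable)
    have "f n x q < 1 / Suc m" if n: "n \<in> {..m}" for n
    proof -
      have "q \<in> Z" "dist q z < d n" using q Q(2) e(2)[OF n] by auto
      then have "dist (f n x q) (f n x z) < 1 / Suc m" using d n by simp
      then show ?thesis using z(2)[of n] unfolding dist_real_def by linarith
    qed
    then show "\<exists>q\<in>Q. \<forall>n\<in>{..m}. f n x q < 1 / Suc m" using q by blast
  next
    fix x assume x: "x \<in> space X" and "\<forall>m. \<exists>q\<in>Q. \<forall>n\<in>{..m}. f n x q < 1 / Suc m"
    then obtain q where q: "\<And>m. q m \<in> Q" "\<And>m n. n \<le> m \<Longrightarrow> f n x (q m) < 1 / Suc m"
      by (metis atMost_iff)
    then have qZ: "q m \<in> Z" for m using Q(2) by auto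
    obtain z r where z: "z \<in> Z" "strict_mono r" "(q \<circ> r) \<longlonglongrightarrow> z"
      using Z qZ unfolding compact_def by metis
    have "f n x z \<le> 0" for n
    proof (rule LIMSEQ_le)
      have "continuous_on Z (f n x)" using f x unfolding Caratheodory_def by simp
      then show "(\<lambda>m. f n x ((q \<circ> r) m)) \<longlonglongrightarrow> f n x z"
        using z qZ unfolding continuous_on_sequentially comp_def by auto
      show "(\<lambda>m. 1 / Suc m) \<longlonglongrightarrow> (0::real)" by (rule LIMSEQ_Suc[OF lim_1_over_n])
      show "\<exists>N. \<forall>m\<ge>N. f n x ((q \<circ> r) m) \<le> 1 / Suc m"
      proof (intro exI allI impI)
        fix m assume "n \<le> m"
        \<comment> \<open>The subsequence index is at least \<open>m\<close>, so constraint
          \<open>n\<close> is already enforced there and the error bound \<open>1 / Suc m\<close>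
          still holds.\<close>
        moreover have m: "m \<le> r m" by (rule seq_suble[OF z(2)])
        ultimately have "f n x (q (r m)) \<le> 1 / Suc (r m)" using q(2)[of n "r m"] by simp
        also have "\<dots> \<le> 1 / Suc m" using m by (simp add: frac_le)
        finally show "f n x ((q \<circ> r) m) \<le> 1 / Suc m" by simp
      qed
    qed
    then show "solutions Z f x \<noteq> {}" using z(1) unfolding solutions_def by auto
  qed
  also have "\<dots> \<in> sets X"
  proof -
    have m: "(\<lambda>x. f n x q) \<in> borel_measurable X" if "q \<in> Q" for n q
      using f Q(2) that unfolding Caratheodory_def by auto
    have "{x \<in> space X. f n x q < 1 / Suc m} \<in> sets X" if "q \<in> Q" for m n q
      using m[OF that, of n] by measurable
    then show ?thesis
      by (intro sets.sets_Collect_countable_All sets.sets_Collect_countable_Ex' sets.sets_Collect_finite_All' Q) auto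
  qed
  finally show ?thesis .
qed

lemma compact_solutions:
  fixes Z :: "'z::metric_space set"
  assumes "compact Z" "\<And>n. Caratheodory X Z (f n)" "x \<in> space X"
  shows "compact (solutions Z f x)"
proof -
  have "closed (Z \<inter> f n x -` {..0})" for n
    using assms compact_imp_closed unfolding Caratheodory_def by (intro continuous_closed_preimage) auto
  then have "closed (\<Inter>n. Z \<inter> f n x -` {..0})" by (intro closed_INT ballI)
  moreover have "solutions Z f x = Z \<inter> (\<Inter>n. Z \<inter> f n x -` {..0})" unfolding solutions_def by auto
  ultimately show ?thesis using assms(1) by (metis compact_Int_closed)
qed

lemma solutions_case_nat:
  "solutions Z (case_nat g0 g) x = {z \<in> solutions Z g x. g0 x z \<le> 0}"
proof -
  have "(\<forall>n. case_nat g0 g n x z \<le> 0) \<longleftrightarrow> g0 x z \<le> 0 \<and> (\<forall>n. g n x z \<le> 0)" for z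
  proof safe
    assume all: "\<forall>n. case_nat g0 g n x z \<le> 0"
    show "g0 x z \<le> 0" "g n x z \<le> 0" for n
      using spec[OF all, of 0] spec[OF all, of "Suc n"] by simp_all
  qed (simp split: nat.split)
  then show ?thesis unfolding solutions_def by auto
qed

lemma Caratheodory_case_nat:
  assumes "Caratheodory X Z g0" "\<And>i. Caratheodory X Z (g i)"
  shows "Caratheodory X Z (case_nat g0 g i)"
  using assms by (cases i) auto

text \<open>The selection minimises \<open>h 0\<close> over the solution set, then \<open>h 1\<close> over the set of minimisers,
  and so on: the successive minima are measurable and adding them as constraints keeps the
  problem in the same form.\<close>

theorem measurable_selection_minimising:
  fixes X :: "'x measure" and Z :: "'z::{metric_space,second_countable_topology} set"
  assumes Z: "compact Z" and f: "\<And>n. Caratheodory X Z (f n)"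
    and h: "\<And>n. continuous_on Z (h n :: 'z \<Rightarrow> real)"
    and ne: "\<And>x. x \<in> space X \<Longrightarrow> solutions Z f x \<noteq> {}"
  shows "\<exists>s. (\<forall>n::nat. (\<lambda>x. h n (s x)) \<in> borel_measurable X) \<and>
    (\<forall>x\<in>space X. s x \<in> solutions Z f x \<and> (\<forall>z\<in>solutions Z f x. h 0 (s x) \<le> h 0 z))"
proof -
  define C where "C = rec_nat (solutions Z f) (\<lambda>n D x. {z \<in> D x. \<forall>y\<in>D x. h n z \<le> h n y})"
  have C0: "C 0 = solutions Z f" and CS: "C (Suc n) x = {z \<in> C n x. \<forall>y\<in>C n x. h n z \<le> h n y}" for n x
    unfolding C_def by auto
  define m where "m n x = Inf (h n ` C n x)" for n x
  have CZ: "C n x \<subseteq> Z" for n x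
    by (induction n) (auto simp: C0 CS solutions_def)
  have step: "C n x \<noteq> {} \<and> compact (C n x) \<Longrightarrow>
      (\<exists>z\<in>C n x. h n z = m n x) \<and> C (Suc n) x = {z \<in> C n x. h n z \<le> m n x} \<and> (\<forall>z\<in>C n x. m n x \<le> h n z)" for n x
  proof -
    assume *: "C n x \<noteq> {} \<and> compact (C n x)"
    then obtain z where z: "z \<in> C n x" "\<And>y. y \<in> C n x \<Longrightarrow> h n z \<le> h n y"
      using continuous_attains_inf[of "C n x" "h n"] continuous_on_subset[OF h CZ] by metis
    then have m: "m n x = h n z" unfolding m_def by (intro cInf_eq_minimum) auto
    show ?thesis
    proof (intro conjI ballI)
      show "\<exists>z\<in>C n x. h n z = m n x" using z m by auto
      show "C (Suc n) x = {z \<in> C n x. h n z \<le> m n x}" unfolding CS m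
        using z order_trans by blast
      show "m n x \<le> h n y" if "y \<in> C n x" for y using m z that by simp
    qed
  qed
  have good: "x \<in> space X \<Longrightarrow> C n x \<noteq> {} \<and> compact (C n x)" for n x
  proof (induction n)
    case 0 then show ?case using ne compact_solutions[OF Z f] unfolding C0 by auto
  next
    case (Suc n)
    then have IH: "C n x \<noteq> {} \<and> compact (C n x)" by simp
    note s = step[OF IH]
    have "C (Suc n) x = C n x \<inter> h n -` {..m n x}" using s by auto
    moreover have "closed (C n x \<inter> h n -` {..m n x})"
      using IH continuous_on_subset[OF h CZ] compact_imp_closed by (intro continuous_closed_preimage) auto
    moreover have "C n x \<inter> (C n x \<inter> h n -` {..m n x}) = C n x \<inter> h n -` {..m n x}" by auto
    ultimately have "compact (C (Suc n) x)" using IH compact_Int_closed by metis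
    then show ?case using s by force
  qed
  note step = step[OF good]
  have rep: "\<exists>g. (\<forall>i. Caratheodory X Z (g i)) \<and> (\<forall>x\<in>space X. C n x = solutions Z g x)"
    and meas: "m n \<in> borel_measurable X" for n
  proof -
    \<comment> \<open>The minimum is at most \<open>c\<close> exactly when the system stays solvable
      after the constraint \<open>h n z - c \<le> 0\<close> is added. This is a measurable condition
      as long as \<open>C n\<close> is itself given by constraints.\<close>
    have meas: "m n \<in> borel_measurable X"
      if g: "\<forall>i. Caratheodory X Z (g i)" "\<forall>x\<in>space X. C n x = solutions Z g x" for n and g :: "nat \<Rightarrow> 'x \<Rightarrow> 'z \<Rightarrow> real"
    proof (rule borel_measurableI_le)
      fix c
      define g' where "g' = case_nat (\<lambda>x z. h n z - c) g"
      have "Caratheodory X Z (g' i)" for i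
        unfolding g'_def using g(1) h
        by (intro Caratheodory_case_nat) (auto simp: Caratheodory_def intro!: continuous_intros)
      then have "{x \<in> space X. solutions Z g' x \<noteq> {}} \<in> sets X"
        by (rule solutions_nonempty_measurable[OF Z])
      moreover have "m n x \<le> c \<longleftrightarrow> solutions Z g' x \<noteq> {}" if x: "x \<in> space X" for x
      proof -
        have "solutions Z g' x = {z \<in> C n x. h n z \<le> c}"
          using g(2) x unfolding g'_def solutions_case_nat by simp
        then show ?thesis using step[OF x, of n] by force
      qed
      then have "{x \<in> space X. m n x \<le> c} = {x \<in> space X. solutions Z g' x \<noteq> {}}"
        by (intro Collect_cong conj_cong refl)
      ultimately show "{x \<in> space X. m n x \<le> c} \<in> sets X" by simp
    qed
    have rep: "\<exists>g. (\<forall>i. Caratheodory X Z (g i)) \<and> (\<forall>x\<in>space X. C n x = solutions Z g x)" for n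
    proof (induction n)
      case 0 then show ?case using f unfolding C0 by auto
    next
      case (Suc n)
      from Suc obtain g where g: "\<forall>i. Caratheodory X Z (g i)" "\<forall>x\<in>space X. C n x = solutions Z g x"
        by (elim exE conjE)
      \<comment> \<open>The measurable minimum \<open>m n x\<close> becomes the bound of a new
        constraint, so the set of minimisers is again a solution set.\<close>
      define g' where "g' = case_nat (\<lambda>x z. h n z - m n x) g"
      have "Caratheodory X Z (g' i)" for i
        unfolding g'_def using g(1) h meas[OF g]
        by (intro Caratheodory_case_nat) (auto simp: Caratheodory_def intro!: continuous_intros)
      moreover have "C (Suc n) x = solutions Z g' x" if x: "x \<in> space X" for x
        using g(2) x step[OF x, of n] unfolding g'_def solutions_case_nat by simp
      ultimately show ?case by (intro exI[of _ g']) simp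
    qed
    show "\<exists>g. (\<forall>i. Caratheodory X Z (g i)) \<and> (\<forall>x\<in>space X. C n x = solutions Z g x)" by (rule rep)
    obtain g where "\<forall>i. Caratheodory X Z (g i)" "\<forall>x\<in>space X. C n x = solutions Z g x"
      using rep[of n] by (elim exE conjE)
    then show "m n \<in> borel_measurable X" by (rule meas)
  qed
  \<comment> \<open>Any common point will do: \<open>h n\<close> takes the value
    \<open>m n x\<close> at all points of \<open>C (Suc n) x\<close>, so measurability of
    \<open>h n (s x)\<close> does not depend on the choice.\<close>
  define s where "s x = (SOME z. \<forall>n. z \<in> C n x)" for x
  have s: "s x \<in> C n x" if x: "x \<in> space X" for x n
  proof -
    have "Z \<inter> (\<Inter>n\<in>UNIV. C n x) \<noteq> {}"
    proof (rule compact_imp_fip_image[OF Z])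
      show "closed (C n x)" for n using good[OF x] compact_imp_closed by auto
      fix I :: "nat set" assume "finite I"
      then obtain k where k: "I \<subseteq> {..k}" using finite_nat_iff_bounded_le by auto
      have dec: "C (Suc n) x \<subseteq> C n x" for n by (auto simp: CS)
      have "C k x \<subseteq> C n x" if "n \<in> I" for n
      proof -
        have "n \<le> k" using k that by auto
        then show ?thesis by (rule lift_Suc_antimono_le[of "\<lambda>n. C n x", OF dec])
      qed
      then have "C k x \<subseteq> Z \<inter> (\<Inter>n\<in>I. C n x)" using CZ by auto
      then show "Z \<inter> (\<Inter>n\<in>I. C n x) \<noteq> {}" using good[OF x, of k] by (metis subset_empty)
    qed
    then have "\<exists>z. \<forall>n. z \<in> C n x" by auto
    from someI_ex[OF this] show ?thesis unfolding s_def by simp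
  qed
  have hs: "h n (s x) = m n x" if x: "x \<in> space X" for x n
    using s[OF x, of n] s[OF x, of "Suc n"] step[OF x, of n] by force
  show ?thesis
  proof (intro exI[of _ s] conjI allI ballI)
    show "(\<lambda>x. h n (s x)) \<in> borel_measurable X" for n
      using meas[of n] by (subst measurable_cong[OF hs]) auto
    fix x assume x: "x \<in> space X"
    show "s x \<in> solutions Z f x" using s[OF x, of 0] C0 by simp
    fix z assume "z \<in> solutions Z f x"
    then show "h 0 (s x) \<le> h 0 z" using s[OF x, of "Suc 0"] unfolding CS C0 by simp
  qed
qed

section \<open>Characters of a group with a dense sequence\<close>

text \<open>Formal words rather than their values index the dense subgroup: they form a single
  countable type for all fibres, whatever relations hold between the generators in a particular
  group.\<close>

type_synonym word = "(bool \<times> nat) list"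

fun word_value :: "('g, 'm) monoid_scheme \<Rightarrow> (nat \<Rightarrow> 'g) \<Rightarrow> word \<Rightarrow> 'g" where
  "word_value G a [] = \<one>\<^bsub>G\<^esub>"
| "word_value G a ((b, n) # w) = (if b then a n else inv\<^bsub>G\<^esub> a n) \<otimes>\<^bsub>G\<^esub> word_value G a w"

text \<open>Conjugation stands for inversion: it agrees with it on the torus and is continuous on
  all tuples. Words with the same value in the group may still receive different numbers; only
  smallness near the unit excludes this.\<close>

fun torus_word :: "(nat \<Rightarrow> complex) \<Rightarrow> word \<Rightarrow> complex" where
  "torus_word u [] = 1"
| "torus_word u ((b, n) # w) = (if b then u n else cnj (u n)) * torus_word u w"

definition inverse_word :: "word \<Rightarrow> word" where
  "inverse_word w = rev (map (\<lambda>(b, n). (\<not> b, n)) w)"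

definition torus :: "(nat \<Rightarrow> complex) set" where
  "torus = {u. \<forall>n. norm (u n) = 1}"

lemma torus_word_append: "torus_word u (v @ w) = torus_word u v * torus_word u w"
  by (induction v) auto

lemma norm_torus_word: "u \<in> torus \<Longrightarrow> norm (torus_word u w) = 1"
  by (induction w) (auto simp: torus_def norm_mult)

lemma torus_word_inverse: "torus_word u (inverse_word w) = cnj (torus_word u w)"
  by (induction w) (auto simp: inverse_word_def torus_word_append)

lemma continuous_on_torus_word: "continuous_on S (\<lambda>u. torus_word u w)"
proof (induction w)
  case (Cons x w)
  have "continuous_on S (\<lambda>u. u (snd x))"
    by (rule continuous_on_subset[OF continuous_on_product_coordinates]) auto
  then show ?case using Cons by (cases x; cases "fst x") (auto intro!: continuous_intros)
qed simp

lemma compact_torus: "compact torus"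
proof -
  have "compactin (product_topology (\<lambda>n::nat. euclidean :: complex topology) UNIV) (PiE UNIV (\<lambda>n. sphere 0 1))"
    by (simp add: compactin_PiE)
  moreover have "PiE UNIV (\<lambda>n. sphere 0 1) = torus" by (auto simp: torus_def PiE_def)
  ultimately show ?thesis by (simp add: euclidean_product_topology)
qed

text \<open>If \<open>z\<close> is within 1/2 of 1, then
  \<open>norm (z + 1) \<ge> 2 - 1/2 = 3/2\<close>, and \<open>z * z - 1\<close> factors as
  \<open>(z - 1) * (z + 1)\<close>. This is the origin of the factor 2/3.\<close>

lemma norm_minus_one_halving:
  fixes z :: complex
  assumes "norm (z - 1) \<le> 1/2" "norm (z * z - 1) \<le> c"
  shows "norm (z - 1) \<le> 2/3 * c"
proof -
  have "norm (z + 1) \<ge> 3/2"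
    using norm_triangle_ineq4[of "z + 1" "z - 1"] assms(1) by simp
  moreover have "z * z - 1 = (z - 1) * (z + 1)" by (simp add: algebra_simps)
  ultimately have "norm (z - 1) * (3/2) \<le> norm (z * z - 1)"
    by (metis mult_left_mono norm_ge_zero norm_mult)
  then show ?thesis using assms(2) by simp
qed

lemma circle_group_simps [simp]:
  "carrier circle_group = sphere 0 1" "mult circle_group = (*)" "one circle_group = 1"
  by (simp_all add: circle_group_def)

lemma Pontryagin_dual_simps [simp]:
  "mult (Pontryagin_dual G T) = (\<lambda>\<omega> \<eta>. \<lambda>g\<in>carrier G. \<omega> g * \<eta> g)"
  "one (Pontryagin_dual G T) = (\<lambda>g\<in>carrier G. 1)"
  by (simp_all add: Pontryagin_dual_def)

lemma carrier_Pontryagin_dual: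
  "\<omega> \<in> carrier (Pontryagin_dual G T) \<longleftrightarrow>
     \<omega> \<in> extensional (carrier G) \<and> \<omega> \<in> hom G circle_group \<and> continuous_map T circle_topology \<omega>"
  by (simp add: Pontryagin_dual_def)

text \<open>The metric \<open>d\<close> is not assumed invariant under translations. Uniform
  closeness of \<open>g\<close> and \<open>h\<close> is therefore expressed by
  \<open>inv g \<otimes> h\<close> lying in an open set around the unit.\<close>

locale dense_sequence_group =
  fixes G :: "('g, 'm) monoid_scheme" and T :: "'g topology" and d :: "'g \<Rightarrow> 'g \<Rightarrow> real"
    and a :: "nat \<Rightarrow> 'g"
  assumes top_group: "topological_group G T"
    and metric: "Metric_space (carrier G) d"
    and mtop: "Metric_space.mtopology (carrier G) d = T"
    and a_closed: "a n \<in> carrier G"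
    and dense: "T closure_of range a = topspace T"
begin

sublocale group G using top_group unfolding topological_group_def by simp
sublocale Metric_space "carrier G" d by (rule metric)

abbreviation p :: "word \<Rightarrow> 'g" where "p \<equiv> word_value G a"
abbreviation dual :: "('g \<Rightarrow> complex) monoid" where "dual \<equiv> Pontryagin_dual G T"

definition small :: "nat \<Rightarrow> (nat \<Rightarrow> complex) \<Rightarrow> bool" where
  "small k u \<longleftrightarrow> (\<forall>w. d \<one>\<^bsub>G\<^esub> (p w) < 1 / Suc k \<longrightarrow> norm (torus_word u w - 1) \<le> 1/2)"

lemma topspace_T [simp]: "topspace T = carrier G"
  using top_group unfolding topological_group_def by simp

lemma p_closed [simp]: "p w \<in> carrier G"
  by (induction w) (auto simp: a_closed)

lemma p_append: "p (v @ w) = p v \<otimes>\<^bsub>G\<^esub> p w"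
  by (induction v) (auto simp: a_closed m_assoc)

lemma p_inverse: "p (inverse_word w) = inv\<^bsub>G\<^esub> (p w)"
proof (induction w)
  case (Cons x w)
  obtain b n where x: "x = (b, n)" by (cases x)
  have "p (inverse_word (x # w)) = p (inverse_word w) \<otimes>\<^bsub>G\<^esub> p [(\<not> b, n)]"
    by (simp add: x inverse_word_def p_append del: word_value.simps)
  also have "\<dots> = inv\<^bsub>G\<^esub> (p (x # w))"
    unfolding Cons x by (cases b) (simp_all add: a_closed inv_mult_group)
  finally show ?case .
qed (simp add: inverse_word_def)

lemma p_single: "p [(True, n)] = a n"
  by (simp add: a_closed)

lemma dense_word:
  assumes "openin T A" "g \<in> A"
  shows "\<exists>n. a n \<in> A"
  using dense assms unfolding dense_intersects_open by blast

lemma continuous_mult: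
  assumes "continuous_map S T f" "continuous_map S T h"
  shows "continuous_map S T (\<lambda>x. f x \<otimes>\<^bsub>G\<^esub> h x)"
proof -
  have "continuous_map S (prod_topology T T) (\<lambda>x. (f x, h x))"
    using assms by (simp add: continuous_map_pairwise comp_def)
  moreover have "continuous_map (prod_topology T T) T (\<lambda>(g, h). g \<otimes>\<^bsub>G\<^esub> h)"
    using top_group unfolding topological_group_def by simp
  ultimately show ?thesis using continuous_map_compose by (fastforce simp: comp_def)
qed

lemma continuous_inv:
  assumes "continuous_map S T f"
  shows "continuous_map S T (\<lambda>x. inv\<^bsub>G\<^esub> f x)"
proof -
  have "continuous_map T T (\<lambda>g. inv\<^bsub>G\<^esub> g)"
    using top_group unfolding topological_group_def by simp
  then show ?thesis using continuous_map_compose[OF assms] by (simp add: comp_def)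
qed

lemma continuous_translation:
  "g \<in> carrier G \<Longrightarrow> continuous_map T T (\<lambda>h. g \<otimes>\<^bsub>G\<^esub> h)"
  by (intro continuous_mult) auto

lemma openin_translate:
  assumes "openin T A" "g \<in> carrier G"
  shows "openin T {h \<in> carrier G. inv\<^bsub>G\<^esub> g \<otimes>\<^bsub>G\<^esub> h \<in> A}"
  using openin_continuous_map_preimage[OF continuous_translation assms(1), of "inv\<^bsub>G\<^esub> g"] assms(2)
  by simp

text \<open>The set of \<open>h\<close> with \<open>inv h \<otimes> g \<in> A\<close> is open and
  contains \<open>g\<close>, so the dense sequence meets it.\<close>

lemma translates_cover:
  assumes "openin T A" "\<one>\<^bsub>G\<^esub> \<in> A" "g \<in> carrier G"
  shows "\<exists>n. inv\<^bsub>G\<^esub> (a n) \<otimes>\<^bsub>G\<^esub> g \<in> A"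
proof -
  have "continuous_map T T (\<lambda>h. inv\<^bsub>G\<^esub> h \<otimes>\<^bsub>G\<^esub> g)"
    using assms(3) by (intro continuous_mult continuous_inv) auto
  then have "openin T {h \<in> topspace T. inv\<^bsub>G\<^esub> h \<otimes>\<^bsub>G\<^esub> g \<in> A}"
    using assms(1) by (rule openin_continuous_map_preimage)
  then show ?thesis using dense_word[of "{h \<in> topspace T. inv\<^bsub>G\<^esub> h \<otimes>\<^bsub>G\<^esub> g \<in> A}" g] assms by auto
qed

lemma openin_ball_one:
  assumes "openin T A" "\<one>\<^bsub>G\<^esub> \<in> A"
  shows "\<exists>k. mball \<one>\<^bsub>G\<^esub> (1 / Suc k) \<subseteq> A"
proof -
  obtain r where r: "r > 0" "mball \<one>\<^bsub>G\<^esub> r \<subseteq> A"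
    using assms unfolding mtop[symmetric] openin_mtopology by auto
  then obtain k where "1 / Suc k < r" using nat_approx_posE[of r] by (metis of_nat_Suc)
  then have "mball \<one>\<^bsub>G\<^esub> (1 / Suc k) \<subseteq> mball \<one>\<^bsub>G\<^esub> r" by (intro mball_subset_concentric) auto
  then show ?thesis using r by blast
qed

text \<open>Induction on \<open>N\<close>: the next neighbourhood consists of the elements of the
  ball whose square lies in the previous one. The word \<open>w @ w\<close> has the squared value,
  so the halving estimate improves the bound by 2/3. The neighbourhood is chosen before
  \<open>u\<close>, which makes the bound uniform over all small tuples.\<close>

lemma equicontinuous:
  "\<exists>A. openin T A \<and> \<one>\<^bsub>G\<^esub> \<in> A \<and>
     (\<forall>u w. small k u \<longrightarrow> p w \<in> A \<longrightarrow> norm (torus_word u w - 1) \<le> (2/3) ^ N)"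
proof -
  define B where "B = mball \<one>\<^bsub>G\<^esub> (1 / Suc k)"
  have B: "openin T B" "\<one>\<^bsub>G\<^esub> \<in> B" unfolding B_def mtop[symmetric] by auto
  have half: "norm (torus_word u w - 1) \<le> 1/2" if "small k u" "p w \<in> B" for u w
    using that unfolding small_def B_def by simp
  show ?thesis
  proof (induction N)
    case 0
    show ?case using B half by (intro exI[of _ B]) force
  next
    case (Suc N)
    then obtain A where A: "openin T A" "\<one>\<^bsub>G\<^esub> \<in> A"
      "\<And>u w. small k u \<Longrightarrow> p w \<in> A \<Longrightarrow> norm (torus_word u w - 1) \<le> (2/3) ^ N" by auto
    define A' where "A' = B \<inter> {g \<in> topspace T. g \<otimes>\<^bsub>G\<^esub> g \<in> A}"
    have "openin T A'" unfolding A'_def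
      by (intro openin_Int B openin_continuous_map_preimage[OF _ A(1)] continuous_mult) auto
    moreover have "\<one>\<^bsub>G\<^esub> \<in> A'" unfolding A'_def using A B by simp
    moreover have "norm (torus_word u w - 1) \<le> (2/3) ^ Suc N" if "small k u" "p w \<in> A'" for u w
    proof -
      have "p (w @ w) \<in> A" "p w \<in> B" using that(2) unfolding A'_def p_append by auto
      then show ?thesis
        using norm_minus_one_halving[OF half[OF that(1)] A(3)[OF that(1), of "w @ w", unfolded torus_word_append]]
        by simp
    qed
    ultimately show ?case by blast
  qed
qed

lemma dualD:
  assumes "\<omega> \<in> carrier dual"
  shows "\<omega> \<in> extensional (carrier G)" "g \<in> carrier G \<Longrightarrow> norm (\<omega> g) = 1"
    "g \<in> carrier G \<Longrightarrow> h \<in> carrier G \<Longrightarrow> \<omega> (g \<otimes>\<^bsub>G\<^esub> h) = \<omega> g * \<omega> h"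
    "continuous_map T euclidean \<omega>"
  using assms unfolding carrier_Pontryagin_dual hom_def Pi_iff
  by (auto simp: continuous_map_in_subtopology)

lemma dual_one:
  assumes "\<omega> \<in> carrier dual"
  shows "\<omega> \<one>\<^bsub>G\<^esub> = 1"
proof -
  have "\<omega> \<one>\<^bsub>G\<^esub> * \<omega> \<one>\<^bsub>G\<^esub> = \<omega> \<one>\<^bsub>G\<^esub>" "\<omega> \<one>\<^bsub>G\<^esub> \<noteq> 0"
    using dualD(3)[OF assms, of "\<one>\<^bsub>G\<^esub>" "\<one>\<^bsub>G\<^esub>"] dualD(2)[OF assms, of "\<one>\<^bsub>G\<^esub>"] by auto
  then show ?thesis by simp
qed

lemma dual_inv:
  assumes "\<omega> \<in> carrier dual" "g \<in> carrier G"
  shows "\<omega> (inv\<^bsub>G\<^esub> g) = cnj (\<omega> g)"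
proof -
  have "\<omega> (inv\<^bsub>G\<^esub> g) * \<omega> g = 1"
    using dualD(3)[OF assms(1), of "inv\<^bsub>G\<^esub> g" g] assms(2) dual_one[OF assms(1)]
    by simp
  moreover have "cnj (\<omega> g) * \<omega> g = 1"
    using dualD(2)[OF assms] complex_norm_square[of "\<omega> g"] by (simp add: mult.commute)
  ultimately show ?thesis using dualD(2)[OF assms] by (metis mult_right_cancel norm_zero zero_neq_one)
qed

lemma dual_word:
  assumes "\<omega> \<in> carrier dual"
  shows "\<omega> (p w) = torus_word (\<lambda>n. \<omega> (a n)) w"
  by (induction w)
    (use assms in \<open>auto simp: dual_one dualD(3) dual_inv a_closed\<close>)

lemma dual_torus: "\<omega> \<in> carrier dual \<Longrightarrow> (\<lambda>n. \<omega> (a n)) \<in> torus"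
  by (auto simp: torus_def dualD(2) a_closed)

lemma dual_near_one:
  assumes "\<omega> \<in> carrier dual" "e > 0"
  shows "\<exists>A. openin T A \<and> \<one>\<^bsub>G\<^esub> \<in> A \<and> (\<forall>g\<in>A. norm (\<omega> g - 1) < e)"
proof -
  have "openin T {g \<in> topspace T. \<omega> g \<in> ball 1 e}"
    using dualD(4)[OF assms(1)] by (rule openin_continuous_map_preimage) simp
  then show ?thesis using assms(2) dual_one[OF assms(1)]
    by (intro exI[of _ "{g \<in> topspace T. \<omega> g \<in> ball 1 e}"]) (auto simp: dist_norm norm_minus_commute)
qed

lemma dual_small:
  assumes "\<omega> \<in> carrier dual"
  shows "\<exists>k. small k (\<lambda>n. \<omega> (a n))"
proof -
  obtain A where A: "openin T A" "\<one>\<^bsub>G\<^esub> \<in> A" "\<And>g. g \<in> A \<Longrightarrow> norm (\<omega> g - 1) < 1/2"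
    using dual_near_one[OF assms, of "1/2"] by auto
  obtain k where k: "mball \<one>\<^bsub>G\<^esub> (1 / Suc k) \<subseteq> A" using openin_ball_one[OF A(1,2)] by auto
  have "small k (\<lambda>n. \<omega> (a n))" unfolding small_def dual_word[OF assms, symmetric]
  proof (intro allI impI)
    fix w assume "d \<one>\<^bsub>G\<^esub> (p w) < 1 / Suc k"
    then have "p w \<in> A" using k by auto
    then show "norm (\<omega> (p w) - 1) \<le> 1/2" using A(3) by force
  qed
  then show ?thesis ..
qed

lemma dual_eqI:
  assumes "\<omega> \<in> carrier dual" "\<eta> \<in> carrier dual" "\<And>n. \<omega> (a n) = \<eta> (a n)"
  shows "\<omega> = \<eta>"
proof (rule extensionalityI[OF dualD(1)[OF assms(1)] dualD(1)[OF assms(2)]], rule ccontr)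
  fix g assume g: "g \<in> carrier G" "\<omega> g \<noteq> \<eta> g"
  have "openin T {h \<in> topspace T. \<omega> h - \<eta> h \<in> - {0}}"
    using dualD(4)[OF assms(1)] dualD(4)[OF assms(2)]
    by (intro openin_continuous_map_preimage[where Y = euclidean] continuous_map_diff) auto
  moreover have "g \<in> {h \<in> topspace T. \<omega> h - \<eta> h \<in> - {0}}" using g by simp
  ultimately obtain n where "a n \<in> {h \<in> topspace T. \<omega> h - \<eta> h \<in> - {0}}" by (metis dense_word)
  then show False using assms(3) by simp
qed

text \<open>Continuity at the unit is enough, since \<open>\<omega> h - \<omega> g\<close> equals
  \<open>\<omega> g\<close> times \<open>\<omega> (inv g \<otimes> h) - 1\<close> and
  \<open>\<omega> g\<close> has modulus 1.\<close>

lemma dualI: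
  assumes "\<omega> \<in> extensional (carrier G)"
    and norm: "\<And>g. g \<in> carrier G \<Longrightarrow> norm (\<omega> g) = 1"
    and mult: "\<And>g h. g \<in> carrier G \<Longrightarrow> h \<in> carrier G \<Longrightarrow> \<omega> (g \<otimes>\<^bsub>G\<^esub> h) = \<omega> g * \<omega> h"
    and cont: "\<And>e. e > 0 \<Longrightarrow> \<exists>A. openin T A \<and> \<one>\<^bsub>G\<^esub> \<in> A \<and> (\<forall>g\<in>A. norm (\<omega> g - 1) < e)"
  shows "\<omega> \<in> carrier dual"
proof -
  have "continuous_map T euclidean \<omega>"
    unfolding mtopology_is_euclidean[symmetric] Met_TC.continuous_map_to_metric
  proof (intro ballI allI impI)
    fix g and e :: real assume g: "g \<in> topspace T" and "e > 0"
    from cont[OF this(2)] obtain A where A: "openin T A" "\<one>\<^bsub>G\<^esub> \<in> A" "\<And>g. g \<in> A \<Longrightarrow> norm (\<omega> g - 1) < e"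
      by auto
    define B where "B = {h \<in> carrier G. inv\<^bsub>G\<^esub> g \<otimes>\<^bsub>G\<^esub> h \<in> A}"
    have "openin T B" unfolding B_def using A g by (intro openin_translate) auto
    moreover have "g \<in> B" using A g unfolding B_def by simp
    moreover have "dist (\<omega> g) (\<omega> h) < e" if "h \<in> B" for h
    proof -
      have h: "h \<in> carrier G" "norm (\<omega> (inv\<^bsub>G\<^esub> g \<otimes>\<^bsub>G\<^esub> h) - 1) < e"
        using that A(3) unfolding B_def by auto
      have "\<omega> h = \<omega> g * \<omega> (inv\<^bsub>G\<^esub> g \<otimes>\<^bsub>G\<^esub> h)"
        using g h(1) mult[of g "inv\<^bsub>G\<^esub> g \<otimes>\<^bsub>G\<^esub> h"] by (simp add: m_assoc[symmetric])
      then have "\<omega> h - \<omega> g = \<omega> g * (\<omega> (inv\<^bsub>G\<^esub> g \<otimes>\<^bsub>G\<^esub> h) - 1)" by (simp add: algebra_simps)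
      then have "norm (\<omega> h - \<omega> g) = norm (\<omega> (inv\<^bsub>G\<^esub> g \<otimes>\<^bsub>G\<^esub> h) - 1)"
        using norm[of g] g by (simp add: norm_mult)
      then show ?thesis using h(2) by (simp add: dist_norm norm_minus_commute)
    qed
    ultimately show "\<exists>U. openin T U \<and> g \<in> U \<and> (\<forall>y\<in>U. \<omega> y \<in> Met_TC.mball (\<omega> g) e)"
      by (intro exI[of _ B]) auto
  qed
  then show ?thesis using assms(1) norm mult
    unfolding carrier_Pontryagin_dual hom_def
    by (auto simp: continuous_map_in_subtopology)
qed

text \<open>The bound at the unit is applied to the word \<open>inverse_word v @ w\<close>. In
  particular two words with the same value get the same \<open>torus_word\<close>, because their
  quotient lies in every neighbourhood of the unit: a small tuple does define a homomorphism on the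
  subgroup of word values.\<close>

lemma torus_word_uniformly_continuous:
  assumes "u \<in> torus" "small k u" "e > 0"
  shows "\<exists>A. openin T A \<and> \<one>\<^bsub>G\<^esub> \<in> A \<and>
    (\<forall>v w. inv\<^bsub>G\<^esub> (p v) \<otimes>\<^bsub>G\<^esub> p w \<in> A \<longrightarrow> norm (torus_word u v - torus_word u w) < e)"
proof -
  obtain N where N: "(2/3)^N < e" using real_arch_pow_inv[OF assms(3), of "2/3"] by auto
  obtain A where A: "openin T A" "\<one>\<^bsub>G\<^esub> \<in> A"
    "\<And>w. p w \<in> A \<Longrightarrow> norm (torus_word u w - 1) \<le> (2/3) ^ N"
    using equicontinuous[of k N] assms(2) by blast
  have "norm (torus_word u v - torus_word u w) < e" if vw: "inv\<^bsub>G\<^esub> (p v) \<otimes>\<^bsub>G\<^esub> p w \<in> A" for v w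
  proof -
    have "p (inverse_word v @ w) \<in> A" using vw by (simp add: p_append p_inverse)
    from A(3)[OF this] have le: "norm (cnj (torus_word u v) * torus_word u w - 1) \<le> (2/3)^N"
      by (simp add: torus_word_append torus_word_inverse)
    have n: "norm (torus_word u v) = 1" using norm_torus_word[OF assms(1)] .
    then have "torus_word u v * cnj (torus_word u v) = 1"
      using complex_norm_square[of "torus_word u v"] by simp
    then have "torus_word u w - torus_word u v =
        torus_word u v * (cnj (torus_word u v) * torus_word u w - 1)"
      by (simp add: algebra_simps)
    then have "norm (torus_word u w - torus_word u v) \<le> (2/3)^N" using n le by (simp add: norm_mult)
    then show ?thesis using N by (simp add: norm_minus_commute)
  qed
  then show ?thesis using A by blast
qed

text \<open>The map sending \<open>(x, y)\<close> to \<open>inv x \<otimes> y\<close> is continuous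
  at \<open>(g, g)\<close>, so late terms have quotient near the unit. With \<open>v = w\<close>
  this gives the Cauchy property along one approximating sequence; with \<open>i = j\<close> it
  shows that two sequences approximating \<open>g\<close> lead to the same limit.\<close>

lemma torus_word_limits_agree:
  assumes u: "u \<in> torus" "small k u" and g: "g \<in> carrier G" and "e > 0"
    and v: "limitin T (\<lambda>i. p (v i)) g sequentially" and w: "limitin T (\<lambda>i. p (w i)) g sequentially"
  shows "\<exists>N. \<forall>i\<ge>N. \<forall>j\<ge>N. norm (torus_word u (v i) - torus_word u (w j)) < e"
proof -
  obtain A where A: "openin T A" "\<one>\<^bsub>G\<^esub> \<in> A"
    "\<And>v w. inv\<^bsub>G\<^esub> (p v) \<otimes>\<^bsub>G\<^esub> p w \<in> A \<Longrightarrow> norm (torus_word u v - torus_word u w) < e"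
    using torus_word_uniformly_continuous[OF u \<open>e > 0\<close>] by blast
  have "continuous_map (prod_topology T T) T (\<lambda>z. inv\<^bsub>G\<^esub> (fst z) \<otimes>\<^bsub>G\<^esub> snd z)"
    by (intro continuous_mult continuous_inv continuous_map_fst continuous_map_snd)
  from openin_continuous_map_preimage[OF this A(1)]
  have "openin (prod_topology T T) {z \<in> carrier G \<times> carrier G. inv\<^bsub>G\<^esub> (fst z) \<otimes>\<^bsub>G\<^esub> snd z \<in> A}"
    by simp
  moreover have "(g, g) \<in> {z \<in> carrier G \<times> carrier G. inv\<^bsub>G\<^esub> (fst z) \<otimes>\<^bsub>G\<^esub> snd z \<in> A}" using g A by simp
  ultimately obtain B C where BC: "openin T B" "openin T C" "g \<in> B" "g \<in> C"
    "B \<times> C \<subseteq> {z \<in> carrier G \<times> carrier G. inv\<^bsub>G\<^esub> (fst z) \<otimes>\<^bsub>G\<^esub> snd z \<in> A}"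
    unfolding openin_prod_topology_alt by meson
  obtain N where N: "\<And>i. i \<ge> N \<Longrightarrow> p (v i) \<in> B"
    using v BC(1,3) unfolding limitin_sequentially by blast
  obtain N' where N': "\<And>i. i \<ge> N' \<Longrightarrow> p (w i) \<in> C"
    using w BC(2,4) unfolding limitin_sequentially by blast
  have "norm (torus_word u (v i) - torus_word u (w j)) < e" if "i \<ge> max N N'" "j \<ge> max N N'" for i j
  proof (rule A(3))
    have "(p (v i), p (w j)) \<in> B \<times> C" using that N N' by simp
    then show "inv\<^bsub>G\<^esub> (p (v i)) \<otimes>\<^bsub>G\<^esub> p (w j) \<in> A" using BC(5) by auto
  qed
  then show ?thesis by blast
qed

text \<open>A tuple \<open>u\<close> that is small near the unit defines a uniformly continuous homomorphism on the
  dense subgroup of word values, and its continuous extension is a character.\<close>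

lemma torus_extends:
  assumes u: "u \<in> torus" "small k u"
  shows "\<exists>\<omega>\<in>carrier dual. \<forall>n. \<omega> (a n) = u n"
proof -
  have "\<forall>g i. \<exists>w. g \<in> carrier G \<longrightarrow> d g (p w) < 1 / Suc i"
  proof (intro allI)
    fix g and i :: nat
    show "\<exists>w. g \<in> carrier G \<longrightarrow> d g (p w) < 1 / Suc i"
    proof (cases "g \<in> carrier G")
      case True
      then obtain n where "a n \<in> mball g (1 / Suc i)"
        using dense_word[of "mball g (1 / Suc i)" g] by (auto simp: mtop[symmetric])
      then show ?thesis by (intro exI[of _ "[(True, n)]"]) (auto simp: p_single simp del: word_value.simps)
    qed simp
  qed
  then obtain ws where ws: "\<And>g i. g \<in> carrier G \<Longrightarrow> d g (p (ws g i)) < 1 / Suc i" by metis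
  have lim_ws: "limitin T (\<lambda>i. p (ws g i)) g sequentially" if g: "g \<in> carrier G" for g
    unfolding mtop[symmetric] limitin_metric
  proof (intro conjI allI impI g)
    fix e :: real assume "e > 0"
    then obtain N where N: "1 / Suc N < e" using nat_approx_posE[of e] by (metis of_nat_Suc)
    have "p (ws g i) \<in> carrier G \<and> d (p (ws g i)) g < e" if "i \<ge> N" for i
    proof -
      have "d (p (ws g i)) g < 1 / Suc i" using ws[OF g, of i] commute by simp
      also have "\<dots> \<le> 1 / Suc N" using that by (simp add: frac_le)
      finally show ?thesis using N by simp
    qed
    then show "\<forall>\<^sub>F i in sequentially. p (ws g i) \<in> carrier G \<and> d (p (ws g i)) g < e"
      unfolding eventually_sequentially by blast
  qed
  define \<omega> where "\<omega> = (\<lambda>g\<in>carrier G. lim (\<lambda>i. torus_word u (ws g i)))"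
  \<comment> \<open>Freedom in the approximating words is essential: concatenated words approximate
    a product and the constant one-letter word approximates \<open>a n\<close>, which gives
    multiplicativity and the prescribed values.\<close>
  have tends: "(\<lambda>i. torus_word u (v i)) \<longlonglongrightarrow> \<omega> g"
    if g: "g \<in> carrier G" and v: "limitin T (\<lambda>i. p (v i)) g sequentially" for g v
  proof -
    have "Cauchy (\<lambda>i. torus_word u (ws g i))"
      unfolding Cauchy_def dist_norm using torus_word_limits_agree[OF u g _ lim_ws[OF g] lim_ws[OF g]] by simp
    then have "(\<lambda>i. torus_word u (ws g i)) \<longlonglongrightarrow> \<omega> g"
      using g unfolding \<omega>_def by (simp add: Cauchy_convergent_iff convergent_LIMSEQ_iff)
    moreover have "(\<lambda>i. torus_word u (v i) - torus_word u (ws g i)) \<longlonglongrightarrow> 0"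
      unfolding LIMSEQ_iff
    proof (intro allI impI)
      fix r :: real assume "0 < r"
      from torus_word_limits_agree[OF u g this v lim_ws[OF g]]
      show "\<exists>no. \<forall>n\<ge>no. norm (torus_word u (v n) - torus_word u (ws g n) - 0) < r" by auto
    qed
    ultimately have "(\<lambda>i. torus_word u (ws g i) + (torus_word u (v i) - torus_word u (ws g i))) \<longlonglongrightarrow> \<omega> g + 0"
      by (rule tendsto_add)
    then show ?thesis by simp
  qed
  note tends_ws = tends[OF _ lim_ws]
  have "\<omega> \<in> carrier dual"
  proof (rule dualI)
    show "\<omega> \<in> extensional (carrier G)" unfolding \<omega>_def by simp
  next
    fix g assume g: "g \<in> carrier G"
    have "(\<lambda>i. norm (torus_word u (ws g i))) \<longlonglongrightarrow> norm (\<omega> g)"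
      using tends_ws[OF g g] by (rule tendsto_norm)
    then show "norm (\<omega> g) = 1" using norm_torus_word[OF u(1)] by (simp add: LIMSEQ_const_iff)
  next
    fix g h assume g: "g \<in> carrier G" and h: "h \<in> carrier G"
    have "limitin T (\<lambda>i. p (ws g i @ ws h i)) (g \<otimes>\<^bsub>G\<^esub> h) sequentially"
    proof -
      have "limitin (prod_topology T T) (\<lambda>i. (p (ws g i), p (ws h i))) (g, h) sequentially"
        using lim_ws[OF g] lim_ws[OF h] by (simp add: limitin_pairwise comp_def)
      moreover have "continuous_map (prod_topology T T) T (\<lambda>(g, h). g \<otimes>\<^bsub>G\<^esub> h)"
        using top_group unfolding topological_group_def by simp
      ultimately have "limitin T ((\<lambda>(g, h). g \<otimes>\<^bsub>G\<^esub> h) \<circ> (\<lambda>i. (p (ws g i), p (ws h i)))) (g \<otimes>\<^bsub>G\<^esub> h) sequentially"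
        using continuous_map_limit by fastforce
      then show ?thesis by (simp add: p_append comp_def)
    qed
    from tends[OF _ this]
    have "(\<lambda>i. torus_word u (ws g i) * torus_word u (ws h i)) \<longlonglongrightarrow> \<omega> (g \<otimes>\<^bsub>G\<^esub> h)"
      using g h by (simp add: torus_word_append)
    moreover have "(\<lambda>i. torus_word u (ws g i) * torus_word u (ws h i)) \<longlonglongrightarrow> \<omega> g * \<omega> h"
      using tends_ws[OF g g] tends_ws[OF h h] by (rule tendsto_mult)
    ultimately show "\<omega> (g \<otimes>\<^bsub>G\<^esub> h) = \<omega> g * \<omega> h" by (rule LIMSEQ_unique)
  next
    fix e :: real assume "e > 0"
    then obtain N where N: "(2/3)^N < e" using real_arch_pow_inv[of e "2/3"] by auto
    obtain A where A: "openin T A" "\<one>\<^bsub>G\<^esub> \<in> A"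
      "\<And>w. p w \<in> A \<Longrightarrow> norm (torus_word u w - 1) \<le> (2/3) ^ N"
      using equicontinuous[of k N] u(2) by blast
    have "norm (\<omega> g - 1) < e" if g: "g \<in> A" for g
    proof -
      have gG: "g \<in> carrier G" using openin_subset[OF A(1)] g by auto
      obtain M where "\<And>i. i \<ge> M \<Longrightarrow> p (ws g i) \<in> A"
        using lim_ws[OF gG] A(1) g unfolding limitin_sequentially by blast
      then have "\<forall>i\<ge>M. norm (torus_word u (ws g i) - 1) \<le> (2/3)^N" using A(3) by blast
      moreover have "(\<lambda>i. norm (torus_word u (ws g i) - 1)) \<longlonglongrightarrow> norm (\<omega> g - 1)"
        by (intro tendsto_intros tends_ws gG)
      ultimately have "norm (\<omega> g - 1) \<le> (2/3)^N" by (meson Lim_bounded)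
      then show ?thesis using N by simp
    qed
    then show "\<exists>A. openin T A \<and> \<one>\<^bsub>G\<^esub> \<in> A \<and> (\<forall>g\<in>A. norm (\<omega> g - 1) < e)" using A by blast
  qed
  moreover have "\<omega> (a n) = u n" for n
  proof -
    have "limitin T (\<lambda>i. p [(True, n)]) (a n) sequentially"
      unfolding p_single by (simp add: limitin_const_iff a_closed)
    from tends[OF a_closed this] show ?thesis by (simp add: LIMSEQ_const_iff)
  qed
  ultimately show ?thesis by blast
qed

end

section \<open>The dual of a locally compact group\<close>

text \<open>Two characters differ by at most 2, so a word with value outside \<open>U\<close>
  contributes at most \<open>2 * (1/2) ^ to_nat w\<close> to the supremum that defines
  \<open>\<delta>\<close>. Beyond the index \<open>n\<close> such words can be ignored.\<close>

lemma small_tail: "e > 0 \<Longrightarrow> \<exists>n. \<forall>w :: word. n \<le> to_nat w \<longrightarrow> 2 * (1/2::real) ^ to_nat w \<le> e"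
proof -
  assume "e > 0"
  then obtain n where n: "(1/2)^n < e / 2" using real_arch_pow_inv[of "e/2" "1/2"] by auto
  have "2 * (1/2::real) ^ to_nat w \<le> e" if "n \<le> to_nat w" for w :: word
  proof -
    have "(1/2::real) ^ to_nat w \<le> (1/2) ^ n" using that by (intro power_decreasing) auto
    then show ?thesis using n by linarith
  qed
  then show ?thesis by blast
qed

lemma finite_words: "finite {w :: word. to_nat w < n}"
  using finite_vimageI[of "{..<n}" "to_nat :: word \<Rightarrow> nat"] by (simp add: vimage_def lessThan_def)

lemma norm_mult_diff_le:
  fixes a b c d :: complex
  assumes "norm a = 1" "norm d = 1"
  shows "norm (a * b - c * d) \<le> norm (a - c) + norm (b - d)"
proof -
  have "a * b - c * d = (a - c) * d + a * (b - d)" by (simp add: algebra_simps)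
  then show ?thesis using norm_triangle_ineq[of "(a - c) * d" "a * (b - d)"] assms by (simp add: norm_mult)
qed

locale locally_compact_sequence_group = dense_sequence_group +
  fixes r :: real
  assumes r_pos: "r > 0"
    and compact_closure: "compactin T (T closure_of (mball \<one>\<^bsub>G\<^esub> r))"
begin

abbreviation U :: "'a set" where "U \<equiv> mball \<one>\<^bsub>G\<^esub> r"

text \<open>Weight \<open>1\<close> on \<open>U\<close> makes convergence uniform on \<open>U\<close>, hence on its translates, which cover
  every compact set; the other weights only enforce convergence at the individual word values.\<close>

definition weight :: "word \<Rightarrow> real" where
  "weight w = (if p w \<in> U then 1 else (1/2) ^ to_nat w)"

text \<open>The value 0 off the dual makes nonnegativity and symmetry hold for all functions, as
  \<open>Metric_space\<close> demands; there the supremum could be unbounded.\<close>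

definition \<delta> :: "('a \<Rightarrow> complex) \<Rightarrow> ('a \<Rightarrow> complex) \<Rightarrow> real" where
  "\<delta> \<omega> \<eta> = (if \<omega> \<in> carrier dual \<and> \<eta> \<in> carrier dual
     then SUP w. weight w * norm (\<omega> (p w) - \<eta> (p w)) else 0)"

lemma U_open: "openin T U" and one_U: "\<one>\<^bsub>G\<^esub> \<in> U"
  using r_pos by (auto simp: mtop[symmetric])

lemma weight_pos: "weight w > 0" and weight_le_1: "weight w \<le> 1"
  unfolding weight_def by (auto simp: power_le_one)

lemma dual_diff_le_2:
  assumes "\<omega> \<in> carrier dual" "\<eta> \<in> carrier dual" "g \<in> carrier G"
  shows "norm (\<omega> g - \<eta> g) \<le> 2"
  using norm_triangle_ineq4[of "\<omega> g" "\<eta> g"] dualD(2) assms by simp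

lemma weighted_le_2:
  assumes "\<omega> \<in> carrier dual" "\<eta> \<in> carrier dual"
  shows "weight w * norm (\<omega> (p w) - \<eta> (p w)) \<le> 2"
  using mult_mono[OF weight_le_1 dual_diff_le_2[OF assms p_closed[of w]]] by simp

lemma \<delta>_ge:
  assumes "\<omega> \<in> carrier dual" "\<eta> \<in> carrier dual"
  shows "weight w * norm (\<omega> (p w) - \<eta> (p w)) \<le> \<delta> \<omega> \<eta>"
proof -
  have "bdd_above (range (\<lambda>w. weight w * norm (\<omega> (p w) - \<eta> (p w))))"
    using weighted_le_2[OF assms] by (intro bdd_aboveI[of _ 2]) auto
  then have "weight w * norm (\<omega> (p w) - \<eta> (p w)) \<le> (SUP w. weight w * norm (\<omega> (p w) - \<eta> (p w)))"
    by (rule cSUP_upper[OF UNIV_I])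
  then show ?thesis using assms unfolding \<delta>_def by simp
qed

lemma \<delta>_le:
  assumes "\<omega> \<in> carrier dual" "\<eta> \<in> carrier dual"
    and "\<And>w. weight w * norm (\<omega> (p w) - \<eta> (p w)) \<le> c"
  shows "\<delta> \<omega> \<eta> \<le> c"
  using assms unfolding \<delta>_def by (simp add: cSUP_least)

lemma \<delta>_nonneg: "0 \<le> \<delta> \<omega> \<eta>"
proof (cases "\<omega> \<in> carrier dual \<and> \<eta> \<in> carrier dual")
  case True
  have "0 \<le> weight [] * norm (\<omega> (p []) - \<eta> (p []))" using weight_pos[of "[]"] by simp
  then show ?thesis using \<delta>_ge[of \<omega> \<eta> "[]"] True by linarith
qed (auto simp: \<delta>_def)

lemma \<delta>_metric: "Metric_space (carrier dual) \<delta>"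
proof
  fix \<omega> \<eta> show "0 \<le> \<delta> \<omega> \<eta>" by (rule \<delta>_nonneg)
  show "\<delta> \<omega> \<eta> = \<delta> \<eta> \<omega>" unfolding \<delta>_def by (auto simp: norm_minus_commute)
next
  fix \<omega> \<eta> assume *: "\<omega> \<in> carrier dual" "\<eta> \<in> carrier dual"
  show "\<delta> \<omega> \<eta> = 0 \<longleftrightarrow> \<omega> = \<eta>"
  proof
    assume "\<delta> \<omega> \<eta> = 0"
    then have "weight w * norm (\<omega> (p w) - \<eta> (p w)) \<le> 0" for w using \<delta>_ge[OF *, of w] by simp
    then have "\<omega> (p w) = \<eta> (p w)" for w
      using weight_pos[of w] by (metis mult_le_0_iff norm_le_zero_iff not_less right_minus_eq)
    from this[of "[(True, _)]", unfolded p_single] show "\<omega> = \<eta>" by (rule dual_eqI[OF *])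
  next
    assume "\<omega> = \<eta>"
    then show "\<delta> \<omega> \<eta> = 0" using \<delta>_le[OF *, of 0] \<delta>_nonneg[of \<omega> \<eta>] by simp
  qed
next
  fix \<omega> \<eta> \<zeta> assume *: "\<omega> \<in> carrier dual" "\<eta> \<in> carrier dual" "\<zeta> \<in> carrier dual"
  show "\<delta> \<omega> \<zeta> \<le> \<delta> \<omega> \<eta> + \<delta> \<eta> \<zeta>"
  proof (rule \<delta>_le[OF *(1,3)])
    fix w
    have "weight w * norm (\<omega> (p w) - \<zeta> (p w)) \<le>
        weight w * (norm (\<omega> (p w) - \<eta> (p w)) + norm (\<eta> (p w) - \<zeta> (p w)))"
      using weight_pos[of w] norm_triangle_ineq[of "\<omega> (p w) - \<eta> (p w)" "\<eta> (p w) - \<zeta> (p w)"]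
      by (intro mult_left_mono) auto
    then show "weight w * norm (\<omega> (p w) - \<zeta> (p w)) \<le> \<delta> \<omega> \<eta> + \<delta> \<eta> \<zeta>"
      using \<delta>_ge[OF *(1,2), of w] \<delta>_ge[OF *(2,3), of w] by (simp add: distrib_left)
  qed
qed

sublocale dm: Metric_space "carrier dual" \<delta> by (rule \<delta>_metric)

text \<open>If the bound failed at \<open>g\<close>, it would fail on an open subset of
  \<open>U\<close>. That subset contains some \<open>a n\<close>, and the one-letter word for
  \<open>a n\<close> has weight 1.\<close>

lemma dual_diff_on_U:
  assumes "\<omega> \<in> carrier dual" "\<eta> \<in> carrier dual" "g \<in> U"
  shows "norm (\<omega> g - \<eta> g) \<le> \<delta> \<omega> \<eta>"
proof (rule ccontr)
  assume neg: "\<not> norm (\<omega> g - \<eta> g) \<le> \<delta> \<omega> \<eta>"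
  have "continuous_map T euclideanreal (\<lambda>g. norm (\<omega> g - \<eta> g))"
    using assms dualD(4) by (intro continuous_map_norm continuous_map_diff) auto
  then have "openin T {h \<in> topspace T. norm (\<omega> h - \<eta> h) \<in> {\<delta> \<omega> \<eta> <..}}"
    by (rule openin_continuous_map_preimage) auto
  with U_open have "openin T (U \<inter> {h \<in> topspace T. norm (\<omega> h - \<eta> h) \<in> {\<delta> \<omega> \<eta> <..}})"
    by (rule openin_Int)
  moreover have "g \<in> U \<inter> {h \<in> topspace T. norm (\<omega> h - \<eta> h) \<in> {\<delta> \<omega> \<eta> <..}}" using assms neg by simp
  ultimately obtain n where n: "a n \<in> U \<inter> {h \<in> topspace T. norm (\<omega> h - \<eta> h) \<in> {\<delta> \<omega> \<eta> <..}}"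
    by (metis dense_word)
  then have "weight [(True, n)] = 1" unfolding weight_def p_single by simp
  then show False using \<delta>_ge[OF assms(1,2), of "[(True, n)]"] n unfolding p_single by simp
qed

lemma compact_translates:
  assumes "compactin T K" "openin T A" "\<one>\<^bsub>G\<^esub> \<in> A"
  shows "\<exists>F. finite F \<and> (\<forall>g\<in>K. \<exists>n\<in>F. inv\<^bsub>G\<^esub> (a n) \<otimes>\<^bsub>G\<^esub> g \<in> A)"
proof -
  define V where "V n = {h \<in> carrier G. inv\<^bsub>G\<^esub> (a n) \<otimes>\<^bsub>G\<^esub> h \<in> A}" for n
  have "K \<subseteq> \<Union>(range V)"
  proof
    fix g assume "g \<in> K"
    then have "g \<in> carrier G" using compactin_subset_topspace[OF assms(1)] by auto
    then show "g \<in> \<Union>(range V)" using translates_cover[OF assms(2,3)] unfolding V_def by blast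
  qed
  moreover have "\<forall>V\<in>range V. openin T V" unfolding V_def using openin_translate[OF assms(2) a_closed] by blast
  ultimately obtain \<F> where \<F>: "finite \<F>" "\<F> \<subseteq> range V" "K \<subseteq> \<Union>\<F>"
    using assms(1) unfolding compactin_def by meson
  obtain F where F: "finite F" "\<F> = V ` F" using finite_subset_image[OF \<F>(1,2)] by auto
  then show ?thesis using \<F>(3) unfolding V_def by (intro exI[of _ F]) fast
qed

text \<open>Finitely many translates of \<open>U\<close> cover \<open>K\<close>, so
  \<open>g = a n \<otimes> h\<close> with \<open>h\<close> in \<open>U\<close> and \<open>n\<close>
  in a finite set. The factor \<open>h\<close> costs \<open>\<delta>\<close> itself and the factor
  \<open>a n\<close> costs \<open>\<delta>\<close> divided by the weight of its one-letter word;
  \<open>C\<close> dominates these finitely many costs.\<close>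

lemma dual_diff_on_compact:
  assumes "compactin T K"
  shows "\<exists>C>0. \<forall>\<omega>\<in>carrier dual. \<forall>\<eta>\<in>carrier dual. \<forall>g\<in>K. norm (\<omega> g - \<eta> g) \<le> C * \<delta> \<omega> \<eta>"
proof -
  obtain F where F: "finite F" "\<And>g. g \<in> K \<Longrightarrow> \<exists>n\<in>F. inv\<^bsub>G\<^esub> (a n) \<otimes>\<^bsub>G\<^esub> g \<in> U"
    using compact_translates[OF assms U_open one_U] by auto
  define C where "C = (\<Sum>n\<in>F. 1 / weight [(True, n)]) + 1"
  have C: "1 / weight [(True, n)] + 1 \<le> C" if "n \<in> F" for n
    unfolding C_def using that F(1) weight_pos by (auto intro!: member_le_sum simp: less_imp_le)
  have "C > 0" unfolding C_def using weight_pos by (intro add_nonneg_pos sum_nonneg) (auto simp: less_imp_le)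
  moreover have "norm (\<omega> g - \<eta> g) \<le> C * \<delta> \<omega> \<eta>"
    if \<omega>: "\<omega> \<in> carrier dual" and \<eta>: "\<eta> \<in> carrier dual" and g: "g \<in> K" for \<omega> \<eta> g
  proof -
    have gG: "g \<in> carrier G" using compactin_subset_topspace[OF assms] g by auto
    obtain n where n: "n \<in> F" "inv\<^bsub>G\<^esub> (a n) \<otimes>\<^bsub>G\<^esub> g \<in> U" using F(2)[OF g] by auto
    define h where "h = inv\<^bsub>G\<^esub> (a n) \<otimes>\<^bsub>G\<^esub> g"
    have hG: "h \<in> carrier G" and gh: "g = a n \<otimes>\<^bsub>G\<^esub> h"
      using gG a_closed unfolding h_def by (auto simp: m_assoc[symmetric])
    have "norm (\<omega> g - \<eta> g) \<le> norm (\<omega> (a n) - \<eta> (a n)) + norm (\<omega> h - \<eta> h)"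
      unfolding gh dualD(3)[OF \<omega> a_closed hG] dualD(3)[OF \<eta> a_closed hG]
      by (intro norm_mult_diff_le dualD(2) \<omega> \<eta> a_closed hG)
    also have "norm (\<omega> h - \<eta> h) \<le> \<delta> \<omega> \<eta>" using dual_diff_on_U[OF \<omega> \<eta>] n(2) unfolding h_def .
    also have "norm (\<omega> (a n) - \<eta> (a n)) \<le> 1 / weight [(True, n)] * \<delta> \<omega> \<eta>"
      using \<delta>_ge[OF \<omega> \<eta>, of "[(True, n)]"] weight_pos[of "[(True, n)]"]
      unfolding p_single by (simp add: field_simps)
    finally have "norm (\<omega> g - \<eta> g) \<le> (1 / weight [(True, n)] + 1) * \<delta> \<omega> \<eta>" by (simp add: distrib_right)
    also have "\<dots> \<le> C * \<delta> \<omega> \<eta>" using C[OF n(1)] \<delta>_nonneg by (rule mult_right_mono)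
    finally show ?thesis .
  qed
  ultimately show ?thesis by blast
qed

text \<open>Singletons are compact, so a Cauchy sequence converges at each point. Uniform control on
  the fixed open set \<open>U\<close> carries continuity at the unit over to the limit by an
  \<open>e / 3\<close> argument, and the metric bounds pass to the limit word by word.\<close>

lemma \<delta>_complete: "dm.mcomplete"
  unfolding dm.mcomplete_def
proof (intro allI impI)
  fix \<sigma> assume \<sigma>: "dm.MCauchy \<sigma>"
  then have \<sigma>d: "\<sigma> i \<in> carrier dual" for i unfolding dm.MCauchy_def by auto
  have Cau: "\<exists>N. \<forall>i\<ge>N. \<forall>j\<ge>N. \<delta> (\<sigma> i) (\<sigma> j) < e" if "e > 0" for e
    using \<sigma>[unfolded dm.MCauchy_def, THEN conjunct2, rule_format, OF that] by auto
  define \<omega> where "\<omega> = (\<lambda>g\<in>carrier G. lim (\<lambda>i. \<sigma> i g))"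
  have lim: "(\<lambda>i. \<sigma> i g) \<longlonglongrightarrow> \<omega> g" if g: "g \<in> carrier G" for g
  proof -
    have "compactin T {g}" using g by simp
    from dual_diff_on_compact[OF this] obtain C where C: "C > 0"
      "\<forall>\<omega>\<in>carrier dual. \<forall>\<eta>\<in>carrier dual. \<forall>g\<in>{g}. norm (\<omega> g - \<eta> g) \<le> C * \<delta> \<omega> \<eta>"
      by (elim exE conjE)
    have "Cauchy (\<lambda>i. \<sigma> i g)"
    proof (rule metric_CauchyI)
      fix e :: real assume "e > 0"
      then obtain N where N: "\<And>i j. i \<ge> N \<Longrightarrow> j \<ge> N \<Longrightarrow> \<delta> (\<sigma> i) (\<sigma> j) < e / C"
        using Cau[of "e / C"] C(1) by auto
      have "dist (\<sigma> i g) (\<sigma> j g) < e" if "i \<ge> N" "j \<ge> N" for i j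
      proof -
        have "dist (\<sigma> i g) (\<sigma> j g) \<le> C * \<delta> (\<sigma> i) (\<sigma> j)" using C(2) \<sigma>d by (simp add: dist_norm)
        also have "\<dots> < C * (e / C)" using N[OF that] C(1) by (rule mult_strict_left_mono)
        finally show ?thesis using C(1) by simp
      qed
      then show "\<exists>M. \<forall>m\<ge>M. \<forall>n\<ge>M. dist (\<sigma> m g) (\<sigma> n g) < e" by blast
    qed
    then show ?thesis using g unfolding \<omega>_def by (simp add: Cauchy_convergent_iff convergent_LIMSEQ_iff)
  qed
  have \<omega>: "\<omega> \<in> carrier dual"
  proof (rule dualI)
    show "\<omega> \<in> extensional (carrier G)" unfolding \<omega>_def by simp
  next
    fix g assume g: "g \<in> carrier G"
    have "(\<lambda>i. norm (\<sigma> i g)) \<longlonglongrightarrow> norm (\<omega> g)" using lim[OF g] by (rule tendsto_norm)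
    then show "norm (\<omega> g) = 1" using dualD(2)[OF \<sigma>d g] by (simp add: LIMSEQ_const_iff)
  next
    fix g h assume g: "g \<in> carrier G" and h: "h \<in> carrier G"
    have "(\<lambda>i. \<sigma> i g * \<sigma> i h) \<longlonglongrightarrow> \<omega> (g \<otimes>\<^bsub>G\<^esub> h)"
      using lim[OF m_closed[OF g h]] dualD(3)[OF \<sigma>d g h] by simp
    moreover have "(\<lambda>i. \<sigma> i g * \<sigma> i h) \<longlonglongrightarrow> \<omega> g * \<omega> h" by (intro tendsto_mult lim g h)
    ultimately show "\<omega> (g \<otimes>\<^bsub>G\<^esub> h) = \<omega> g * \<omega> h" by (rule LIMSEQ_unique)
  next
    fix e :: real assume e: "e > 0"
    then obtain N where N: "\<And>i j. i \<ge> N \<Longrightarrow> j \<ge> N \<Longrightarrow> \<delta> (\<sigma> i) (\<sigma> j) < e / 3"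
      using Cau[of "e / 3"] by auto
    obtain A where A: "openin T A" "\<one>\<^bsub>G\<^esub> \<in> A" "\<And>g. g \<in> A \<Longrightarrow> norm (\<sigma> N g - 1) < e / 3"
      using dual_near_one[OF \<sigma>d, of "e/3" N] e by auto
    have "norm (\<omega> g - 1) < e" if g: "g \<in> A \<inter> U" for g
    proof -
      have gG: "g \<in> carrier G" using g by auto
      have "norm (\<sigma> i g - \<sigma> N g) \<le> e / 3" if "i \<ge> N" for i
        using dual_diff_on_U[OF \<sigma>d \<sigma>d, of g i N] N[OF that order_refl] g by simp
      moreover have "(\<lambda>i. norm (\<sigma> i g - \<sigma> N g)) \<longlonglongrightarrow> norm (\<omega> g - \<sigma> N g)"
        by (intro tendsto_intros lim gG)
      ultimately have "norm (\<omega> g - \<sigma> N g) \<le> e / 3" by (meson Lim_bounded)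
      moreover have "norm (\<omega> g - 1) \<le> norm (\<omega> g - \<sigma> N g) + norm (\<sigma> N g - 1)"
        using norm_triangle_ineq[of "\<omega> g - \<sigma> N g" "\<sigma> N g - 1"] by simp
      ultimately show ?thesis using A(3)[of g] g e by simp
    qed
    then show "\<exists>A. openin T A \<and> \<one>\<^bsub>G\<^esub> \<in> A \<and> (\<forall>g\<in>A. norm (\<omega> g - 1) < e)"
      using A U_open one_U by (intro exI[of _ "A \<inter> U"]) auto
  qed
  have "limitin dm.mtopology \<sigma> \<omega> sequentially"
    unfolding dm.limitin_metric eventually_sequentially
  proof (intro conjI allI impI \<omega>)
    fix e :: real assume e: "e > 0"
    then obtain N where N: "\<And>i j. i \<ge> N \<Longrightarrow> j \<ge> N \<Longrightarrow> \<delta> (\<sigma> i) (\<sigma> j) < e / 2"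
      using Cau[of "e / 2"] by auto
    have "\<delta> (\<sigma> i) \<omega> < e" if i: "i \<ge> N" for i
    proof -
      have "\<delta> (\<sigma> i) \<omega> \<le> e / 2"
      proof (rule \<delta>_le[OF \<sigma>d \<omega>])
        fix w
        have "weight w * norm (\<sigma> i (p w) - \<sigma> j (p w)) \<le> e / 2" if "j \<ge> N" for j
          using \<delta>_ge[OF \<sigma>d \<sigma>d, of w i j] N[OF i that] by simp
        moreover have "(\<lambda>j. weight w * norm (\<sigma> i (p w) - \<sigma> j (p w))) \<longlonglongrightarrow> weight w * norm (\<sigma> i (p w) - \<omega> (p w))"
          by (intro tendsto_intros lim p_closed)
        ultimately show "weight w * norm (\<sigma> i (p w) - \<omega> (p w)) \<le> e / 2" by (meson Lim_bounded)
      qed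
      then show ?thesis using e by simp
    qed
    then show "\<exists>N. \<forall>n\<ge>N. \<sigma> n \<in> carrier dual \<and> \<delta> (\<sigma> n) \<omega> < e" using \<sigma>d by blast
  qed
  then show "\<exists>x. limitin dm.mtopology \<sigma> x sequentially" by (intro exI[of _ \<omega>])
qed

section \<open>Comparison of the metric with the compact-open topology\<close>

abbreviation dual_top :: "('a \<Rightarrow> complex) topology" where
  "dual_top \<equiv> Pontryagin_dual_topology G T"

lemma topspace_dual: "topspace dual_top = carrier dual"
  by (rule topspace_Pontryagin_dual_topology) simp

text \<open>The circle is covered by finitely many balls of radius \<open>e / 3\<close>, and
  \<open>L c\<close> is the part of \<open>K\<close> that \<open>\<omega>\<close> sends into the
  closed ball around \<open>c\<close>. Requiring \<open>\<eta>\<close> to send each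
  \<open>L c\<close> into the ball of radius \<open>e / 2\<close> is a finite intersection of
  subbasic conditions and keeps \<open>\<eta>\<close> within \<open>e / 3 + e / 2 < e\<close> of
  \<open>\<omega>\<close> on \<open>K\<close>.\<close>

lemma uniform_nbhd_dual:
  assumes K: "compactin T K" and \<omega>: "\<omega> \<in> carrier dual" and e: "e > 0"
  shows "\<exists>N. openin dual_top N \<and> \<omega> \<in> N \<and> (\<forall>\<eta>\<in>N. \<eta> \<in> carrier dual \<and> (\<forall>g\<in>K. norm (\<omega> g - \<eta> g) < e))"
proof -
  obtain F where F: "finite F" "F \<subseteq> sphere (0::complex) 1" "sphere 0 1 \<subseteq> (\<Union>c\<in>F. ball c (e/3))"
    using compactE_image[OF compact_sphere[of "0::complex" 1], of "sphere 0 1" "\<lambda>c. ball c (e/3)"] e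
    by (smt (verit, ccfv_threshold) UN_I centre_in_ball divide_pos_pos open_ball subsetI)
  \<comment> \<open>This yields that \<open>F\<close> is nonempty; an intersection over an empty
    index set would be the whole type, which is not an open set of this topology.\<close>
  have "1 \<in> sphere (0::complex) 1" by simp
  then have "F \<noteq> {}" using F(3) by blast
  define L where "L c = {g \<in> topspace T. \<omega> g \<in> cball c (e/3)} \<inter> K" for c
  have L: "compactin T (L c)" for c unfolding L_def
    using dualD(4)[OF \<omega>] by (intro closed_Int_compactin K closedin_continuous_map_preimage) auto
  define N where "N c = {f \<in> extensional (topspace T). continuous_map T circle_topology f \<and>
      f ` L c \<subseteq> sphere 0 1 \<inter> ball c (e/2)}" for c
  have N: "openin (compact_open_topology T circle_topology) (N c)" for c
    unfolding compact_open_topology_def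
  proof (rule topology_generated_by_Basis)
    have "openin circle_topology (sphere 0 1 \<inter> ball c (e/2))" by (simp add: openin_open_Int)
    then show "N c \<in> {{f \<in> extensional (topspace T). continuous_map T circle_topology f \<and> f ` K \<subseteq> U} | K U.
        compactin T K \<and> openin circle_topology U}"
      unfolding N_def using L[of c] by (intro CollectI exI[of _ "L c"] exI[of _ "sphere 0 1 \<inter> ball c (e/2)"]) simp
  qed
  have "openin (compact_open_topology T circle_topology) (\<Inter>c\<in>F. N c)"
    using F(1) \<open>F \<noteq> {}\<close> N by (intro openin_INT2) auto
  then have "openin dual_top ((\<Inter>c\<in>F. N c) \<inter> carrier dual)"
    unfolding Pontryagin_dual_topology_def by (rule openin_subtopology_Int)
  moreover have "\<omega> \<in> N c" for c
  proof -
    have "\<omega> g \<in> sphere 0 1 \<inter> ball c (e/2)" if "g \<in> L c" for g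
      using that dualD(2)[OF \<omega>] e unfolding L_def by auto
    then show ?thesis using \<omega> unfolding N_def carrier_Pontryagin_dual by auto
  qed
  moreover have "norm (\<omega> g - \<eta> g) < e" if \<eta>: "\<eta> \<in> (\<Inter>c\<in>F. N c)" and g: "g \<in> K" for \<eta> g
  proof -
    have gG: "g \<in> topspace T" using compactin_subset_topspace[OF K] g by auto
    then have "\<omega> g \<in> sphere 0 1" using dualD(2)[OF \<omega>] by simp
    then obtain c where c: "c \<in> F" "\<omega> g \<in> ball c (e/3)" using F(3) by auto
    then have "g \<in> L c" using gG g unfolding L_def by auto
    moreover have "\<eta> ` L c \<subseteq> ball c (e/2)" using \<eta> c(1) unfolding N_def by auto
    ultimately have "dist c (\<eta> g) < e/2" by auto
    then show ?thesis using c(2) dist_triangle3[of "\<omega> g" "\<eta> g" c] e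
      unfolding mem_ball dist_norm by linarith
  qed
  ultimately show ?thesis using \<omega> by (intro exI[of _ "(\<Inter>c\<in>F. N c) \<inter> carrier dual"]) auto
qed

text \<open>It is enough to control the words with value in \<open>U\<close> and finitely many others.\<close>

lemma \<delta>_lessI:
  assumes "\<omega> \<in> carrier dual" "\<eta> \<in> carrier dual" "e > 0"
    and n: "\<forall>w :: word. n \<le> to_nat w \<longrightarrow> 2 * (1/2::real) ^ to_nat w \<le> e / 2"
    and "\<And>w. p w \<in> U \<or> to_nat w < n \<Longrightarrow> norm (\<omega> (p w) - \<eta> (p w)) \<le> e / 2"
  shows "\<delta> \<omega> \<eta> < e"
proof -
  have "\<delta> \<omega> \<eta> \<le> e / 2"
  proof (rule \<delta>_le[OF assms(1,2)])
    fix w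
    show "weight w * norm (\<omega> (p w) - \<eta> (p w)) \<le> e / 2"
    proof (cases "p w \<in> U \<or> to_nat w < n")
      case True
      have "weight w * norm (\<omega> (p w) - \<eta> (p w)) \<le> 1 * (e / 2)"
        using assms(5)[OF True] weight_le_1[of w] weight_pos[of w] by (intro mult_mono) auto
      then show ?thesis by simp
    next
      case False
      have "weight w * norm (\<omega> (p w) - \<eta> (p w)) \<le> (1/2) ^ to_nat w * 2"
        using False dual_diff_le_2[OF assms(1,2) p_closed[of w]] unfolding weight_def
        by (intro mult_mono) auto
      moreover have "2 * (1/2::real) ^ to_nat w \<le> e / 2" using n False by simp
      ultimately show ?thesis by linarith
    qed
  qed
  then show ?thesis using assms(3) by simp
qed

text \<open>Subbasic sets are open for the metric because on a compact \<open>K\<close> differences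
  are at most a constant times \<open>\<delta>\<close>, and a compact image inside an open set has a
  uniform margin. Conversely a metric ball only requires control on the closure of \<open>U\<close>
  and at finitely many word values, which together form a compact set.\<close>

lemma mtopology_dual: "dm.mtopology = dual_top"
  unfolding topology_eq
proof (intro allI iffI)
  let ?B = "{{f \<in> extensional (topspace T). continuous_map T circle_topology f \<and> f ` K \<subseteq> U} | K U.
        compactin T K \<and> openin circle_topology U}"
  fix S assume S: "openin dual_top S"
  have "continuous_map dm.mtopology (compact_open_topology T circle_topology) id"
    unfolding compact_open_topology_def continuous_on_generated_topo_iff
  proof (intro conjI allI impI)
    fix W assume "W \<in> ?B"
    then obtain K V where KV: "compactin T K" "openin circle_topology V"
      and W: "W = {f \<in> extensional (topspace T). continuous_map T circle_topology f \<and> f ` K \<subseteq> V}" by auto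
    obtain V' where V': "open V'" "V = sphere 0 1 \<inter> V'" using KV(2) by (auto simp: openin_open)
    from dual_diff_on_compact[OF KV(1)] obtain C where C: "C > 0"
      "\<forall>\<omega>\<in>carrier dual. \<forall>\<eta>\<in>carrier dual. \<forall>g\<in>K. norm (\<omega> g - \<eta> g) \<le> C * \<delta> \<omega> \<eta>"
      by (elim exE conjE)
    show "openin dm.mtopology (id -` W \<inter> topspace dm.mtopology)"
      unfolding dm.openin_mtopology
    proof (intro conjI ballI allI impI)
      fix \<omega> assume "\<omega> \<in> id -` W \<inter> topspace dm.mtopology"
      then have \<omega>: "\<omega> \<in> carrier dual" "\<omega> ` K \<subseteq> V'" unfolding W V' by auto
      have "compact (\<omega> ` K)" using image_compactin[OF KV(1) dualD(4)[OF \<omega>(1)]] by simp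
      then obtain e where e: "e > 0" "(\<Union>x\<in>\<omega> ` K. ball x e) \<subseteq> V'"
        using compact_subset_open_imp_ball_epsilon_subset[OF _ V'(1) \<omega>(2)] by auto
      have "\<eta> \<in> id -` W \<inter> topspace dm.mtopology" if \<eta>: "\<eta> \<in> dm.mball \<omega> (e / C)" for \<eta>
      proof -
        have \<eta>d: "\<eta> \<in> carrier dual" "\<delta> \<omega> \<eta> < e / C" using \<eta> by auto
        have "\<eta> g \<in> V" if g: "g \<in> K" for g
        proof -
          have "norm (\<omega> g - \<eta> g) \<le> C * \<delta> \<omega> \<eta>" using C(2) \<omega>(1) \<eta>d(1) g by simp
          also have "\<dots> < e" using \<eta>d(2) C(1) by (simp add: field_simps)
          finally have "\<eta> g \<in> ball (\<omega> g) e" by (simp add: dist_norm)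
          moreover have "ball (\<omega> g) e \<subseteq> V'" using e(2) g by auto
          ultimately have "\<eta> g \<in> V'" by auto
          moreover have "g \<in> carrier G" using compactin_subset_topspace[OF KV(1)] g by auto
          ultimately show ?thesis using dualD(2)[OF \<eta>d(1)] unfolding V' by simp
        qed
        then have "\<eta> ` K \<subseteq> V" by auto
        moreover have "\<eta> \<in> extensional (topspace T)" "continuous_map T circle_topology \<eta>"
          using \<eta>d(1) unfolding carrier_Pontryagin_dual by auto
        ultimately have "\<eta> \<in> W" unfolding W by simp
        then show ?thesis using \<eta>d(1) by simp
      qed
      then show "\<exists>r>0. dm.mball \<omega> r \<subseteq> id -` W \<inter> topspace dm.mtopology"
        using e(1) C(1) by (intro exI[of _ "e / C"]) auto
    qed auto
  next
    \<comment> \<open>The empty compact set gives a subbasic set that contains every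
      character.\<close>
    have "\<omega> \<in> \<Union>?B" if "\<omega> \<in> carrier dual" for \<omega>
      using that unfolding carrier_Pontryagin_dual
      by (intro UnionI[of "{f \<in> extensional (topspace T). continuous_map T circle_topology f \<and> f ` {} \<subseteq> {}}"]
          CollectI exI[of _ "{}"]) auto
    then show "id ` topspace dm.mtopology \<subseteq> \<Union>?B" by auto
  qed
  then have "continuous_map dm.mtopology dual_top id"
    unfolding Pontryagin_dual_topology_def continuous_map_in_subtopology by simp
  from openin_continuous_map_preimage[OF this S]
  have "openin dm.mtopology {\<omega> \<in> carrier dual. \<omega> \<in> S}" by simp
  moreover have "{\<omega> \<in> carrier dual. \<omega> \<in> S} = S" using openin_subset[OF S] topspace_dual by auto
  ultimately show "openin dm.mtopology S" by simp
next
  fix S assume S: "openin dm.mtopology S"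
  show "openin dual_top S"
  proof (subst openin_subopen, intro ballI)
    fix \<omega> assume "\<omega> \<in> S"
    then have \<omega>: "\<omega> \<in> carrier dual" using openin_subset[OF S] by auto
    obtain e where e: "e > 0" "dm.mball \<omega> e \<subseteq> S" using S \<open>\<omega> \<in> S\<close> unfolding dm.openin_mtopology by auto
    obtain n where n: "\<forall>w :: word. n \<le> to_nat w \<longrightarrow> 2 * (1/2::real) ^ to_nat w \<le> e / 2"
      using small_tail[of "e / 2"] e(1) by auto
    define K where "K = T closure_of U \<union> p ` {w. to_nat w < n}"
    have "compactin T K" unfolding K_def
      using finite_words by (intro compactin_Un compact_closure finite_imp_compactin) auto
    then obtain N where N: "openin dual_top N" "\<omega> \<in> N"
      "\<And>\<eta>. \<eta> \<in> N \<Longrightarrow> \<eta> \<in> carrier dual" "\<And>\<eta> g. \<eta> \<in> N \<Longrightarrow> g \<in> K \<Longrightarrow> norm (\<omega> g - \<eta> g) < e / 2"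
      using uniform_nbhd_dual[OF _ \<omega>, of K "e / 2"] e(1) by auto
    have "\<eta> \<in> dm.mball \<omega> e" if \<eta>: "\<eta> \<in> N" for \<eta>
    proof -
      have "U \<subseteq> T closure_of U" by (rule closure_of_subset) auto
      then have "p w \<in> K" if "p w \<in> U \<or> to_nat w < n" for w using that unfolding K_def by auto
      then have "norm (\<omega> (p w) - \<eta> (p w)) \<le> e / 2" if "p w \<in> U \<or> to_nat w < n" for w
        using N(4)[OF \<eta>, of "p w"] that by (simp add: less_imp_le)
      then have "\<delta> \<omega> \<eta> < e" by (rule \<delta>_lessI[OF \<omega> N(3)[OF \<eta>] e(1) n])
      then show ?thesis using \<omega> N(3)[OF \<eta>] by simp
    qed
    then show "\<exists>N. openin dual_top N \<and> \<omega> \<in> N \<and> N \<subseteq> S" using N(1,2) e(2) by blast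
  qed
qed

text \<open>Equicontinuity of the layer \<open>k\<close> turns control at finitely many words into
  control on all of \<open>U\<close>: a word value in \<open>U\<close> is \<open>a m\<close> times
  an element of the neighbourhood \<open>A\<close>, with \<open>m\<close> from the finite set
  \<open>F\<close>. The budget is \<open>e / 4\<close> for \<open>a m\<close> and twice
  \<open>e / 8\<close> for the other factor, together \<open>e / 2\<close>.\<close>

lemma small_approximation:
  assumes \<omega>: "\<omega> \<in> carrier dual" "small k (\<lambda>n. \<omega> (a n))" and e: "e > 0"
  shows "\<exists>W. open W \<and> (\<lambda>n. \<omega> (a n)) \<in> W \<and>
    (\<forall>\<eta>\<in>carrier dual. small k (\<lambda>n. \<eta> (a n)) \<longrightarrow> (\<lambda>n. \<eta> (a n)) \<in> W \<longrightarrow> \<delta> \<omega> \<eta> < e)"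
proof -
  obtain N where N: "(2/3)^N < e / 8" using real_arch_pow_inv[of "e/8" "2/3"] e by auto
  obtain A where A: "openin T A" "\<one>\<^bsub>G\<^esub> \<in> A"
    "\<And>u w. small k u \<Longrightarrow> p w \<in> A \<Longrightarrow> norm (torus_word u w - 1) \<le> (2/3) ^ N"
    using equicontinuous[of k N] by auto
  obtain F where F: "finite F" "\<And>g. g \<in> T closure_of U \<Longrightarrow> \<exists>n\<in>F. inv\<^bsub>G\<^esub> (a n) \<otimes>\<^bsub>G\<^esub> g \<in> A"
    using compact_translates[OF compact_closure A(1,2)] by auto
  obtain n where n: "\<forall>w :: word. n \<le> to_nat w \<longrightarrow> 2 * (1/2::real) ^ to_nat w \<le> e / 2"
    using small_tail[of "e / 2"] e by auto
  define I where "I = (\<lambda>n. [(True, n)]) ` F \<union> {w. to_nat w < n}"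
  define W where "W = (\<Inter>w\<in>I. {u. norm (\<omega> (p w) - torus_word u w) < e / 4})"
  have "open {u. norm (\<omega> (p w) - torus_word u w) < e / 4}" for w
    by (intro open_Collect_less continuous_intros continuous_on_torus_word)
  moreover have "finite I" unfolding I_def using F(1) finite_words by auto
  ultimately have "open W" unfolding W_def by (intro open_INT) auto
  moreover have "(\<lambda>n. \<omega> (a n)) \<in> W" unfolding W_def using e by (simp add: dual_word[OF \<omega>(1)])
  moreover have "\<delta> \<omega> \<eta> < e"
    if \<eta>: "\<eta> \<in> carrier dual" "small k (\<lambda>n. \<eta> (a n))" "(\<lambda>n. \<eta> (a n)) \<in> W" for \<eta>
  proof -
    have I: "norm (\<omega> (p w) - \<eta> (p w)) < e / 4" if "w \<in> I" for w
      using \<eta>(3) that unfolding W_def dual_word[OF \<eta>(1)] by simp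
    show ?thesis
    proof (rule \<delta>_lessI[OF \<omega>(1) \<eta>(1) e n])
      fix w assume w: "p w \<in> U \<or> to_nat w < n"
      show "norm (\<omega> (p w) - \<eta> (p w)) \<le> e / 2"
      proof (cases "to_nat w < n")
        case True
        then show ?thesis using I[of w] e unfolding I_def by simp
      next
        case False
        moreover have "U \<subseteq> T closure_of U" by (rule closure_of_subset) auto
        ultimately have "p w \<in> T closure_of U" using w by auto
        then obtain m where m: "m \<in> F" "inv\<^bsub>G\<^esub> (a m) \<otimes>\<^bsub>G\<^esub> p w \<in> A" using F(2) by auto
        define v where "v = inverse_word [(True, m)] @ w"
        have v: "p v = inv\<^bsub>G\<^esub> (a m) \<otimes>\<^bsub>G\<^esub> p w" unfolding v_def p_append p_inverse p_single ..
        have pw: "p w = a m \<otimes>\<^bsub>G\<^esub> p v" unfolding v using a_closed by (simp add: m_assoc[symmetric])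
        have 1: "norm (\<omega> (p v) - 1) \<le> (2/3)^N" "norm (\<eta> (p v) - 1) \<le> (2/3)^N"
          using A(3)[OF \<omega>(2), of v] A(3)[OF \<eta>(2), of v] m(2)
          unfolding v dual_word[OF \<omega>(1), symmetric] dual_word[OF \<eta>(1), symmetric] by auto
        have "norm (\<omega> (p w) - \<eta> (p w)) \<le> norm (\<omega> (a m) - \<eta> (a m)) + norm (\<omega> (p v) - \<eta> (p v))"
          unfolding pw dualD(3)[OF \<omega>(1) a_closed p_closed] dualD(3)[OF \<eta>(1) a_closed p_closed]
          by (intro norm_mult_diff_le dualD(2) \<omega> \<eta> a_closed p_closed)
        also have "norm (\<omega> (p v) - \<eta> (p v)) \<le> norm (\<omega> (p v) - 1) + norm (\<eta> (p v) - 1)"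
          using norm_triangle_ineq4[of "\<omega> (p v) - 1" "\<eta> (p v) - 1"] by simp
        also have "norm (\<omega> (a m) - \<eta> (a m)) < e / 4" using I[of "[(True, m)]"] m(1) unfolding I_def p_single by simp
        finally show ?thesis using 1 N by simp
      qed
    qed
  qed
  ultimately show ?thesis by blast
qed

section \<open>The dual as a topological group\<close>

lemma mult_dual_closed:
  assumes "\<omega> \<in> carrier dual" "\<eta> \<in> carrier dual"
  shows "(\<lambda>g\<in>carrier G. \<omega> g * \<eta> g) \<in> carrier dual"
proof (rule dualI)
  fix e :: real assume e: "e > 0"
  obtain A where A: "openin T A" "\<one>\<^bsub>G\<^esub> \<in> A" "\<And>g. g \<in> A \<Longrightarrow> norm (\<omega> g - 1) < e / 2"
    using dual_near_one[OF assms(1), of "e/2"] e by auto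
  obtain B where B: "openin T B" "\<one>\<^bsub>G\<^esub> \<in> B" "\<And>g. g \<in> B \<Longrightarrow> norm (\<eta> g - 1) < e / 2"
    using dual_near_one[OF assms(2), of "e/2"] e by auto
  have "norm ((\<lambda>g\<in>carrier G. \<omega> g * \<eta> g) g - 1) < e" if "g \<in> A \<inter> B" for g
  proof -
    have "g \<in> carrier G" using openin_subset[OF A(1)] that by auto
    then show ?thesis using A(3)[of g] B(3)[of g] that norm_mult_diff_le[of "\<omega> g" 1 "\<eta> g" 1] dualD(2)[OF assms(1)]
      by simp
  qed
  then show "\<exists>A. openin T A \<and> \<one>\<^bsub>G\<^esub> \<in> A \<and> (\<forall>g\<in>A. norm ((\<lambda>g\<in>carrier G. \<omega> g * \<eta> g) g - 1) < e)"
    using A B by (intro exI[of _ "A \<inter> B"]) auto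
qed (use assms in \<open>auto simp: dualD norm_mult\<close>)

lemma one_dual_closed: "(\<lambda>g\<in>carrier G. 1) \<in> carrier dual"
  by (rule dualI) (auto intro!: exI[of _ "carrier G"] simp: openin_topspace[of T, simplified])

lemma cnj_dual_closed:
  assumes "\<omega> \<in> carrier dual"
  shows "(\<lambda>g\<in>carrier G. cnj (\<omega> g)) \<in> carrier dual"
proof (rule dualI)
  fix e :: real assume e: "e > 0"
  obtain A where A: "openin T A" "\<one>\<^bsub>G\<^esub> \<in> A" "\<And>g. g \<in> A \<Longrightarrow> norm (\<omega> g - 1) < e"
    using dual_near_one[OF assms(1) e] by auto
  have "norm ((\<lambda>g\<in>carrier G. cnj (\<omega> g)) g - 1) < e" if "g \<in> A" for g
  proof -
    have "norm (cnj (\<omega> g) - 1) = norm (\<omega> g - 1)" using complex_mod_cnj[of "\<omega> g - 1"] by simp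
    then show ?thesis using that A(3)[OF that] openin_subset[OF A(1)] by auto
  qed
  then show "\<exists>A. openin T A \<and> \<one>\<^bsub>G\<^esub> \<in> A \<and> (\<forall>g\<in>A. norm ((\<lambda>g\<in>carrier G. cnj (\<omega> g)) g - 1) < e)"
    using A by (intro exI[of _ A]) auto
qed (use assms in \<open>auto simp: dualD\<close>)

lemma cnj_mult_dual:
  assumes "\<omega> \<in> carrier dual" "g \<in> carrier G"
  shows "cnj (\<omega> g) * \<omega> g = 1"
  using dualD(2)[OF assms] complex_norm_square[of "\<omega> g"] by (simp add: mult.commute)

lemma group_dual: "group dual"
proof (rule groupI)
  fix \<omega> assume \<omega>: "\<omega> \<in> carrier dual"
  show "\<one>\<^bsub>dual\<^esub> \<otimes>\<^bsub>dual\<^esub> \<omega> = \<omega>"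
    using dualD(1)[OF \<omega>] by (auto simp: fun_eq_iff extensional_def)
  show "\<exists>\<eta>\<in>carrier dual. \<eta> \<otimes>\<^bsub>dual\<^esub> \<omega> = \<one>\<^bsub>dual\<^esub>"
    using cnj_dual_closed[OF \<omega>] cnj_mult_dual[OF \<omega>]
    by (intro bexI[of _ "\<lambda>g\<in>carrier G. cnj (\<omega> g)"]) (auto simp: fun_eq_iff)
qed (use mult_dual_closed one_dual_closed in \<open>auto simp: fun_eq_iff mult.assoc\<close>)

lemma inv_dual:
  assumes "\<omega> \<in> carrier dual"
  shows "inv\<^bsub>dual\<^esub> \<omega> = (\<lambda>g\<in>carrier G. cnj (\<omega> g))"
  by (rule group.inv_equality[OF group_dual _ assms cnj_dual_closed[OF assms]])
    (use cnj_mult_dual[OF assms] in \<open>auto simp: fun_eq_iff\<close>)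

lemma \<delta>_mult:
  assumes "\<omega> \<in> carrier dual" "\<eta> \<in> carrier dual" "\<omega>' \<in> carrier dual" "\<eta>' \<in> carrier dual"
  shows "\<delta> (\<omega> \<otimes>\<^bsub>dual\<^esub> \<eta>) (\<omega>' \<otimes>\<^bsub>dual\<^esub> \<eta>') \<le> \<delta> \<omega> \<omega>' + \<delta> \<eta> \<eta>'"
proof (rule \<delta>_le)
  fix w
  have "norm ((\<omega> \<otimes>\<^bsub>dual\<^esub> \<eta>) (p w) - (\<omega>' \<otimes>\<^bsub>dual\<^esub> \<eta>') (p w))
      \<le> norm (\<omega> (p w) - \<omega>' (p w)) + norm (\<eta> (p w) - \<eta>' (p w))"
    using norm_mult_diff_le[of "\<omega> (p w)" "\<eta>' (p w)" "\<eta> (p w)" "\<omega>' (p w)"] dualD(2) assms by simp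
  then have "weight w * norm ((\<omega> \<otimes>\<^bsub>dual\<^esub> \<eta>) (p w) - (\<omega>' \<otimes>\<^bsub>dual\<^esub> \<eta>') (p w))
      \<le> weight w * (norm (\<omega> (p w) - \<omega>' (p w)) + norm (\<eta> (p w) - \<eta>' (p w)))"
    using weight_pos[of w] by (intro mult_left_mono) auto
  also have "\<dots> \<le> \<delta> \<omega> \<omega>' + \<delta> \<eta> \<eta>'"
    using \<delta>_ge[OF assms(1,3), of w] \<delta>_ge[OF assms(2,4), of w] by (simp add: distrib_left)
  finally show "weight w * norm ((\<omega> \<otimes>\<^bsub>dual\<^esub> \<eta>) (p w) - (\<omega>' \<otimes>\<^bsub>dual\<^esub> \<eta>') (p w)) \<le> \<delta> \<omega> \<omega>' + \<delta> \<eta> \<eta>'" .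
qed (use assms mult_dual_closed in auto)

lemma \<delta>_inv:
  assumes "\<omega> \<in> carrier dual" "\<eta> \<in> carrier dual"
  shows "\<delta> (inv\<^bsub>dual\<^esub> \<omega>) (inv\<^bsub>dual\<^esub> \<eta>) \<le> \<delta> \<omega> \<eta>"
  unfolding inv_dual[OF assms(1)] inv_dual[OF assms(2)]
proof (rule \<delta>_le[OF cnj_dual_closed[OF assms(1)] cnj_dual_closed[OF assms(2)]])
  fix w
  have "norm (cnj (\<omega> (p w)) - cnj (\<eta> (p w))) = norm (\<omega> (p w) - \<eta> (p w))"
    using complex_mod_cnj[of "\<omega> (p w) - \<eta> (p w)"] by simp
  then show "weight w * norm ((\<lambda>g\<in>carrier G. cnj (\<omega> g)) (p w) - (\<lambda>g\<in>carrier G. cnj (\<eta> g)) (p w)) \<le> \<delta> \<omega> \<eta>"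
    using \<delta>_ge[OF assms, of w] by simp
qed

text \<open>Under multiplication the distances of the factors at most add up, and inversion does not
  increase distances, so continuity can be read off from metric balls once the topology is replaced
  by that of \<open>\<delta>\<close>.\<close>

theorem topological_group_dual: "topological_group dual dual_top"
  unfolding topological_group_def
proof (intro conjI group_dual topspace_dual)
  interpret dg: group dual by (rule group_dual)
  show "continuous_map (prod_topology dual_top dual_top) dual_top (\<lambda>(\<omega>, \<eta>). \<omega> \<otimes>\<^bsub>dual\<^esub> \<eta>)"
    unfolding mtopology_dual[symmetric] dm.continuous_map_to_metric
  proof (intro ballI allI impI)
    fix z and e :: real
    assume "z \<in> topspace (prod_topology dm.mtopology dm.mtopology)" and e: "e > 0"
    then obtain \<omega> \<eta> where z: "z = (\<omega>, \<eta>)" "\<omega> \<in> carrier dual" "\<eta> \<in> carrier dual" by auto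
    have "(case y of (\<omega>, \<eta>) \<Rightarrow> \<omega> \<otimes>\<^bsub>dual\<^esub> \<eta>) \<in> dm.mball (case z of (\<omega>, \<eta>) \<Rightarrow> \<omega> \<otimes>\<^bsub>dual\<^esub> \<eta>) e"
      if "y \<in> dm.mball \<omega> (e/2) \<times> dm.mball \<eta> (e/2)" for y
    proof -
      obtain \<omega>' \<eta>' where y: "y = (\<omega>', \<eta>')" by (cases y)
      with that have y: "y = (\<omega>', \<eta>')" "\<omega>' \<in> carrier dual" "\<eta>' \<in> carrier dual"
        "\<delta> \<omega> \<omega>' < e/2" "\<delta> \<eta> \<eta>' < e/2" by auto
      have "\<delta> (\<omega> \<otimes>\<^bsub>dual\<^esub> \<eta>) (\<omega>' \<otimes>\<^bsub>dual\<^esub> \<eta>') < e" using \<delta>_mult[OF z(2,3) y(2,3)] y(4,5) by linarith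
      then show ?thesis using dg.m_closed[OF z(2,3)] dg.m_closed[OF y(2,3)] unfolding y(1) z(1) by simp
    qed
    moreover have "openin (prod_topology dm.mtopology dm.mtopology) (dm.mball \<omega> (e/2) \<times> dm.mball \<eta> (e/2))"
      by (simp add: openin_prod_Times_iff)
    moreover have "z \<in> dm.mball \<omega> (e/2) \<times> dm.mball \<eta> (e/2)" using z e by simp
    ultimately show "\<exists>U. openin (prod_topology dm.mtopology dm.mtopology) U \<and> z \<in> U \<and>
        (\<forall>y\<in>U. (case y of (\<omega>, \<eta>) \<Rightarrow> \<omega> \<otimes>\<^bsub>dual\<^esub> \<eta>) \<in> dm.mball (case z of (\<omega>, \<eta>) \<Rightarrow> \<omega> \<otimes>\<^bsub>dual\<^esub> \<eta>) e)"
      by (intro exI[of _ "dm.mball \<omega> (e/2) \<times> dm.mball \<eta> (e/2)"] conjI ballI)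
  qed
  show "continuous_map dual_top dual_top (\<lambda>\<omega>. inv\<^bsub>dual\<^esub> \<omega>)"
    unfolding mtopology_dual[symmetric] dm.continuous_map_to_metric
  proof (intro ballI allI impI)
    fix \<omega> and e :: real
    assume "\<omega> \<in> topspace dm.mtopology" and e: "e > 0"
    then have \<omega>: "\<omega> \<in> carrier dual" by simp
    have "inv\<^bsub>dual\<^esub> \<eta> \<in> dm.mball (inv\<^bsub>dual\<^esub> \<omega>) e" if "\<eta> \<in> dm.mball \<omega> e" for \<eta>
      using that \<delta>_inv[OF \<omega>, of \<eta>] dg.inv_closed \<omega> by auto
    then show "\<exists>U. openin dm.mtopology U \<and> \<omega> \<in> U \<and> (\<forall>y\<in>U. inv\<^bsub>dual\<^esub> y \<in> dm.mball (inv\<^bsub>dual\<^esub> \<omega>) e)"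
      using \<omega> e by (intro exI[of _ "dm.mball \<omega> e"]) auto
  qed
qed

end

section \<open>Fields of locally compact groups\<close>

context dense_sequence_group
begin

text \<open>This is total boundedness of the ball tested on word values. The finite nets are initial
  segments of the enumeration of words, and their centres may lie outside the ball, so only
  quantifiers over countable types occur.\<close>

definition precompact_ball :: "nat \<Rightarrow> bool" where
  "precompact_ball k \<longleftrightarrow> (\<forall>i. \<exists>N. \<forall>w. d \<one>\<^bsub>G\<^esub> (p w) < 1 / Suc k \<longrightarrow>
     (\<exists>v. to_nat v < (N::nat) \<and> d (p v) (p w) < 1 / Suc i))"

lemma dense_word_ball:
  assumes "openin T A" "g \<in> A" "e > 0"
  shows "\<exists>w. p w \<in> A \<and> d g (p w) < e"
proof -
  have "g \<in> carrier G" using openin_subset[OF assms(1)] assms(2) by auto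
  then have "openin T (A \<inter> mball g e)" "g \<in> A \<inter> mball g e"
    using assms by (auto simp: mtop[symmetric])
  then obtain n where "a n \<in> A \<inter> mball g e" by (metis dense_word)
  then show ?thesis by (intro exI[of _ "[(True, n)]"]) (simp add: p_single del: word_value.simps)
qed

text \<open>In a complete space a totally bounded set has compact closure. The nets of
  \<open>mtotally_bounded\<close> must lie inside the set, so each centre close to the ball is
  replaced by a nearby point of the ball, at the price of a larger radius.\<close>

lemma precompact_ball_imp_compact:
  assumes mcomplete and tb: "precompact_ball k"
  shows "compactin T (T closure_of (mball \<one>\<^bsub>G\<^esub> (1 / Suc k)))"
proof -
  define S where "S = mball \<one>\<^bsub>G\<^esub> (1 / Suc k)"
  have S: "openin T S" unfolding S_def by (simp add: mtop[symmetric])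
  have "mtotally_bounded S"
    unfolding mtotally_bounded_def
  proof (intro allI impI)
    fix e :: real assume e: "e > 0"
    \<comment> \<open>A point of the ball is within \<open>e / 4\<close> of a word value in the
      ball, which is within \<open>e / 4\<close> of a net centre; moving that centre into the ball
      costs another \<open>e / 2\<close>.\<close>
    then obtain i where i: "1 / Suc i < e / 4" using nat_approx_posE[of "e/4"] by (metis of_nat_Suc divide_pos_pos zero_less_numeral)
    obtain N where N: "\<And>w. d \<one>\<^bsub>G\<^esub> (p w) < 1 / Suc k \<Longrightarrow> \<exists>v. to_nat v < N \<and> d (p v) (p w) < 1 / Suc i"
      using tb unfolding precompact_ball_def by meson
    define V where "V = {v :: word. to_nat v < N \<and> (\<exists>s\<in>S. d (p v) s < e / 2)}"
    have "\<forall>v\<in>V. \<exists>s. s \<in> S \<and> d (p v) s < e / 2" unfolding V_def by auto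
    from bchoice[OF this] obtain s where s: "\<forall>v\<in>V. s v \<in> S \<and> d (p v) (s v) < e / 2" by auto
    have "finite V" unfolding V_def by (rule finite_subset[OF _ finite_words[of N]]) auto
    moreover have "S \<subseteq> (\<Union>x\<in>s ` V. mball x e)"
    proof
      fix g assume g: "g \<in> S"
      then have gG: "g \<in> carrier G" unfolding S_def by auto
      obtain w where w: "p w \<in> S" "d g (p w) < e / 4" using dense_word_ball[OF S g, of "e/4"] e by auto
      then obtain v where v: "to_nat v < N" "d (p v) (p w) < 1 / Suc i"
        using N[of w] unfolding S_def by auto
      have vg: "d (p v) g < e / 2"
        using triangle[of "p v" "p w" g] v(2) w(2) i gG commute[of g "p w"] by simp
      then have vV: "v \<in> V" using v(1) g unfolding V_def by auto
      then have "d (p v) (s v) < e / 2" "s v \<in> carrier G" using s unfolding S_def by auto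
      then have "d (s v) g < e" using triangle[of "s v" "p v" g] vg gG commute[of "p v" "s v"] by simp
      then show "g \<in> (\<Union>x\<in>s ` V. mball x e)" using vV gG \<open>s v \<in> carrier G\<close> by auto
    qed
    ultimately show "\<exists>K. finite K \<and> K \<subseteq> S \<and> S \<subseteq> (\<Union>x\<in>K. mball x e)"
      using s by (intro exI[of _ "s ` V"]) auto
  qed
  then show ?thesis using mtotally_bounded_eq_compact_closure_of[OF assms(1)]
    unfolding S_def mtop by simp
qed

text \<open>The balls of radius \<open>1 / Suc i\<close> around word values cover a compact
  neighbourhood of the unit, and a finite subcover uses only words below some index
  \<open>N\<close>.\<close>

lemma precompact_ball_exists:
  assumes "locally_compact_space T"
  shows "\<exists>k. precompact_ball k"
proof -
  have "\<one>\<^bsub>G\<^esub> \<in> topspace T" by simp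
  then obtain A K where AK: "openin T A" "compactin T K" "\<one>\<^bsub>G\<^esub> \<in> A" "A \<subseteq> K"
    using assms unfolding locally_compact_space_def by metis
  obtain k where k: "mball \<one>\<^bsub>G\<^esub> (1 / Suc k) \<subseteq> A" using openin_ball_one[OF AK(1,3)] by auto
  have "precompact_ball k" unfolding precompact_ball_def
  proof
    fix i :: nat
    define B where "B v = mball (p v) (1 / Suc i)" for v
    have "K \<subseteq> \<Union>(range B)"
    proof
      fix g assume "g \<in> K"
      then have g: "g \<in> carrier G" using compactin_subset_topspace[OF AK(2)] by auto
      obtain w where "d g (p w) < 1 / Suc i"
        using dense_word_ball[OF openin_topspace, of g "1 / Suc i"] g by auto
      then show "g \<in> \<Union>(range B)" using g unfolding B_def by (auto simp: commute intro!: exI[of _ w])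
    qed
    moreover have "\<forall>b\<in>range B. openin T b" unfolding B_def mtop[symmetric] by auto
    ultimately obtain \<F> where \<F>: "finite \<F>" "\<F> \<subseteq> range B" "K \<subseteq> \<Union>\<F>"
      using AK(2) unfolding compactin_def by meson
    obtain V where V: "finite V" "\<F> = B ` V" using finite_subset_image[OF \<F>(1,2)] by auto
    obtain N where N: "\<forall>n\<in>to_nat ` V. n < N" using V(1) finite_nat_set_iff_bounded by blast
    have "\<exists>v. to_nat v < N \<and> d (p v) (p w) < 1 / Suc i" if "d \<one>\<^bsub>G\<^esub> (p w) < 1 / Suc k" for w
    proof -
      have "p w \<in> mball \<one>\<^bsub>G\<^esub> (1 / Suc k)" using that by simp
      then have "p w \<in> \<Union>\<F>" using k AK(4) \<F>(3) by blast
      then obtain v where "v \<in> V" "p w \<in> B v" unfolding V(2) by auto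
      then show ?thesis using N unfolding B_def by auto
    qed
    then show "\<exists>N. \<forall>w. d \<one>\<^bsub>G\<^esub> (p w) < 1 / Suc k \<longrightarrow> (\<exists>v. to_nat v < N \<and> d (p v) (p w) < 1 / Suc i)"
      by blast
  qed
  then show ?thesis ..
qed

end

lemma space_fibre_product:
  "space (fibre_product M N) = {(v, w). v \<in> space M \<and> w \<in> space N \<and> fst v = fst w}"
  unfolding fibre_product_def space_restrict_space space_pair_measure by auto

lemma measurable_fibre_product:
  assumes "f \<in> L \<rightarrow>\<^sub>M M" "g \<in> L \<rightarrow>\<^sub>M N" "\<And>z. z \<in> space L \<Longrightarrow> fst (f z) = fst (g z)"
  shows "(\<lambda>z. (f z, g z)) \<in> L \<rightarrow>\<^sub>M fibre_product M N"
  unfolding fibre_product_def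
proof (rule measurable_restrict_space2)
  show "(\<lambda>z. (f z, g z)) \<in> space L \<rightarrow> {(v, w). v \<in> space M \<and> w \<in> space N \<and> fst v = fst w}"
    using assms measurable_space[OF assms(1)] measurable_space[OF assms(2)] by auto
qed (use assms in measurable)

lemma measurable_fibre_product_projections:
  "fst \<in> fibre_product M N \<rightarrow>\<^sub>M M" "snd \<in> fibre_product M N \<rightarrow>\<^sub>M N"
  unfolding fibre_product_def by (intro measurable_restrict_space1 measurable_fst measurable_snd)+

locale locally_compact_group_field =
  fixes X :: "'x measure" and G :: "'x \<Rightarrow> ('g, 'm) monoid_scheme" and T :: "'x \<Rightarrow> 'g topology"
    and M :: "('x \<times> 'g) measure" and d :: "('x \<times> 'g) \<times> ('x \<times> 'g) \<Rightarrow> real"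
    and \<phi> :: "nat \<Rightarrow> 'x \<Rightarrow> 'x \<times> 'g"
  assumes field: "Borel_field_of_Polish_groups X G T M"
    and locally_compact: "x \<in> space X \<Longrightarrow> locally_compact_space (T x)"
    and d_measurable: "d \<in> fibre_product M M \<rightarrow>\<^sub>M borel"
    and d_metric: "x \<in> space X \<Longrightarrow> Metric_space (topspace (T x)) (\<lambda>v w. d ((x, v), (x, w)))"
    and d_complete: "x \<in> space X \<Longrightarrow>
      Metric_space.mcomplete (topspace (T x)) (\<lambda>v w. d ((x, v), (x, w)))"
    and d_topology: "x \<in> space X \<Longrightarrow>
      Metric_space.mtopology (topspace (T x)) (\<lambda>v w. d ((x, v), (x, w))) = T x"
    and \<phi>_section: "Borel_section X M (\<phi> n)"
    and \<phi>_dense: "x \<in> space X \<Longrightarrow> T x closure_of (range (\<lambda>n. snd (\<phi> n x))) = topspace (T x)"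
begin

definition dx :: "'x \<Rightarrow> 'g \<Rightarrow> 'g \<Rightarrow> real" where "dx x v w = d ((x, v), (x, w))"
definition a :: "'x \<Rightarrow> nat \<Rightarrow> 'g" where "a x n = snd (\<phi> n x)"
abbreviation P :: "'x \<Rightarrow> word \<Rightarrow> 'g" where "P x \<equiv> word_value (G x) (a x)"

lemma standard_X: "standard_Borel X" and space_M: "space M = total_space X T"
  and fst_M: "fst \<in> M \<rightarrow>\<^sub>M X"
  and Polish_group_fibre: "x \<in> space X \<Longrightarrow> Polish_group (G x) (T x)"
  and unit_measurable: "(\<lambda>x. (x, \<one>\<^bsub>G x\<^esub>)) \<in> X \<rightarrow>\<^sub>M M"
  and inv_measurable: "(\<lambda>(x, g). (x, inv\<^bsub>G x\<^esub> g)) \<in> M \<rightarrow>\<^sub>M M"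
  and mult_measurable:
    "(\<lambda>((x, g), (_, h)). (x, g \<otimes>\<^bsub>G x\<^esub> h)) \<in> fibre_product M M \<rightarrow>\<^sub>M M"
  using field unfolding Borel_field_of_Polish_groups_def Borel_field_of_Polish_spaces_def by auto

lemma topspace_T: "x \<in> space X \<Longrightarrow> topspace (T x) = carrier (G x)"
  using Polish_group_fibre unfolding Polish_group_def topological_group_def by auto

lemma \<phi>_measurable: "\<phi> n \<in> X \<rightarrow>\<^sub>M M"
  using \<phi>_section unfolding Borel_section_def by auto

lemma \<phi>_eq: "x \<in> space X \<Longrightarrow> \<phi> n x = (x, a x n)"
  using \<phi>_section[of n] unfolding Borel_section_def a_def by (metis prod.collapse)

lemma a_measurable: "(\<lambda>x. (x, a x n)) \<in> X \<rightarrow>\<^sub>M M"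
  using \<phi>_measurable[of n] by (subst measurable_cong[OF \<phi>_eq[symmetric]]) auto

lemma dense_sequence_fibre:
  assumes x: "x \<in> space X"
  shows "dense_sequence_group (G x) (T x) (dx x) (a x)"
proof (rule dense_sequence_group.intro)
  show "topological_group (G x) (T x)" using Polish_group_fibre[OF x] unfolding Polish_group_def by simp
  show "Metric_space (carrier (G x)) (dx x)"
    using d_metric[OF x] unfolding topspace_T[OF x] dx_def[abs_def] .
  show "Metric_space.mtopology (carrier (G x)) (dx x) = T x"
    using d_topology[OF x] unfolding topspace_T[OF x] dx_def[abs_def] .
  show "a x n \<in> carrier (G x)" for n
    using measurable_space[OF a_measurable x, of n] unfolding space_M total_space_def topspace_T[OF x, symmetric] by auto
  show "T x closure_of range (a x) = topspace (T x)" using \<phi>_dense[OF x] unfolding a_def[abs_def] .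
qed

lemma word_measurable: "(\<lambda>x. (x, P x w)) \<in> X \<rightarrow>\<^sub>M M"
proof (induction w)
  case Nil
  then show ?case using unit_measurable by simp
next
  case (Cons y w)
  obtain b n where y: "y = (b, n)" by (cases y)
  have "(\<lambda>x. (x, inv\<^bsub>G x\<^esub> a x n)) \<in> X \<rightarrow>\<^sub>M M"
    using measurable_comp[OF a_measurable[of n] inv_measurable] by (simp add: comp_def)
  then have "(\<lambda>x. (x, if b then a x n else inv\<^bsub>G x\<^esub> a x n)) \<in> X \<rightarrow>\<^sub>M M"
    using a_measurable[of n] by (cases b) auto
  then have "(\<lambda>x. ((x, if b then a x n else inv\<^bsub>G x\<^esub> a x n), (x, P x w))) \<in> X \<rightarrow>\<^sub>M fibre_product M M"
    using Cons by (rule measurable_fibre_product) simp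
  from measurable_comp[OF this mult_measurable] show ?case by (simp add: y comp_def)
qed

lemma dx_measurable:
  assumes "(\<lambda>z. (f z, g z)) \<in> L \<rightarrow>\<^sub>M M" "(\<lambda>z. (f z, h z)) \<in> L \<rightarrow>\<^sub>M M"
  shows "(\<lambda>z. dx (f z) (g z) (h z)) \<in> borel_measurable L"
  using measurable_comp[OF measurable_fibre_product[OF assms] d_measurable]
  by (simp add: comp_def dx_def)

lemma dx_words_measurable [measurable]: "(\<lambda>x. dx x (P x v) (P x w)) \<in> borel_measurable X"
  by (intro dx_measurable word_measurable)

lemma dx_one_measurable [measurable]: "(\<lambda>x. dx x \<one>\<^bsub>G x\<^esub> (P x w)) \<in> borel_measurable X"
  using dx_words_measurable[of "[]" w] by simp

text \<open>Total boundedness of a ball is tested on the dense subgroup only, which makes the choice of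
  the radius measurable in \<open>x\<close>.\<close>

definition J :: "'x \<Rightarrow> nat" where
  "J x = (LEAST k. \<forall>i. \<exists>N. \<forall>w. dx x \<one>\<^bsub>G x\<^esub> (P x w) < 1 / Suc k \<longrightarrow>
     (\<exists>v. to_nat v < (N::nat) \<and> dx x (P x v) (P x w) < 1 / Suc i))"

lemma J_measurable [measurable]: "J \<in> X \<rightarrow>\<^sub>M count_space UNIV"
  unfolding J_def[abs_def] by measurable

definition R :: "'x \<Rightarrow> real" where "R x = 1 / Suc (J x)"

lemma R_measurable [measurable]: "R \<in> borel_measurable X"
  unfolding R_def[abs_def] by measurable

lemma locally_compact_sequence_fibre:
  assumes x: "x \<in> space X"
  shows "locally_compact_sequence_group (G x) (T x) (dx x) (a x) (R x)"
proof -
  interpret D: dense_sequence_group "G x" "T x" "dx x" "a x" by (rule dense_sequence_fibre[OF x])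
  have "D.precompact_ball (J x)"
    using LeastI_ex[OF D.precompact_ball_exists[OF locally_compact[OF x]]]
    unfolding J_def D.precompact_ball_def .
  moreover have "D.mcomplete"
    using d_complete[OF x] unfolding topspace_T[OF x] dx_def[abs_def] .
  ultimately show ?thesis
    using D.precompact_ball_imp_compact by unfold_locales (auto simp: R_def)
qed

end

section \<open>The Borel structure on the dual\<close>

context locally_compact_group_field
begin

abbreviation dual_group :: "'x \<Rightarrow> ('g \<Rightarrow> complex) monoid" where
  "dual_group x \<equiv> Pontryagin_dual (G x) (T x)"

abbreviation dual_topology :: "'x \<Rightarrow> ('g \<Rightarrow> complex) topology" where
  "dual_topology x \<equiv> Pontryagin_dual_topology (G x) (T x)"

definition e\<^sub>X :: "'x \<Rightarrow> nat \<Rightarrow> real" where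
  "e\<^sub>X = (SOME i. borel_embedding X i)"

lemma e\<^sub>X: "borel_embedding X e\<^sub>X"
  unfolding e\<^sub>X_def by (rule someI_ex[OF standard_Borel_embedding[OF standard_X]])

text \<open>A character is recorded by its values on the dense sequence of sections.\<close>

definition coords :: "'x \<times> ('g \<Rightarrow> complex) \<Rightarrow> (nat \<Rightarrow> real) \<times> (nat \<Rightarrow> complex)" where
  "coords z = (e\<^sub>X (fst z), \<lambda>n. snd z (a (fst z) n))"

abbreviation \<Omega> :: "('x \<times> ('g \<Rightarrow> complex)) set" where "\<Omega> \<equiv> dual_total_space X G T"

definition dual_borel :: "('x \<times> ('g \<Rightarrow> complex)) measure" where
  "dual_borel = vimage_algebra \<Omega> coords borel"

lemma space_dual_borel [simp]: "space dual_borel = \<Omega>"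
  unfolding dual_borel_def by simp

lemma sets_dual_borel: "sets dual_borel = {coords -` C \<inter> \<Omega> | C. C \<in> sets borel}"
  unfolding dual_borel_def by (rule sets_vimage_algebra2) simp

lemma mem_\<Omega>: "z \<in> \<Omega> \<longleftrightarrow> fst z \<in> space X \<and> snd z \<in> carrier (dual_group (fst z))"
  unfolding dual_total_space_def by (cases z) auto

lemma coords_measurable: "coords \<in> borel_measurable dual_borel"
  unfolding dual_borel_def by (rule measurable_vimage_algebra1) simp

lemma coords_inj: "inj_on coords \<Omega>"
proof (rule inj_onI)
  fix z z' assume z: "z \<in> \<Omega>" "z' \<in> \<Omega>" "coords z = coords z'"
  then have "fst z = fst z'" using e\<^sub>X unfolding coords_def borel_embedding_def mem_\<Omega> inj_on_def by auto
  interpret dense_sequence_group "G (fst z)" "T (fst z)" "dx (fst z)" "a (fst z)"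
    using z(1) unfolding mem_\<Omega> by (intro dense_sequence_fibre) simp
  have "snd z = snd z'"
  proof (rule dual_eqI)
    show "snd z \<in> carrier dual" "snd z' \<in> carrier dual"
      using z(1,2) \<open>fst z = fst z'\<close> unfolding mem_\<Omega> by auto
    show "snd z (a (fst z) n) = snd z' (a (fst z) n)" for n
      using z(3) \<open>fst z = fst z'\<close> unfolding coords_def by (metis prod.inject)
  qed
  with \<open>fst z = fst z'\<close> show "z = z'" by (rule prod_eqI)
qed

text \<open>The condition \<open>small k\<close> of a single fibre is written outside the fibre
  locale so that \<open>x\<close> can vary.\<close>

definition small_tuples :: "nat \<Rightarrow> 'x \<Rightarrow> (nat \<Rightarrow> complex) set" where
  "small_tuples k x = {u \<in> torus. \<forall>w. dx x \<one>\<^bsub>G x\<^esub> (P x w) < 1 / Suc k \<longrightarrow> norm (torus_word u w - 1) \<le> 1/2}"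

lemma small_tuples_character:
  assumes "x \<in> space X" "u \<in> small_tuples k x"
  shows "\<exists>\<omega>\<in>carrier (dual_group x). \<forall>n. \<omega> (a x n) = u n"
proof -
  interpret dense_sequence_group "G x" "T x" "dx x" "a x" by (rule dense_sequence_fibre[OF assms(1)])
  show ?thesis using assms(2) torus_extends[of u k] unfolding small_tuples_def small_def by simp
qed

lemma character_small_tuples:
  assumes "x \<in> space X" "\<omega> \<in> carrier (dual_group x)"
  shows "\<exists>k. (\<lambda>n. \<omega> (a x n)) \<in> small_tuples k x"
proof -
  interpret dense_sequence_group "G x" "T x" "dx x" "a x" by (rule dense_sequence_fibre[OF assms(1)])
  show ?thesis using dual_small[OF assms(2)] dual_torus[OF assms(2)] unfolding small_tuples_def small_def by simp
qed

lemma closed_torus: "closed torus"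
  using compact_torus by (rule compact_imp_closed)

lemma torus_word_measurable: "(\<lambda>u. torus_word u w) \<in> borel_measurable borel"
  by (intro borel_measurable_continuous_onI continuous_on_torus_word)

lemma coords_image: "coords ` \<Omega> =
   {(e\<^sub>X x, u) | x u. x \<in> space X \<and> (\<exists>k. u \<in> small_tuples k x)}"
proof (intro equalityI subsetI)
  fix y assume "y \<in> coords ` \<Omega>"
  then obtain z where z: "z \<in> \<Omega>" "y = coords z" by auto
  then show "y \<in> {(e\<^sub>X x, u) | x u. x \<in> space X \<and> (\<exists>k. u \<in> small_tuples k x)}"
    using character_small_tuples[of "fst z" "snd z"] unfolding mem_\<Omega> coords_def by auto
next
  fix y assume "y \<in> {(e\<^sub>X x, u) | x u. x \<in> space X \<and> (\<exists>k. u \<in> small_tuples k x)}"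
  then obtain x u k where y: "y = (e\<^sub>X x, u)" "x \<in> space X" "u \<in> small_tuples k x" by auto
  then obtain \<omega> where "\<omega> \<in> carrier (dual_group x)" "\<And>n. \<omega> (a x n) = u n"
    using small_tuples_character[OF y(2,3)] by auto
  then show "y \<in> coords ` \<Omega>" using y by (intro image_eqI[of _ _ "(x, \<omega>)"]) (auto simp: coords_def mem_\<Omega>)
qed

text \<open>The base point is recovered from its code by the inverse \<open>j\<close> of
  \<open>e\<^sub>X\<close>, which is measurable on the Borel set \<open>S\<close> of codes. The
  image is then described by quantifiers over countable types applied to measurable functions of the
  code and the tuple.\<close>

lemma coords_image_borel: "coords ` \<Omega> \<in> sets borel"
proof -
  define S where "S = e\<^sub>X ` space X"
  define j where "j = the_inv_into (space X) e\<^sub>X"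
  have inj: "inj_on e\<^sub>X (space X)" and S: "S \<in> sets borel"
    using e\<^sub>X unfolding borel_embedding_def S_def by auto
  have je: "j (e\<^sub>X x) = x" if "x \<in> space X" for x
    using that inj unfolding j_def by (rule the_inv_into_f_f[rotated])
  have j: "j \<in> restrict_space borel S \<rightarrow>\<^sub>M X"
    unfolding j_def S_def by (rule borel_embedding_inverse[OF e\<^sub>X])
  define N where "N = restrict_space (borel :: ((nat \<Rightarrow> real) \<times> (nat \<Rightarrow> complex)) measure) (S \<times> UNIV)"
  have "S \<times> UNIV \<in> sets (borel \<Otimes>\<^sub>M (borel :: (nat \<Rightarrow> complex) measure))" using S by auto
  then have SU: "S \<times> UNIV \<in> sets (borel :: ((nat \<Rightarrow> real) \<times> (nat \<Rightarrow> complex)) measure)"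
    unfolding borel_prod .
  have spN: "space N = S \<times> UNIV" unfolding N_def space_restrict_space by simp
  have fst: "fst \<in> N \<rightarrow>\<^sub>M borel" and snd [measurable]: "snd \<in> N \<rightarrow>\<^sub>M borel"
    unfolding N_def
    by (intro measurable_restrict_space1 borel_measurable_continuous_onI
        continuous_on_fst[OF continuous_on_id] continuous_on_snd[OF continuous_on_id])+
  have "fst \<in> N \<rightarrow>\<^sub>M restrict_space borel S"
    by (rule measurable_restrict_space2[OF _ fst]) (auto simp: spN)
  from measurable_compose[OF this j] have jf: "(\<lambda>z. j (fst z)) \<in> N \<rightarrow>\<^sub>M X" .
  have d [measurable]: "(\<lambda>z. dx (j (fst z)) \<one>\<^bsub>G (j (fst z))\<^esub> (P (j (fst z)) w)) \<in> borel_measurable N" for w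
    by (rule measurable_compose[OF jf dx_one_measurable])
  have t [measurable]: "(\<lambda>z. torus_word (snd z) w) \<in> borel_measurable N" for w
    by (rule measurable_compose[OF snd torus_word_measurable])
  have "torus \<in> sets borel" using closed_torus by simp
  then have "{z \<in> space N. snd z \<in> torus \<and> (\<exists>k. \<forall>w. dx (j (fst z)) \<one>\<^bsub>G (j (fst z))\<^esub> (P (j (fst z)) w) < 1 / Suc k \<longrightarrow>
      norm (torus_word (snd z) w - 1) \<le> 1/2)} \<in> sets N" (is "?Q \<in> _") by measurable
  also have "?Q = {z \<in> space N. \<exists>k. snd z \<in> small_tuples k (j (fst z))}"
    unfolding small_tuples_def by auto
  also have "\<dots> = coords ` \<Omega>"
    unfolding coords_image spN S_def using je by fastforce
  finally show ?thesis using SU unfolding N_def by (auto simp: sets_restrict_space)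
qed

lemma coords_embedding: "borel_embedding dual_borel coords"
  unfolding borel_embedding_def
proof (intro conjI ballI coords_measurable)
  show "inj_on coords (space dual_borel)" using coords_inj by simp
  fix A assume "A \<in> sets dual_borel"
  then obtain C where "C \<in> sets borel" "A = coords -` C \<inter> \<Omega>" unfolding sets_dual_borel by auto
  moreover from this have "coords ` A = C \<inter> coords ` \<Omega>" by auto
  ultimately show "coords ` A \<in> sets borel" using coords_image_borel by auto
qed

lemma standard_dual_borel: "standard_Borel dual_borel"
  by (rule standard_BorelI[OF coords_embedding])

lemma fst_dual_borel: "fst \<in> dual_borel \<rightarrow>\<^sub>M X"
proof (rule measurableI)
  show "fst z \<in> space X" if "z \<in> space dual_borel" for z using that by (simp add: mem_\<Omega>)
  fix A assume A: "A \<in> sets X"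
  then have "e\<^sub>X ` A \<in> sets borel" using e\<^sub>X unfolding borel_embedding_def by auto
  then have "e\<^sub>X ` A \<times> (UNIV :: (nat \<Rightarrow> complex) set) \<in> sets (borel \<Otimes>\<^sub>M borel)" by auto
  moreover have "fst -` A \<inter> space dual_borel = coords -` (e\<^sub>X ` A \<times> UNIV) \<inter> \<Omega>"
  proof -
    have "fst z \<in> A \<longleftrightarrow> e\<^sub>X (fst z) \<in> e\<^sub>X ` A" if "z \<in> \<Omega>" for z
      using that e\<^sub>X sets.sets_into_space[OF A] unfolding borel_embedding_def mem_\<Omega>
      inj_on_def by blast
    then show ?thesis by (auto simp: coords_def)
  qed
  ultimately show "fst -` A \<inter> space dual_borel \<in> sets dual_borel"
    unfolding sets_dual_borel borel_prod by blast
qed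

lemma measurable_snd_coord:
  "(\<lambda>z. snd z (a (fst z) n)) \<in> borel_measurable dual_borel"
proof -
  have "(\<lambda>c :: (nat \<Rightarrow> real) \<times> (nat \<Rightarrow> complex). snd c n) \<in> borel_measurable borel"
    by (intro borel_measurable_continuous_onI continuous_on_compose2[OF continuous_on_product_coordinates[of n] continuous_on_snd[OF continuous_on_id]]) auto
  from measurable_compose[OF coords_measurable this] show ?thesis by (simp add: coords_def)
qed

text \<open>The base point and the values at the sections are the components of
  \<open>coords\<close>, which generates the structure. This is the test used for the sections and
  the group operations of the dual.\<close>

lemma measurable_into_dual_borel:
  assumes "\<And>z. z \<in> space L \<Longrightarrow> h z \<in> \<Omega>" "(\<lambda>z. fst (h z)) \<in> L \<rightarrow>\<^sub>M X"
    and "\<And>n. (\<lambda>z. snd (h z) (a (fst (h z)) n)) \<in> borel_measurable L"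
  shows "h \<in> L \<rightarrow>\<^sub>M dual_borel"
  unfolding dual_borel_def
proof (rule measurable_vimage_algebra2)
  have "(\<lambda>z. e\<^sub>X (fst (h z))) \<in> borel_measurable L"
    using measurable_compose[OF assms(2)] e\<^sub>X unfolding borel_embedding_def by auto
  moreover have "(\<lambda>z n. snd (h z) (a (fst (h z)) n)) \<in> borel_measurable L"
    by (rule measurable_coordinatewise_then_product[OF assms(3)])
  ultimately show "(\<lambda>z. coords (h z)) \<in> borel_measurable L"
    unfolding coords_def borel_prod[symmetric] by (rule measurable_Pair)
qed (use assms(1) in auto)

text \<open>A point \<open>g\<close> is approximated by \<open>a x n\<close> with the least
  \<open>n\<close> at distance below \<open>1 / Suc k\<close>, an index that depends measurably on
  the point; continuity of the character gives pointwise convergence of the measurable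
  approximations. \<open>N\<close> is kept general so that the result applies to the measure rebuilt
  by \<open>sigma\<close>.\<close>

lemma evaluation_measurable:
  assumes N: "space N = \<Omega>" "fst \<in> N \<rightarrow>\<^sub>M X" "\<And>n. (\<lambda>z. snd z (a (fst z) n)) \<in> borel_measurable N"
  shows "(\<lambda>((_, \<omega>), (_, g)). \<omega> g) \<in> fibre_product N M \<rightarrow>\<^sub>M restrict_space borel (sphere 0 1)"
proof (rule measurable_restrict_space2)
  let ?F = "fibre_product N M"
  have sp: "fst (fst z) \<in> space X \<and> fst (snd z) = fst (fst z) \<and>
      snd (fst z) \<in> carrier (dual_group (fst (fst z))) \<and>
      snd (snd z) \<in> carrier (G (fst (fst z)))" if "z \<in> space ?F" for z
    using that unfolding space_fibre_product N space_M total_space_def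
    by (auto simp: mem_\<Omega> topspace_T)
  show "(\<lambda>((_, \<omega>), (_, g)). \<omega> g) \<in> space ?F \<rightarrow> sphere 0 1"
  proof
    fix z assume z: "z \<in> space ?F"
    interpret dense_sequence_group "G (fst (fst z))" "T (fst (fst z))" "dx (fst (fst z))" "a (fst (fst z))"
      using sp[OF z] by (intro dense_sequence_fibre) simp
    show "(case z of (x, xa) \<Rightarrow> (case x of (_, \<omega>) \<Rightarrow> \<lambda>(_, g). \<omega> g) xa) \<in> sphere 0 1"
      using dualD(2)[of "snd (fst z)" "snd (snd z)"] sp[OF z] by (auto simp: case_prod_beta)
  qed
  define near where "near k z = (LEAST n. dx (fst (snd z)) (a (fst (snd z)) n) (snd (snd z)) < 1 / Suc k)"
    for k :: nat and z :: "('x \<times> ('g \<Rightarrow> complex)) \<times> ('x \<times> 'g)"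
  have fst1: "(\<lambda>z. fst (snd z)) \<in> ?F \<rightarrow>\<^sub>M X"
    by (rule measurable_compose[OF measurable_fibre_product_projections(2) fst_M])
  have "(\<lambda>z. dx (fst (snd z)) (a (fst (snd z)) n) (snd (snd z))) \<in> borel_measurable ?F" for n
  proof (rule dx_measurable)
    show "(\<lambda>z. (fst (snd z), a (fst (snd z)) n)) \<in> ?F \<rightarrow>\<^sub>M M"
      by (rule measurable_compose[OF fst1 a_measurable])
    show "(\<lambda>z. (fst (snd z), snd (snd z))) \<in> ?F \<rightarrow>\<^sub>M M"
      using measurable_fibre_product_projections(2)[of N M] by simp
  qed
  note [measurable] = this
  have near: "near k \<in> ?F \<rightarrow>\<^sub>M count_space UNIV" for k
    unfolding near_def[abs_def] by measurable
  have coord: "(\<lambda>z. snd (fst z) (a (fst (fst z)) n)) \<in> borel_measurable ?F" for n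
    by (rule measurable_compose[OF measurable_fibre_product_projections(1) N(3)])
  show "(\<lambda>((_, \<omega>), (_, g)). \<omega> g) \<in> borel_measurable ?F"
  proof (rule borel_measurable_LIMSEQ_metric)
    show "(\<lambda>z. snd (fst z) (a (fst (fst z)) (near k z))) \<in> borel_measurable ?F" for k
      by (rule measurable_compose_countable[OF coord near])
    fix z assume z: "z \<in> space ?F"
    define x where "x = fst (fst z)"
    define \<omega> where "\<omega> = snd (fst z)"
    define g where "g = snd (snd z)"
    have x: "x \<in> space X" "fst (snd z) = x" "\<omega> \<in> carrier (dual_group x)" "g \<in> carrier (G x)"
      using sp[OF z] unfolding x_def \<omega>_def g_def by auto
    interpret dense_sequence_group "G x" "T x" "dx x" "a x" by (rule dense_sequence_fibre[OF x(1)])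
    have dnear: "dx x (a x (near k z)) g < 1 / Suc k" for k
    proof -
      have "openin (T x) (mball g (1 / Suc k))" "g \<in> mball g (1 / Suc k)"
        using x(4) by (auto simp: mtop[symmetric])
      then obtain n where "a x n \<in> mball g (1 / Suc k)" by (metis dense_word)
      then have "dx x (a x n) g < 1 / Suc k" by (simp add: commute)
      then show ?thesis unfolding near_def x(2) g_def by (rule LeastI)
    qed
    have "limitin mtopology (\<lambda>k. a x (near k z)) g sequentially"
      unfolding limitin_metric eventually_sequentially
    proof (intro conjI allI impI x(4))
      fix e :: real assume "e > 0"
      then obtain m where m: "1 / Suc m < e" using nat_approx_posE[of e] by (metis of_nat_Suc)
      have "a x (near k z) \<in> carrier (G x) \<and> dx x (a x (near k z)) g < e" if "k \<ge> m" for k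
      proof -
        have "1 / Suc k \<le> 1 / Suc m" using that by (simp add: frac_le)
        then have "dx x (a x (near k z)) g < e" using dnear[of k] m by linarith
        then show ?thesis using a_closed by simp
      qed
      then show "\<exists>m. \<forall>k\<ge>m. a x (near k z) \<in> carrier (G x) \<and> dx x (a x (near k z)) g < e" by blast
    qed
    then have "limitin (T x) (\<lambda>k. a x (near k z)) g sequentially" unfolding mtop .
    from continuous_map_limit[OF dualD(4)[OF x(3)] this]
    have "(\<lambda>k. \<omega> (a x (near k z))) \<longlonglongrightarrow> \<omega> g" by (simp add: comp_def)
    then show "(\<lambda>k. snd (fst z) (a (fst (fst z)) (near k z))) \<longlonglongrightarrow> (case z of (x, xa) \<Rightarrow> (case x of (_, \<omega>) \<Rightarrow> \<lambda>(_, g). \<omega> g) xa)"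
      unfolding x_def \<omega>_def g_def by (simp add: case_prod_beta)
  qed
qed

lemma sets_sigma_dual_borel: "sets (sigma \<Omega> (sets dual_borel)) = sets dual_borel"
  using sets.sigma_sets_eq[of dual_borel] sets.space_closed[of dual_borel]
  by simp

lemma standard_Borel_cong:
  assumes "sets N = sets N'" "standard_Borel N"
  shows "standard_Borel N'"
proof -
  have "Borel_isomorphic N L = Borel_isomorphic N' L" for L :: "real measure"
    unfolding Borel_isomorphic_def measurable_cong_sets[OF assms(1) refl]
      measurable_cong_sets[OF refl assms(1)] sets_eq_imp_space_eq[OF assms(1)] ..
  then show ?thesis using assms(2) unfolding standard_Borel_def by (simp only:)
qed

theorem dual_borel_structure: "dual_Borel_structure X G T M (sets dual_borel)"
  unfolding dual_Borel_structure_def Let_def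
proof (intro conjI)
  let ?N = "sigma \<Omega> (sets dual_borel)"
  note s = sets_sigma_dual_borel
  show "sigma_algebra \<Omega> (sets dual_borel)" using sets.sigma_algebra_axioms[of dual_borel] by simp
  show "standard_Borel ?N" using standard_dual_borel by (rule standard_Borel_cong[OF s[symmetric]])
  show f: "fst \<in> ?N \<rightarrow>\<^sub>M X" using fst_dual_borel unfolding measurable_cong_sets[OF s refl] .
  show "(\<lambda>((_, \<omega>), (_, g)). \<omega> g) \<in> fibre_product ?N M \<rightarrow>\<^sub>M restrict_space borel (sphere 0 1)"
  proof (rule evaluation_measurable)
    show "space ?N = \<Omega>" using sets_eq_imp_space_eq[OF s] by simp
    show "(\<lambda>z. snd z (a (fst z) n)) \<in> borel_measurable ?N" for n
      using measurable_snd_coord unfolding measurable_cong_sets[OF s refl] .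
  qed (rule f)
qed

text \<open>Composing the evaluation with the sections makes \<open>coords\<close> measurable for
  any admissible structure, which gives one inclusion. For the other, \<open>coords\<close> is
  injective on a standard Borel space and therefore generates its whole structure.\<close>

theorem dual_borel_structure_unique:
  assumes "dual_Borel_structure X G T M \<Sigma>"
  shows "\<Sigma> = sets dual_borel"
proof -
  define N where "N = sigma \<Omega> \<Sigma>"
  have sa: "sigma_algebra \<Omega> \<Sigma>" and st: "standard_Borel N" and f: "fst \<in> N \<rightarrow>\<^sub>M X"
    and ev: "(\<lambda>((_, \<omega>), (_, g)). \<omega> g) \<in> fibre_product N M \<rightarrow>\<^sub>M restrict_space borel (sphere 0 1)"
    using assms unfolding dual_Borel_structure_def Let_def N_def by auto
  have sub: "\<Sigma> \<subseteq> Pow \<Omega>" using sa unfolding sigma_algebra_iff2 by simp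
  have sN: "sets N = \<Sigma>" and spN: "space N = \<Omega>"
    unfolding N_def using sigma_algebra.sigma_sets_eq[OF sa] sub by (simp_all add: space_measure_of_conv)
  \<comment> \<open>Pairing a character with the value of a section over the same base point lands
    in the fibre product, where evaluation is measurable.\<close>
  have "(\<lambda>z. (z, (fst z, a (fst z) n))) \<in> N \<rightarrow>\<^sub>M fibre_product N M" for n
    using measurable_compose[OF f a_measurable] by (intro measurable_fibre_product) auto
  from measurable_compose[OF this ev]
  have "(\<lambda>z. snd z (a (fst z) n)) \<in> N \<rightarrow>\<^sub>M restrict_space borel (sphere 0 1)" for n
    by (simp add: case_prod_beta)
  then have "(\<lambda>z. snd z (a (fst z) n)) \<in> borel_measurable N" for n
    by (simp add: measurable_restrict_space2_iff)
  then have id: "(\<lambda>z. z) \<in> N \<rightarrow>\<^sub>M dual_borel"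
    using f by (intro measurable_into_dual_borel) (auto simp: spN)
  have E: "coords \<in> borel_measurable N" using measurable_compose[OF id coords_measurable] .
  obtain i :: "_ \<Rightarrow> nat \<Rightarrow> real" where i: "borel_embedding N i" using standard_Borel_embedding[OF st] by auto
  show ?thesis
  proof (intro equalityI subsetI)
    fix A assume "A \<in> \<Sigma>"
    then have "A \<in> sets N" using sN by simp
    have "inj_on coords (space N)" using coords_inj spN by simp
    from injective_measurable_generates[OF i E this \<open>A \<in> sets N\<close>]
    show "A \<in> sets dual_borel" unfolding spN sets_dual_borel by auto
  next
    fix A assume A: "A \<in> sets dual_borel"
    then have "A \<subseteq> \<Omega>" using sets.sets_into_space by force
    then show "A \<in> \<Sigma>" using measurable_sets[OF id A] unfolding sN spN by (simp add: Int_absorb2 vimage_def)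
  qed
qed

section \<open>The dual field\<close>

text \<open>The value -1 makes the constraint vacuous when the word value lies outside the ball.
  Whether it does depends on \<open>x\<close> alone, so the function stays continuous in
  \<open>u\<close>.\<close>

definition constraint :: "nat \<Rightarrow> nat \<Rightarrow> 'x \<Rightarrow> (nat \<Rightarrow> complex) \<Rightarrow> real" where
  "constraint k i x u = (if dx x \<one>\<^bsub>G x\<^esub> (P x (from_nat i)) < 1 / Suc k
     then norm (torus_word u (from_nat i) - 1) - 1/2 else -1)"

lemma solutions_constraint: "solutions torus (constraint k) x = small_tuples k x"
proof -
  have "(\<forall>i. constraint k i x u \<le> 0) \<longleftrightarrow>
      (\<forall>w. dx x \<one>\<^bsub>G x\<^esub> (P x w) < 1 / Suc k \<longrightarrow> norm (torus_word u w - 1) \<le> 1/2)" for u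
  proof safe
    fix w assume "\<forall>i. constraint k i x u \<le> 0" "dx x \<one>\<^bsub>G x\<^esub> (P x w) < 1 / Suc k"
    from spec[OF this(1), of "to_nat w"] this(2) show "norm (torus_word u w - 1) \<le> 1/2"
      by (simp add: constraint_def)
  qed (simp add: constraint_def)
  then show ?thesis unfolding solutions_def small_tuples_def by simp
qed

lemma Caratheodory_constraint: "Caratheodory X torus (constraint k i)"
  unfolding Caratheodory_def
proof (intro conjI ballI)
  show "(\<lambda>x. constraint k i x u) \<in> borel_measurable X" for u
    unfolding constraint_def by measurable
  show "continuous_on torus (constraint k i x)" for x
    unfolding constraint_def
    by (cases "dx x \<one>\<^bsub>G x\<^esub> (P x (from_nat i)) < 1 / Suc k")
      (auto intro!: continuous_intros continuous_on_torus_word)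
qed

lemma torus_word_one: "torus_word (\<lambda>_. 1) w = 1"
  by (induction w) auto

lemma small_tuples_nonempty: "small_tuples k x \<noteq> {}"
  unfolding small_tuples_def torus_def by (auto intro!: exI[of _ "\<lambda>_. 1"] simp: torus_word_one)

text \<open>Minimising the distance to \<open>q\<close> comes first and makes the selection a
  nearest point. The remaining functionals are the real and imaginary parts of the coordinates,
  included so that every coordinate of the selected tuple is measurable.\<close>

lemma small_tuple_nearest:
  fixes q :: "nat \<Rightarrow> complex"
  shows "\<exists>s. (\<forall>n. (\<lambda>x. s x n) \<in> borel_measurable X) \<and>
    (\<forall>x\<in>space X. s x \<in> small_tuples k x \<and> (\<forall>u\<in>small_tuples k x. dist q (s x) \<le> dist q u))"
proof -
  define h where "h = case_nat (\<lambda>u :: nat \<Rightarrow> complex. dist q u)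
    (\<lambda>i u. if even i then Re (u (i div 2)) else Im (u (i div 2)))"
  have c: "continuous_on torus (\<lambda>u :: nat \<Rightarrow> complex. u i)" for i
    by (rule continuous_on_subset[OF continuous_on_product_coordinates]) auto
  have "continuous_on torus (h n)" for n
  proof (cases n)
    case 0 then show ?thesis by (auto simp: h_def intro!: continuous_intros)
  next
    case (Suc i) then show ?thesis
      by (cases "even i") (auto simp: h_def intro!: continuous_intros c)
  qed
  then have "\<exists>s. (\<forall>n::nat. (\<lambda>x. h n (s x)) \<in> borel_measurable X) \<and>
    (\<forall>x\<in>space X. s x \<in> solutions torus (constraint k) x \<and>
      (\<forall>u\<in>solutions torus (constraint k) x. h 0 (s x) \<le> h 0 u))"
    by (rule measurable_selection_minimising[OF compact_torus Caratheodory_constraint])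
      (simp add: solutions_constraint small_tuples_nonempty)
  then obtain s where s: "\<forall>n. (\<lambda>x. h n (s x)) \<in> borel_measurable X"
    "\<forall>x\<in>space X. s x \<in> small_tuples k x \<and> (\<forall>u\<in>small_tuples k x. h 0 (s x) \<le> h 0 u)"
    unfolding solutions_constraint by (elim exE conjE)
  have "(\<lambda>x. s x n) \<in> borel_measurable X" for n
  proof -
    have "(\<lambda>x. Re (s x n)) \<in> borel_measurable X" "(\<lambda>x. Im (s x n)) \<in> borel_measurable X"
      using spec[OF s(1), of "Suc (2 * n)"] spec[OF s(1), of "Suc (Suc (2 * n))"] by (simp_all add: h_def)
    then show ?thesis by (simp add: borel_measurable_complex_iff)
  qed
  then show ?thesis using s(2) by (intro exI[of _ s]) (simp add: h_def)
qed

text \<open>If \<open>q\<close> from a countable dense set is within \<open>e / 2\<close> of a small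
  tuple \<open>u\<close>, then a small tuple nearest to \<open>q\<close> is within \<open>e\<close>
  of \<open>u\<close>.\<close>

lemma dense_small_tuples:
  "\<exists>s :: nat \<Rightarrow> 'x \<Rightarrow> nat \<Rightarrow> complex. (\<forall>m n. (\<lambda>x. s m x n) \<in> borel_measurable X) \<and>
    (\<forall>m. \<forall>x\<in>space X. s m x \<in> small_tuples k x) \<and>
    (\<forall>x\<in>space X. \<forall>u\<in>small_tuples k x. \<forall>W. open W \<longrightarrow> u \<in> W \<longrightarrow> (\<exists>m. s m x \<in> W))"
proof -
  obtain Q :: "(nat \<Rightarrow> complex) set" where Q: "countable Q" "Q \<subseteq> torus" "torus \<subseteq> closure Q"
    using separable by blast
  have "\<forall>q. \<exists>s. (\<forall>n. (\<lambda>x. s x n) \<in> borel_measurable X) \<and>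
    (\<forall>x\<in>space X. s x \<in> small_tuples k x \<and> (\<forall>u\<in>small_tuples k x. dist q (s x) \<le> dist q u))"
    using small_tuple_nearest by auto
  from choice[OF this] obtain t where t0: "\<forall>q. (\<forall>n. (\<lambda>x. t q x n) \<in> borel_measurable X) \<and>
    (\<forall>x\<in>space X. t q x \<in> small_tuples k x \<and> (\<forall>u\<in>small_tuples k x. dist q (t q x) \<le> dist q u))"
    by (rule exE)
  have t: "\<And>q n. (\<lambda>x. t q x n) \<in> borel_measurable X"
    "\<And>q x. x \<in> space X \<Longrightarrow> t q x \<in> small_tuples k x"
    "\<And>q x u. x \<in> space X \<Longrightarrow> u \<in> small_tuples k x \<Longrightarrow> dist q (t q x) \<le> dist q u"
    using t0 by auto
  have "\<exists>m. t (from_nat_into Q m) x \<in> W"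
    if x: "x \<in> space X" and u: "u \<in> small_tuples k x" and W: "open W" "u \<in> W" for x u W
  proof -
    obtain e where e: "e > 0" "\<And>y. dist y u < e \<Longrightarrow> y \<in> W" using W unfolding open_dist by auto
    have "u \<in> closure Q" using u Q(3) unfolding small_tuples_def by auto
    then obtain q where q: "q \<in> Q" "dist q u < e / 2" using e(1) unfolding closure_approachable by (meson half_gt_zero)
    have "dist (t q x) u < e"
      using t(3)[OF x u, of q] q(2) dist_triangle3[of "t q x" u q] by simp
    moreover obtain m where "from_nat_into Q m = q" using from_nat_into_surj[OF Q(1) q(1)] by auto
    ultimately show ?thesis using e(2) by auto
  qed
  then show ?thesis using t(1,2) by (intro exI[of _ "\<lambda>m. t (from_nat_into Q m)"]) simp
qed

text \<open>All layers are merged into one sequence through \<open>prod_decode\<close>. A character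
  belongs to some layer \<open>k\<close>, and within that layer approximation of tuples in the
  product topology is approximation in \<open>\<delta>\<close>, hence in the compact-open
  topology.\<close>

lemma dense_dual_sections:
  "\<exists>\<psi> :: nat \<Rightarrow> 'x \<Rightarrow> 'g \<Rightarrow> complex. (\<forall>i. (\<lambda>x. (x, \<psi> i x)) \<in> X \<rightarrow>\<^sub>M dual_borel) \<and>
    (\<forall>x\<in>space X. dual_topology x closure_of range (\<lambda>i. \<psi> i x) =
      topspace (dual_topology x))"
proof -
  have "\<forall>k. \<exists>s :: nat \<Rightarrow> 'x \<Rightarrow> nat \<Rightarrow> complex. (\<forall>m n. (\<lambda>x. s m x n) \<in> borel_measurable X) \<and>
    (\<forall>m. \<forall>x\<in>space X. s m x \<in> small_tuples k x) \<and>
    (\<forall>x\<in>space X. \<forall>u\<in>small_tuples k x. \<forall>W. open W \<longrightarrow> u \<in> W \<longrightarrow> (\<exists>m. s m x \<in> W))"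
    using dense_small_tuples by auto
  from choice[OF this] obtain s :: "nat \<Rightarrow> nat \<Rightarrow> 'x \<Rightarrow> nat \<Rightarrow> complex"
    where s0: "\<forall>k. (\<forall>m n. (\<lambda>x. s k m x n) \<in> borel_measurable X) \<and>
      (\<forall>m. \<forall>x\<in>space X. s k m x \<in> small_tuples k x) \<and>
      (\<forall>x\<in>space X. \<forall>u\<in>small_tuples k x. \<forall>W. open W \<longrightarrow> u \<in> W \<longrightarrow> (\<exists>m. s k m x \<in> W))"
    by (rule exE)
  have s: "\<And>k m n. (\<lambda>x. s k m x n) \<in> borel_measurable X"
    "\<And>k m x. x \<in> space X \<Longrightarrow> s k m x \<in> small_tuples k x"
    "\<And>k x u W. x \<in> space X \<Longrightarrow> u \<in> small_tuples k x \<Longrightarrow> open W \<Longrightarrow> u \<in> W \<Longrightarrow> \<exists>m. s k m x \<in> W"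
    using s0 by simp_all
  define \<xi> where "\<xi> k m x = (SOME \<omega>. \<omega> \<in> carrier (dual_group x) \<and> (\<forall>n. \<omega> (a x n) = s k m x n))"
    for k m x
  have \<xi>: "\<xi> k m x \<in> carrier (dual_group x) \<and> (\<forall>n. \<xi> k m x (a x n) = s k m x n)"
    if x: "x \<in> space X" for k m x
  proof -
    have "\<exists>\<omega>. \<omega> \<in> carrier (dual_group x) \<and> (\<forall>n. \<omega> (a x n) = s k m x n)"
      using small_tuples_character[OF x s(2)[OF x, of k m]] unfolding Bex_def .
    from someI_ex[OF this] show ?thesis unfolding \<xi>_def .
  qed
  have meas: "(\<lambda>x. (x, \<xi> k m x)) \<in> X \<rightarrow>\<^sub>M dual_borel" for k m
  proof (rule measurable_into_dual_borel)
    show "(\<lambda>x. snd (x, \<xi> k m x) (a (fst (x, \<xi> k m x)) n)) \<in> borel_measurable X" for n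
      using s(1)[of k m n] \<xi> by (subst measurable_cong[of X _ "\<lambda>x. s k m x n"]) auto
  qed (use \<xi> in \<open>auto simp: mem_\<Omega>\<close>)
  define \<psi> where "\<psi> i = \<xi> (fst (prod_decode i)) (snd (prod_decode i))" for i
  have "dual_topology x closure_of range (\<lambda>i. \<psi> i x) =
      topspace (dual_topology x)" if x: "x \<in> space X" for x
  proof -
    interpret L: locally_compact_sequence_group "G x" "T x" "dx x" "a x" "R x"
      by (rule locally_compact_sequence_fibre[OF x])
    have "\<exists>y\<in>range (\<lambda>i. \<psi> i x). y \<in> L.dm.mball \<omega> e" if \<omega>: "\<omega> \<in> carrier L.dual" and e: "e > 0" for \<omega> e
    proof -
      obtain k where k: "(\<lambda>n. \<omega> (a x n)) \<in> small_tuples k x" using character_small_tuples[OF x \<omega>] by auto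
      have small: "L.small k u \<longleftrightarrow> u \<in> small_tuples k x" if "u \<in> torus" for u
        using that unfolding L.small_def small_tuples_def by simp
      then have "L.small k (\<lambda>n. \<omega> (a x n))" using k L.dual_torus[OF \<omega>] by simp
      from L.small_approximation[OF \<omega> this e] obtain W where W: "open W" "(\<lambda>n. \<omega> (a x n)) \<in> W"
        "\<forall>\<eta>\<in>carrier L.dual. L.small k (\<lambda>n. \<eta> (a x n)) \<longrightarrow> (\<lambda>n. \<eta> (a x n)) \<in> W \<longrightarrow> L.\<delta> \<omega> \<eta> < e"
        by (elim exE conjE)
      obtain m where m: "s k m x \<in> W" using s(3)[OF x k W(1,2)] by auto
      have \<xi>s: "(\<lambda>n. \<xi> k m x (a x n)) = s k m x" using \<xi>[OF x] by auto
      have "s k m x \<in> torus" using s(2)[OF x] unfolding small_tuples_def by auto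
      then have "L.small k (s k m x)" using small s(2)[OF x] by simp
      then have "L.\<delta> \<omega> (\<xi> k m x) < e" using W(3) \<xi>[OF x, of k m] m \<xi>s by simp
      then have "\<xi> k m x \<in> L.dm.mball \<omega> e" using \<omega> \<xi>[OF x, of k m] by simp
      moreover have "\<xi> k m x = \<psi> (prod_encode (k, m)) x" unfolding \<psi>_def by simp
      ultimately show ?thesis by (intro bexI[of _ "\<xi> k m x"]) auto
    qed
    then show ?thesis unfolding L.mtopology_dual[symmetric] L.dm.metric_closure_of by auto
  qed
  moreover have "(\<lambda>x. (x, \<psi> i x)) \<in> X \<rightarrow>\<^sub>M dual_borel" for i unfolding \<psi>_def by (rule meas)
  ultimately show ?thesis by blast
qed

lemma word_evaluation_measurable:
  "(\<lambda>z. snd z (P (fst z) w)) \<in> borel_measurable dual_borel"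
proof -
  have "(\<lambda>c :: (nat \<Rightarrow> real) \<times> (nat \<Rightarrow> complex). torus_word (snd c) w) \<in> borel_measurable borel"
    by (intro borel_measurable_continuous_onI continuous_on_compose2[OF continuous_on_torus_word[of UNIV] continuous_on_snd[OF continuous_on_id]]) auto
  from measurable_compose[OF coords_measurable this]
  have "(\<lambda>z. torus_word (snd (coords z)) w) \<in> borel_measurable dual_borel" .
  moreover have "snd z (P (fst z) w) = torus_word (snd (coords z)) w" if "z \<in> space dual_borel" for z
  proof -
    have z: "fst z \<in> space X" "snd z \<in> carrier (dual_group (fst z))"
      using that by (simp_all add: mem_\<Omega>)
    interpret dense_sequence_group "G (fst z)" "T (fst z)" "dx (fst z)" "a (fst z)"
      by (rule dense_sequence_fibre[OF z(1)])
    show ?thesis unfolding coords_def using dual_word[OF z(2)] by simp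
  qed
  ultimately show ?thesis by (subst measurable_cong)
qed

definition dual_metric :: "('x \<times> ('g \<Rightarrow> complex)) \<times> ('x \<times> ('g \<Rightarrow> complex)) \<Rightarrow> real" where
  "dual_metric = (\<lambda>((x, \<omega>), (_, \<eta>)). locally_compact_sequence_group.\<delta> (G x) (T x) (dx x) (a x) (R x) \<omega> \<eta>)"

text \<open>The metric is a supremum of measurable functions over the countable type of words;
  membership of a word value in \<open>U\<close> is a measurable comparison of its distance to the
  unit with the radius \<open>R\<close>. The common bound 2 keeps the real supremum
  meaningful.\<close>

lemma dual_metric_measurable: "dual_metric \<in> borel_measurable (fibre_product dual_borel dual_borel)"
proof -
  let ?F = "fibre_product dual_borel dual_borel"
  let ?w = "\<lambda>w z. (if dx (fst (fst z)) \<one>\<^bsub>G (fst (fst z))\<^esub> (P (fst (fst z)) w) < R (fst (fst z)) then 1 else (1/2) ^ to_nat w)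
    * norm (snd (fst z) (P (fst (fst z)) w) - snd (snd z) (P (fst (fst z)) w))"
  have p: "fst \<in> ?F \<rightarrow>\<^sub>M dual_borel" "snd \<in> ?F \<rightarrow>\<^sub>M dual_borel"
    by (rule measurable_fibre_product_projections)+
  have x: "(\<lambda>z. fst (fst z)) \<in> ?F \<rightarrow>\<^sub>M X" by (rule measurable_compose[OF p(1) fst_dual_borel])
  have sp: "fst (fst z) \<in> space X \<and> fst (snd z) = fst (fst z) \<and>
      snd (fst z) \<in> carrier (dual_group (fst (fst z))) \<and>
      snd (snd z) \<in> carrier (dual_group (fst (fst z)))" if "z \<in> space ?F" for z
    using that unfolding space_fibre_product by (auto simp: mem_\<Omega>)
  have [measurable]: "(\<lambda>z. dx (fst (fst z)) \<one>\<^bsub>G (fst (fst z))\<^esub> (P (fst (fst z)) w)) \<in> borel_measurable ?F" for w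
    by (rule measurable_compose[OF x dx_one_measurable])
  have [measurable]: "(\<lambda>z. R (fst (fst z))) \<in> borel_measurable ?F"
    by (rule measurable_compose[OF x R_measurable])
  have [measurable]: "(\<lambda>z. snd (fst z) (P (fst (fst z)) w)) \<in> borel_measurable ?F" for w
    by (rule measurable_compose[OF p(1) word_evaluation_measurable])
  have "(\<lambda>z. snd (snd z) (P (fst (snd z)) w)) \<in> borel_measurable ?F" for w
    by (rule measurable_compose[OF p(2) word_evaluation_measurable])
  then have [measurable]: "(\<lambda>z. snd (snd z) (P (fst (fst z)) w)) \<in> borel_measurable ?F" for w
    using sp by (subst measurable_cong[of ?F _ "\<lambda>z. snd (snd z) (P (fst (snd z)) w)"]) auto
  have w: "?w w \<in> borel_measurable ?F" for w by measurable
  have eq: "dual_metric z = (SUP w. ?w w z) \<and> bdd_above (range (\<lambda>w. ?w w z))" if z: "z \<in> space ?F" for z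
  proof -
    interpret L: locally_compact_sequence_group "G (fst (fst z))" "T (fst (fst z))" "dx (fst (fst z))" "a (fst (fst z))" "R (fst (fst z))"
      using sp[OF z] by (intro locally_compact_sequence_fibre) simp
    have eq: "?w w z = L.weight w * norm (snd (fst z) (L.p w) - snd (snd z) (L.p w))" for w
      unfolding L.weight_def by simp
    have "?w w z \<le> 2" for w unfolding eq using sp[OF z] by (intro L.weighted_le_2) auto
    then have "bdd_above (range (\<lambda>w. ?w w z))" by (intro bdd_aboveI[of _ 2]) auto
    moreover have "dual_metric z = (SUP w. ?w w z)"
      unfolding eq dual_metric_def using sp[OF z] by (simp add: case_prod_beta L.\<delta>_def)
    ultimately show ?thesis by simp
  qed
  have "(\<lambda>z. SUP w. ?w w z) \<in> borel_measurable ?F"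
    using eq w by (intro borel_measurable_cSUP) auto
  then show ?thesis using eq by (subst measurable_cong[of ?F _ "\<lambda>z. SUP w. ?w w z"]) auto
qed

theorem dual_field_of_Polish_spaces:
  "Borel_field_of_Polish_spaces X (\<lambda>x. dual_topology x) dual_borel"
proof -
  have fibre: "Metric_space.mtopology (carrier (dual_group x)) (\<lambda>v w. dual_metric ((x, v), (x, w))) = dual_topology x"
    "Metric_space (carrier (dual_group x)) (\<lambda>v w. dual_metric ((x, v), (x, w)))"
    "Metric_space.mcomplete (carrier (dual_group x)) (\<lambda>v w. dual_metric ((x, v), (x, w)))"
    "topspace (dual_topology x) = carrier (dual_group x)"
    "0 \<le> dual_metric ((x, v), (x, w))"
    if x: "x \<in> space X" for x v w
  proof -
    interpret L: locally_compact_sequence_group "G x" "T x" "dx x" "a x" "R x"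
      by (rule locally_compact_sequence_fibre[OF x])
    have \<delta>: "(\<lambda>v w. dual_metric ((x, v), (x, w))) = L.\<delta>" unfolding dual_metric_def by simp
    show "Metric_space.mtopology (carrier L.dual) (\<lambda>v w. dual_metric ((x, v), (x, w))) = L.dual_top"
      unfolding \<delta> by (rule L.mtopology_dual)
    show "Metric_space (carrier L.dual) (\<lambda>v w. dual_metric ((x, v), (x, w)))"
      unfolding \<delta> by (rule L.\<delta>_metric)
    show "Metric_space.mcomplete (carrier L.dual) (\<lambda>v w. dual_metric ((x, v), (x, w)))"
      unfolding \<delta> by (rule L.\<delta>_complete)
    show "topspace L.dual_top = carrier L.dual" by (rule L.topspace_dual)
    show "0 \<le> dual_metric ((x, v), (x, w))" unfolding dual_metric_def using L.\<delta>_nonneg by simp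
  qed
  obtain \<psi> :: "nat \<Rightarrow> 'x \<Rightarrow> 'g \<Rightarrow> complex" where \<psi>: "\<And>i. (\<lambda>x. (x, \<psi> i x)) \<in> X \<rightarrow>\<^sub>M dual_borel"
    "\<And>x. x \<in> space X \<Longrightarrow> dual_topology x closure_of range (\<lambda>i. \<psi> i x) =
      topspace (dual_topology x)"
    using dense_dual_sections by auto
  have sep: "separable_space (dual_topology x)" if x: "x \<in> space X" for x
    unfolding separable_space_def
  proof (intro exI[of _ "range (\<lambda>i. \<psi> i x)"] conjI \<psi>(2)[OF x])
    show "range (\<lambda>i. \<psi> i x) \<subseteq> topspace (dual_topology x)"
      using measurable_space[OF \<psi>(1) x] fibre(4)[OF x] by (auto simp: mem_\<Omega>)
  qed simp
  have dm: "dual_metric \<in> fibre_product dual_borel dual_borel \<rightarrow>\<^sub>M restrict_space borel {0..}"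
    using fibre(5) by (intro measurable_restrict_space2 dual_metric_measurable)
      (auto simp: space_fibre_product mem_\<Omega>)
  show ?thesis
    unfolding Borel_field_of_Polish_spaces_def
  proof (intro conjI ballI)
    show "standard_Borel X" "standard_Borel dual_borel" by (rule standard_X standard_dual_borel)+
    show "Polish_topology (dual_topology x)" if x: "x \<in> space X" for x
      unfolding Polish_topology_def
      using sep[OF x] Metric_space.completely_metrizable_space_mtopology[OF fibre(2)[OF x] fibre(3)[OF x]]
      unfolding fibre(1)[OF x] by simp
    show "space dual_borel = total_space X (\<lambda>x. dual_topology x)"
      using fibre(4) unfolding space_dual_borel dual_total_space_def total_space_def by auto
    show "fst \<in> dual_borel \<rightarrow>\<^sub>M X" by (rule fst_dual_borel)
    show "\<exists>d. d \<in> fibre_product dual_borel dual_borel \<rightarrow>\<^sub>M restrict_space borel {0..} \<and>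
        (\<forall>x\<in>space X. let d\<^sub>x = \<lambda>v w. d ((x, v), x, w) in
          Metric_space (topspace (dual_topology x)) d\<^sub>x \<and>
          Metric_space.mcomplete (topspace (dual_topology x)) d\<^sub>x \<and>
          Metric_space.mtopology (topspace (dual_topology x)) d\<^sub>x = dual_topology x \<and>
          separable_space (Metric_space.mtopology (topspace (dual_topology x)) d\<^sub>x))"
      using dm fibre(1-4) sep by (intro exI[of _ dual_metric]) (simp add: Let_def)
    show "\<exists>\<psi> :: nat \<Rightarrow> 'x \<Rightarrow> 'x \<times> ('g \<Rightarrow> complex). (\<forall>n. Borel_section X dual_borel (\<psi> n)) \<and>
        (\<forall>x\<in>space X. dual_topology x closure_of range (\<lambda>n. snd (\<psi> n x)) =
          topspace (dual_topology x))"
      using \<psi> by (intro exI[of _ "\<lambda>i x. (x, \<psi> i x)"]) (simp add: Borel_section_def)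
  qed
qed

text \<open>Each operation is tested through its values at the sections, where the unit is
  constantly 1, inversion is conjugation and multiplication is pointwise.\<close>

theorem dual_field_of_Polish_groups:
  "Borel_field_of_Polish_groups X (\<lambda>x. dual_group x)
     (\<lambda>x. dual_topology x) dual_borel"
  unfolding Borel_field_of_Polish_groups_def
proof (intro conjI ballI dual_field_of_Polish_spaces)
  fix x assume x: "x \<in> space X"
  interpret L: locally_compact_sequence_group "G x" "T x" "dx x" "a x" "R x"
    by (rule locally_compact_sequence_fibre[OF x])
  show "Polish_group L.dual L.dual_top"
    using L.topological_group_dual dual_field_of_Polish_spaces x
    unfolding Polish_group_def Borel_field_of_Polish_spaces_def by simp
next
  have a: "a x n \<in> carrier (G x)" if x: "x \<in> space X" for x n
    using dense_sequence_group.a_closed[OF dense_sequence_fibre[OF x]] .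
  note L = locally_compact_sequence_fibre
  show "(\<lambda>x. (x, \<one>\<^bsub>dual_group x\<^esub>)) \<in> X \<rightarrow>\<^sub>M dual_borel"
  proof (rule measurable_into_dual_borel)
    show "(x, \<one>\<^bsub>dual_group x\<^esub>) \<in> \<Omega>" if "x \<in> space X" for x
      using that locally_compact_sequence_group.one_dual_closed[OF L[OF that]] by (simp add: mem_\<Omega>)
    show "(\<lambda>x. snd (x, \<one>\<^bsub>dual_group x\<^esub>) (a (fst (x, \<one>\<^bsub>dual_group x\<^esub>)) n)) \<in> borel_measurable X" for n
      using a by (subst measurable_cong[of X _ "\<lambda>x. 1"]) auto
  qed simp
  let ?i = "\<lambda>(x, \<omega>). (x, inv\<^bsub>dual_group x\<^esub> \<omega>)"
  show "?i \<in> dual_borel \<rightarrow>\<^sub>M dual_borel"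
  proof (rule measurable_into_dual_borel)
    fix z assume "z \<in> space dual_borel"
    then have z: "fst z \<in> space X" "snd z \<in> carrier (dual_group (fst z))"
      by (simp_all add: mem_\<Omega>)
    interpret dg: group "dual_group (fst z)"
      by (rule locally_compact_sequence_group.group_dual[OF L[OF z(1)]])
    show "?i z \<in> \<Omega>"
      using z dg.inv_closed[OF z(2)] by (simp add: case_prod_beta mem_\<Omega>)
  next
    show "(\<lambda>z. fst (?i z)) \<in> dual_borel \<rightarrow>\<^sub>M X"
      using fst_dual_borel by (simp add: case_prod_beta)
    fix n
    have "snd (?i z)
        (a (fst (?i z)) n) = cnj (snd z (a (fst z) n))"
      if "z \<in> space dual_borel" for z
      using that locally_compact_sequence_group.inv_dual[OF L] a by (simp add: case_prod_beta mem_\<Omega>)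
    moreover have "(\<lambda>z. cnj (snd z (a (fst z) n))) \<in> borel_measurable dual_borel"
      by (rule measurable_compose[OF measurable_snd_coord])
        (intro borel_measurable_continuous_onI continuous_intros)
    ultimately show "(\<lambda>z. snd (?i z)
        (a (fst (?i z)) n)) \<in> borel_measurable dual_borel"
      by (subst measurable_cong)
  qed
  let ?F = "fibre_product dual_borel dual_borel"
  let ?m = "\<lambda>((x, \<omega>), (_, \<eta>)). (x, \<omega> \<otimes>\<^bsub>dual_group x\<^esub> \<eta>)"
  show "?m \<in> ?F \<rightarrow>\<^sub>M dual_borel"
  proof (rule measurable_into_dual_borel)
    fix z assume "z \<in> space ?F"
    then have z: "fst (fst z) \<in> space X" "snd (fst z) \<in> carrier (dual_group (fst (fst z)))"
      "snd (snd z) \<in> carrier (dual_group (fst (fst z)))"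
      by (auto simp: space_fibre_product mem_\<Omega>)
    show "?m z \<in> \<Omega>"
      using z locally_compact_sequence_group.mult_dual_closed[OF L[OF z(1)] z(2,3)] by (simp add: case_prod_beta mem_\<Omega>)
  next
    have p: "fst \<in> ?F \<rightarrow>\<^sub>M dual_borel" "snd \<in> ?F \<rightarrow>\<^sub>M dual_borel"
      by (rule measurable_fibre_product_projections)+
    show "(\<lambda>z. fst (?m z)) \<in> ?F \<rightarrow>\<^sub>M X"
      using measurable_compose[OF p(1) fst_dual_borel] by (simp add: case_prod_beta)
    fix n
    have "snd (?m z) (a (fst (?m z)) n) = snd (fst z) (a (fst (fst z)) n) * snd (snd z) (a (fst (snd z)) n)"
      if "z \<in> space ?F" for z
      using that a by (auto simp: case_prod_beta mem_\<Omega> space_fibre_product)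
    moreover have "(\<lambda>z. snd (fst z) (a (fst (fst z)) n) * snd (snd z) (a (fst (snd z)) n)) \<in> borel_measurable ?F"
      by (intro borel_measurable_times measurable_compose[OF p(1) measurable_snd_coord]
          measurable_compose[OF p(2) measurable_snd_coord])
    ultimately show "(\<lambda>z. snd (?m z) (a (fst (?m z)) n)) \<in> borel_measurable ?F"
      by (subst measurable_cong)
  qed
qed

text \<open>Only the space and the sigma-algebra of the measure enter the definition. This passes
  from \<open>dual_borel\<close> to \<open>sigma\<close> applied to its sets, the form that the
  final statement uses.\<close>

lemma Borel_field_of_Polish_groups_cong:
  assumes s: "sets N = sets N'" and "Borel_field_of_Polish_groups X H S N"
  shows "Borel_field_of_Polish_groups X H S N'"
proof -
  have st: "standard_Borel N \<longleftrightarrow> standard_Borel N'"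
    using standard_Borel_cong[of N N'] standard_Borel_cong[of N' N] s by auto
  have f: "sets (fibre_product N N) = sets (fibre_product N' N')"
    unfolding fibre_product_def sets_restrict_space sets_eq_imp_space_eq[OF s] sets_pair_measure_cong[OF s s] ..
  show ?thesis
    using assms(2)
    unfolding Borel_field_of_Polish_groups_def Borel_field_of_Polish_spaces_def Borel_section_def st
      sets_eq_imp_space_eq[OF s] measurable_cong_sets[OF s refl] measurable_cong_sets[OF refl s]
      measurable_cong_sets[OF s s] measurable_cong_sets[OF f refl] measurable_cong_sets[OF f s] .
qed

end

theorem proposition10p1:
  fixes X :: "'x measure"
    and G :: "'x \<Rightarrow> ('g, 'm) monoid_scheme"
    and T :: "'x \<Rightarrow> 'g topology"
    and M :: "('x \<times> 'g) measure"
  assumes "Borel_field_of_Polish_groups X G T M"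
    and "\<forall>x\<in>space X. locally_compact_space (T x)"
  shows "(\<exists>!\<Sigma>. dual_Borel_structure X G T M \<Sigma>) \<and>
    (\<forall>\<Sigma>. dual_Borel_structure X G T M \<Sigma> \<longrightarrow>
       Borel_field_of_Polish_groups X
         (\<lambda>x. Pontryagin_dual (G x) (T x))
         (\<lambda>x. Pontryagin_dual_topology (G x) (T x))
         (sigma (dual_total_space X G T) \<Sigma>))"
proof -
  have "Borel_field_of_Polish_spaces X T M"
    using assms(1) unfolding Borel_field_of_Polish_groups_def by simp
  then obtain d \<phi> where d: "d \<in> fibre_product M M \<rightarrow>\<^sub>M restrict_space borel {0..}"
    "\<forall>x\<in>space X. let d\<^sub>x = (\<lambda>v w. d ((x, v), (x, w))) in
       Metric_space (topspace (T x)) d\<^sub>x \<and>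
       Metric_space.mcomplete (topspace (T x)) d\<^sub>x \<and>
       Metric_space.mtopology (topspace (T x)) d\<^sub>x = T x \<and>
       separable_space (Metric_space.mtopology (topspace (T x)) d\<^sub>x)"
    and \<phi>: "\<forall>n :: nat. Borel_section X M (\<phi> n)"
    "\<forall>x\<in>space X. T x closure_of (range (\<lambda>n. snd (\<phi> n x))) = topspace (T x)"
    unfolding Borel_field_of_Polish_spaces_def by (elim exE conjE)
  \<comment> \<open>Any choice of metric and dense sections will do: by uniqueness the resulting
    sigma-algebra does not depend on it.\<close>
  interpret locally_compact_group_field X G T M d \<phi>
  proof (rule locally_compact_group_field.intro)
    show "d \<in> borel_measurable (fibre_product M M)"
      using d(1) by (simp add: measurable_restrict_space2_iff)
  qed (use assms d(2) \<phi> in \<open>simp_all add: Let_def\<close>)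
  note s = sets_sigma_dual_borel
  have field: "Borel_field_of_Polish_groups X (\<lambda>x. Pontryagin_dual (G x) (T x))
      (\<lambda>x. Pontryagin_dual_topology (G x) (T x)) (sigma \<Omega> (sets dual_borel))"
    by (rule Borel_field_of_Polish_groups_cong[OF s[symmetric] dual_field_of_Polish_groups])
  show ?thesis
  proof (intro conjI allI impI)
    show "\<exists>!\<Sigma>. dual_Borel_structure X G T M \<Sigma>"
      using dual_borel_structure dual_borel_structure_unique by (rule ex1I)
    fix \<Sigma> assume "dual_Borel_structure X G T M \<Sigma>"
    then have "\<Sigma> = sets dual_borel" by (rule dual_borel_structure_unique)
    then show "Borel_field_of_Polish_groups X (\<lambda>x. Pontryagin_dual (G x) (T x))
      (\<lambda>x. Pontryagin_dual_topology (G x) (T x)) (sigma \<Omega> \<Sigma>)" using field by simp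
  qed
qed

end
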